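(* Let $G:\mathbb{D}\to\mathbb{C}$ be holomorphic and let $\delta>0$. Suppose that there exists $\epsilon>0$ such that $$\operatorname{Re}(\overline{z}\,G(z))\le-\delta\qquad\text{for all } z \text{ with } 1-\epsilon<|z|<1.$$ Then $A$, defined by $Af=Gf'$, generates an immediately compact semigroup of composition operators on $H^2(\mathbb{D})$ and on $\mathcal{D}$. Indeed, the semigroup is immediately trace-class.
   Context: $\mathbb{D}$ is the open unit disc. $H^2(\mathbb{D})$ is the Hilbert space of analytic $f(z)=\sum_{n\ge0}c_nz^n$ on $\mathbb{D}$ with $\|f\|^2=\sum_{n\ge 0}|c_n|^2<\infty$; $\mathcal{D}$ is the Dirichlet space, with $\|f\|^2=|c_0|^2+\sum_{n\ge1}n|c_n|^2<\infty$. For $X=H^2(\mathbb{D})$ or $\mathcal{D}$ the domain of $A$ is the natural one, $\{f\in X: Gf'\in X\}$. A $C_0$-semigroup $(T(t))_{t\ge0}$ on $X$ is a family of bounded operators with $T(0)=I$, $T(t+s)=T(t)T(s)$ and $\lim_{t\to0}T(t)x=x$ for all $x\in X$. Its generator is $Ax=\lim_{t\to0^+}(T(t)x-x)/t$, with domain the set of $x$ for which this limit exists. "Semigroup" here means $C_0$-semigroup. A composition operator is an operator $C_\varphi f=f\circ\varphi$ with $\varphi:\mathbb{D}\to\mathbb{D}$ analytic. A semigroup $(T(t))_{t\ge0}$ is immediately compact (respectively immediately trace-class) if $T(t)$ is compact (respectively trace-class) for all $t>0$. *)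

theory Defs
  imports "HOL-Complex_Analysis.Complex_Analysis"
begin

section \<open>Hilbert spaces of functions on the unit disc\<close>

abbreviation unit_disc :: "complex set"
  where "unit_disc \<equiv> ball 0 1"

text \<open>A function on the disc is represented by its extension by 0 to the whole plane, so that
  equality in HOL is equality on the disc and the extensions form a vector space under the
  pointwise operations.\<close>

definition on_disc :: "(complex \<Rightarrow> complex) \<Rightarrow> complex \<Rightarrow> complex"
  where "on_disc f = (\<lambda>z. if z \<in> unit_disc then f z else 0)"

text \<open>A complex Hilbert space whose vectors are functions, with the pointwise vector space
  operations; the inner product is linear in its first argument. Both fields are only meaningful
  on \<open>vecs\<close>.\<close>

record fun_space =
  vecs :: "(complex \<Rightarrow> complex) set"
  ip :: "(complex \<Rightarrow> complex) \<Rightarrow> (complex \<Rightarrow> complex) \<Rightarrow> complex"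

definition taylor_coeff :: "(complex \<Rightarrow> complex) \<Rightarrow> nat \<Rightarrow> complex"
  where "taylor_coeff f n = (deriv ^^ n) f 0 / fact n"

definition weighted_space :: "(nat \<Rightarrow> real) \<Rightarrow> fun_space"
  where "weighted_space w =
    \<lparr>vecs = {f. f holomorphic_on unit_disc \<and> (\<forall>z. z \<notin> unit_disc \<longrightarrow> f z = 0) \<and>
               summable (\<lambda>n. w n * (norm (taylor_coeff f n))\<^sup>2)},
     ip = (\<lambda>f g. \<Sum>n. of_real (w n) * taylor_coeff f n * cnj (taylor_coeff g n))\<rparr>"

definition hardy_space :: fun_space
  where "hardy_space = weighted_space (\<lambda>n. 1)"

definition dirichlet_space :: fun_space
  where "dirichlet_space = weighted_space (\<lambda>n. if n = 0 then 1 else real n)"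

definition hnorm :: "fun_space \<Rightarrow> (complex \<Rightarrow> complex) \<Rightarrow> real"
  where "hnorm H f = sqrt (Re (ip H f f))"

text \<open>The value 0 off the space is there because the library's metric spaces ask for
  nonnegativity and symmetry everywhere, not only on the carrier.\<close>

definition hdist :: "fun_space \<Rightarrow> (complex \<Rightarrow> complex) \<Rightarrow> (complex \<Rightarrow> complex) \<Rightarrow> real"
  where "hdist H f g = (if f \<in> vecs H \<and> g \<in> vecs H then hnorm H (\<lambda>z. f z - g z) else 0)"

definition htopology :: "fun_space \<Rightarrow> (complex \<Rightarrow> complex) topology"
  where "htopology H = Metric_space.mtopology (vecs H) (hdist H)"

text \<open>The metric space axioms hold for both spaces, so \<open>htopology\<close> is their norm topology.\<close>

lemma taylor_coeff_diff:
  assumes "f holomorphic_on unit_disc" "g holomorphic_on unit_disc"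
  shows "taylor_coeff (\<lambda>z. f z - g z) n = taylor_coeff f n - taylor_coeff g n"
  unfolding taylor_coeff_def using higher_deriv_diff[OF assms, of 0 n] by (simp add: diff_divide_distrib)

lemma weighted_l2_triangle:
  fixes w :: "nat \<Rightarrow> real" and a b :: "nat \<Rightarrow> complex"
  assumes w: "\<And>n. w n > 0"
    and a: "summable (\<lambda>n. w n * (norm (a n))\<^sup>2)"
    and b: "summable (\<lambda>n. w n * (norm (b n))\<^sup>2)"
  shows "summable (\<lambda>n. w n * (norm (a n + b n))\<^sup>2) \<and>
   sqrt (\<Sum>n. w n * (norm (a n + b n))\<^sup>2) \<le> sqrt (\<Sum>n. w n * (norm (a n))\<^sup>2) + sqrt (\<Sum>n. w n * (norm (b n))\<^sup>2)"
proof -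
  let ?S = "\<lambda>c::nat\<Rightarrow>complex. (\<lambda>n. w n * (norm (c n))\<^sup>2)"
  have L: "sqrt (sum (?S c) {..<m}) = L2_set (\<lambda>n. sqrt (w n) * norm (c n)) {..<m}" for c m
    unfolding L2_set_def using w by (simp add: power_mult_distrib less_imp_le)
  have nn: "?S c n \<ge> 0" for c n using w[of n] by simp
  have fin: "sqrt (sum (?S (\<lambda>n. a n + b n)) {..<m}) \<le> sqrt (suminf (?S a)) + sqrt (suminf (?S b))" for m
  proof -
    have "sqrt (sum (?S (\<lambda>n. a n + b n)) {..<m}) \<le> L2_set (\<lambda>n. sqrt (w n) * norm (a n) + sqrt (w n) * norm (b n)) {..<m}"
      unfolding L by (rule L2_set_mono) (use w in \<open>auto simp: distrib_left[symmetric] less_imp_le intro!: mult_left_mono norm_triangle_ineq\<close>)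
    also have "\<dots> \<le> sqrt (sum (?S a) {..<m}) + sqrt (sum (?S b) {..<m})"
      unfolding L by (rule L2_set_triangle_ineq)
    also have "\<dots> \<le> sqrt (suminf (?S a)) + sqrt (suminf (?S b))"
      using sum_le_suminf[OF a, of "{..<m}"] sum_le_suminf[OF b, of "{..<m}"] nn
      by (intro add_mono real_sqrt_le_mono) auto
    finally show ?thesis .
  qed
  let ?R = "sqrt (suminf (?S a)) + sqrt (suminf (?S b))"
  have R0: "?R \<ge> 0" using suminf_nonneg[OF a] suminf_nonneg[OF b] nn by (metis add_nonneg_nonneg real_sqrt_ge_0_iff)
  have bd: "sum (?S (\<lambda>n. a n + b n)) {..<m} \<le> ?R\<^sup>2" for m
    using fin[of m] sqrt_le_D by blast
  have s: "summable (?S (\<lambda>n. a n + b n))"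
    by (rule summableI_nonneg_bounded[of _ "?R\<^sup>2"]) (use nn bd in auto)
  have "suminf (?S (\<lambda>n. a n + b n)) \<le> ?R\<^sup>2"
    by (rule suminf_le_const[OF s]) (rule bd)
  then show ?thesis using s R0 real_le_lsqrt by blast
qed

lemma Metric_space_weighted_space:
  assumes w: "\<And>n. w n > (0::real)"
  shows "Metric_space (vecs (weighted_space w)) (hdist (weighted_space w))"
proof -
  let ?H = "weighted_space w" let ?V = "vecs (weighted_space w)"
  let ?S = "\<lambda>f. (\<lambda>n. w n * (norm (taylor_coeff f n))\<^sup>2)"
  have hol: "f holomorphic_on unit_disc" and sm: "summable (?S f)" and off: "\<And>z. z \<notin> unit_disc \<Longrightarrow> f z = 0"
    if "f \<in> ?V" for f using that unfolding weighted_space_def by auto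
  have D: "taylor_coeff (\<lambda>z. f z - g z) n = taylor_coeff f n - taylor_coeff g n"
    if "f \<in> ?V" "g \<in> ?V" for f g n using taylor_coeff_diff hol that by blast
  have V: "(\<lambda>z. f z - g z) \<in> ?V" if fg: "f \<in> ?V" "g \<in> ?V" for f g
  proof -
    have "summable (?S (\<lambda>z. f z - g z))"
      using weighted_l2_triangle[OF w sm[OF fg(1)], of "\<lambda>n. - taylor_coeff g n"] sm[OF fg(2)] by (simp add: D[OF fg])
    moreover have "(\<lambda>z. f z - g z) holomorphic_on unit_disc" using hol fg by (intro holomorphic_intros) auto
    ultimately show ?thesis using off fg unfolding weighted_space_def by auto
  qed
  have nrm: "hnorm ?H f = sqrt (suminf (?S f))" if "f \<in> ?V" for f
  proof -
    have "of_real (w n) * taylor_coeff f n * cnj (taylor_coeff f n) = of_real (?S f n)" for n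
      by (simp add: complex_norm_square[symmetric] mult.assoc)
    then have "ip ?H f f = of_real (suminf (?S f))" unfolding weighted_space_def
      using suminf_of_real[OF sm[OF that], where 'a=complex] by (simp only: fun_space.simps)
    then show ?thesis by (simp add: hnorm_def)
  qed
  have nn: "?S f n \<ge> 0" for f n using w[of n] by simp
  show ?thesis
  proof
    fix x y show "0 \<le> hdist ?H x y" using V nrm suminf_nonneg[OF sm nn] by (auto simp: hdist_def)
    show "hdist ?H x y = hdist ?H y x" 
      by (auto simp: hdist_def nrm V D norm_minus_commute)
  next
    fix x y assume xy: "x \<in> ?V" "y \<in> ?V"
    show "hdist ?H x y = 0 \<longleftrightarrow> x = y"
    proof
      assume "hdist ?H x y = 0"
      then have "suminf (?S (\<lambda>z. x z - y z)) = 0" using xy by (simp add: hdist_def nrm V)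
      then have "?S (\<lambda>z. x z - y z) n = 0" for n
        using suminf_eq_zero_iff[OF sm[OF V[OF xy]] nn] by blast
      then have "taylor_coeff (\<lambda>z. x z - y z) n = 0" for n using w[of n] by (metis less_irrefl mult_eq_0_iff norm_eq_zero zero_eq_power2)
      then have z: "(deriv ^^ n) (\<lambda>z. x z - y z) 0 = 0" for n
        unfolding taylor_coeff_def by simp
      show "x = y"
      proof
        fix z show "x z = y z"
          using holomorphic_fun_eq_0_on_ball[OF hol[OF V[OF xy]] _ z, of z] off[OF xy(1), of z] off[OF xy(2), of z] by force
      qed
    next
      assume "x = y" then show "hdist ?H x y = 0" 
        using xy nrm[OF V[OF xy(1) xy(1)]] D[OF xy(1) xy(1)] by (simp add: hdist_def)
    qed
  next
    fix x y z assume xyz: "x \<in> ?V" "y \<in> ?V" "z \<in> ?V"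
    show "hdist ?H x z \<le> hdist ?H x y + hdist ?H y z"
      using weighted_l2_triangle[OF w, where a = "\<lambda>n. taylor_coeff x n - taylor_coeff y n"
          and b = "\<lambda>n. taylor_coeff y n - taylor_coeff z n"]
        sm[OF V[OF xyz(1,2)]] sm[OF V[OF xyz(2,3)]] xyz
      by (simp add: hdist_def nrm V D)
  qed
qed

lemma Metric_space_hardy_space: "Metric_space (vecs hardy_space) (hdist hardy_space)"
  unfolding hardy_space_def by (rule Metric_space_weighted_space) simp

lemma Metric_space_dirichlet_space: "Metric_space (vecs dirichlet_space) (hdist dirichlet_space)"
  unfolding dirichlet_space_def by (rule Metric_space_weighted_space) simp


section \<open>Operators\<close>

text \<open>An operator is only considered on \<open>vecs H\<close>; its values elsewhere are irrelevant.\<close>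

type_synonym operator = "(complex \<Rightarrow> complex) \<Rightarrow> (complex \<Rightarrow> complex)"

definition bounded_operator :: "fun_space \<Rightarrow> operator \<Rightarrow> bool"
  where "bounded_operator H T \<longleftrightarrow>
    (\<forall>f\<in>vecs H. T f \<in> vecs H) \<and>
    (\<forall>f\<in>vecs H. \<forall>g\<in>vecs H. T (\<lambda>z. f z + g z) = (\<lambda>z. T f z + T g z)) \<and>
    (\<forall>c. \<forall>f\<in>vecs H. T (\<lambda>z. c * f z) = (\<lambda>z. c * T f z)) \<and>
    (\<exists>K. \<forall>f\<in>vecs H. hnorm H (T f) \<le> K * hnorm H f)"

definition compact_operator :: "fun_space \<Rightarrow> operator \<Rightarrow> bool"
  where "compact_operator H T \<longleftrightarrow> bounded_operator H T \<and>
    compactin (htopology H) (htopology H closure_of (T ` {f \<in> vecs H. hnorm H f \<le> 1}))"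

definition positive_operator :: "fun_space \<Rightarrow> operator \<Rightarrow> bool"
  where "positive_operator H P \<longleftrightarrow>
    bounded_operator H P \<and> (\<forall>f\<in>vecs H. ip H (P f) f \<in> \<real>\<^sub>\<ge>\<^sub>0)"

definition is_adjoint :: "fun_space \<Rightarrow> operator \<Rightarrow> operator \<Rightarrow> bool"
  where "is_adjoint H T S \<longleftrightarrow>
    bounded_operator H S \<and> (\<forall>f\<in>vecs H. \<forall>g\<in>vecs H. ip H (T f) g = ip H f (S g))"

text \<open>\<open>P\<close> is the absolute value \<open>(T* T)\<^sup>1\<^sup>/\<^sup>2\<close>.\<close>

definition is_abs_operator :: "fun_space \<Rightarrow> operator \<Rightarrow> operator \<Rightarrow> bool"
  where "is_abs_operator H T P \<longleftrightarrow>
    positive_operator H P \<and> (\<exists>S. is_adjoint H T S \<and> (\<forall>f\<in>vecs H. P (P f) = S (T f)))"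

definition orthonormal_basis :: "fun_space \<Rightarrow> (complex \<Rightarrow> complex) set \<Rightarrow> bool"
  where "orthonormal_basis H E \<longleftrightarrow> E \<subseteq> vecs H \<and>
    (\<forall>e\<in>E. \<forall>e'\<in>E. ip H e e' = (if e = e' then 1 else 0)) \<and>
    (\<forall>f\<in>vecs H. (\<forall>e\<in>E. ip H f e = 0) \<longrightarrow> f = (\<lambda>z. 0))"

text \<open>The trace of the absolute value is finite; this does not depend on the basis.\<close>

definition trace_class_operator :: "fun_space \<Rightarrow> operator \<Rightarrow> bool"
  where "trace_class_operator H T \<longleftrightarrow> bounded_operator H T \<and>
    (\<exists>P E. is_abs_operator H T P \<and> orthonormal_basis H E \<and> (\<lambda>e. ip H (P e) e) summable_on E)"

definition composition_operator :: "fun_space \<Rightarrow> operator \<Rightarrow> bool"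
  where "composition_operator H T \<longleftrightarrow>
    (\<exists>\<phi>. \<phi> holomorphic_on unit_disc \<and> \<phi> ` unit_disc \<subseteq> unit_disc \<and>
         (\<forall>f\<in>vecs H. T f = on_disc (f \<circ> \<phi>)))"


section \<open>Semigroups and generators\<close>

text \<open>Only the values \<open>T t\<close> with \<open>t \<ge> 0\<close> matter.\<close>

definition C0_semigroup :: "fun_space \<Rightarrow> (real \<Rightarrow> operator) \<Rightarrow> bool"
  where "C0_semigroup H T \<longleftrightarrow>
    (\<forall>t\<ge>0. bounded_operator H (T t)) \<and>
    (\<forall>f\<in>vecs H. T 0 f = f) \<and>
    (\<forall>s\<ge>0. \<forall>t\<ge>0. \<forall>f\<in>vecs H. T (t + s) f = T t (T s f)) \<and>
    (\<forall>f\<in>vecs H. limitin (htopology H) (\<lambda>t. T t f) f (at_right 0))"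

text \<open>Unbounded operators are given by their graphs, so equality of graphs includes equality of
  domains.\<close>

definition generator ::
    "fun_space \<Rightarrow> (real \<Rightarrow> operator) \<Rightarrow> ((complex \<Rightarrow> complex) \<times> (complex \<Rightarrow> complex)) set"
  where "generator H T = {(f, g). f \<in> vecs H \<and>
    limitin (htopology H) (\<lambda>t z. (T t f z - f z) / of_real t) g (at_right 0)}"

definition diff_operator ::
    "fun_space \<Rightarrow> (complex \<Rightarrow> complex) \<Rightarrow> ((complex \<Rightarrow> complex) \<times> (complex \<Rightarrow> complex)) set"
  where "diff_operator H G =
    {(f, g). f \<in> vecs H \<and> g \<in> vecs H \<and> g = on_disc (\<lambda>z. G z * deriv f z)}"

end

theory Submission
  imports Defs
begin

text \<open>The semigroup is \<open>T(t) f = f \<circ> \<phi>\<^sub>t\<close>, where \<open>\<phi>\<^sub>t\<close> is the flow of \<open>z' = G(z)\<close>. Near the unit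
  circle the field points inward, so every closed disc of radius close to \<open>1\<close> is forward invariant
  and the flow exists for all times \<open>t \<ge> 0\<close>, however fast \<open>G\<close> grows at the boundary. The flow is
  built as the limit of Euler polygons, which are holomorphic in the starting point and leave the
  same discs invariant (\<open>flow_tendsto\<close>, \<open>flow_add\<close>).

  Two norm estimates carry the proof. In the Hardy space the bound
  \<open>\<parallel>f \<circ> \<phi>\<parallel>\<^sup>2 \<le> (1 + |\<phi>(0)|) / (1 - |\<phi>(0)|) \<parallel>f\<parallel>\<^sup>2\<close> is Littlewood's subordination principle
  (\<open>littlewood_subordination\<close>). In the Dirichlet space, \<open>f\<^sub>t = f \<circ> \<phi>\<^sub>t\<close> satisfies
  \<open>\<partial>\<^sub>t f\<^sub>t = G f\<^sub>t'\<close>, so the density \<open>|f\<^sub>t'|\<^sup>2\<close> is transported across circles near the boundary, outwards and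
  at speed at least \<open>\<delta>\<close>. Hence the Dirichlet integral of \<open>f\<^sub>t\<close> over a disc whose
  radius grows at speed \<open>\<delta>\<close> does not increase (\<open>energy_decay\<close>), and the full Dirichlet integral of
  \<open>f\<^sub>t\<close> is at most that of \<open>f\<close> over the disc of radius \<open>1 - \<delta> t\<close> (\<open>dirichlet_sum_decay\<close>). This
  shows that the Dirichlet seminorm is contracted, and that the images of the normalised monomials
  \<open>e\<^sub>n\<close> decay geometrically (\<open>monomial_decay\<close>); the latter holds in both spaces, because the Hardy
  norm is dominated by the Dirichlet norm.

  From \<open>\<Sum> \<parallel>T(t) e\<^sub>n\<parallel> < \<infinity>\<close> both operator properties follow. The image of the unit ball lies in
  the continuous image of a product of discs, so \<open>T(t)\<close> is compact. The absolute value
  \<open>P = (T* T)\<^sup>1\<^sup>/\<^sup>2\<close> exists, and \<open>\<langle>P e\<^sub>n, e\<^sub>n\<rangle> \<le> \<parallel>P e\<^sub>n\<parallel> = \<parallel>T e\<^sub>n\<parallel>\<close>, so its trace is finite.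

  Both norm bounds tend to \<open>\<parallel>f\<parallel>\<^sup>2\<close> as \<open>t \<rightarrow> 0\<close>, while the Taylor coefficients of \<open>f\<^sub>t\<close> converge to those
  of \<open>f\<close>; by the Radon-Riesz argument \<open>f\<^sub>t \<rightarrow> f\<close> in norm. The Taylor coefficients of \<open>f\<^sub>t\<close> are
  differentiable in \<open>t\<close> with the coefficients of \<open>(G f') \<circ> \<phi>\<^sub>t\<close> as derivatives. This identifies the
  generator: a norm derivative at \<open>0\<close> can only be \<open>G f'\<close>, and if \<open>G f'\<close> lies in the space, the mean
  value inequality and strong continuity turn coefficientwise into norm differentiability.\<close>

section \<open>The Hilbert space of square-summable sequences\<close>

text \<open>The spaces on the disc are isometric to this one by rescaling Taylor coefficients. Having the
  sequences as a type of class \<open>banach\<close> and \<open>real_inner\<close> makes limits, series and compactness in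
  norm available for them.\<close>

typedef l2 = "{a :: nat \<Rightarrow> complex. summable (\<lambda>n. (norm (a n))\<^sup>2)}"
  morphisms coord Abs_l2
  by (rule exI[of _ "\<lambda>_. 0"]) simp

lemma coord_Abs: "summable (\<lambda>n. (norm (a n))\<^sup>2) \<Longrightarrow> coord (Abs_l2 a) = a"
  by (simp add: Abs_l2_inverse)

lemma summable_coord: "summable (\<lambda>n. (norm (coord x n))\<^sup>2)"
  using coord[of x] by simp

lemma l2_eqI: "(\<And>n. coord x n = coord y n) \<Longrightarrow> x = y"
  by (simp add: coord_inject[symmetric] fun_eq_iff)

lemma square_summable_add:
  fixes a b :: "nat \<Rightarrow> complex"
  assumes "summable (\<lambda>n. (norm (a n))\<^sup>2)" "summable (\<lambda>n. (norm (b n))\<^sup>2)"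
  shows "summable (\<lambda>n. (norm (a n + b n))\<^sup>2)"
  using weighted_l2_triangle[of "\<lambda>_. 1" a b] assms by simp

lemma square_summable_mult:
  fixes a :: "nat \<Rightarrow> complex"
  assumes "summable (\<lambda>n. (norm (a n))\<^sup>2)"
  shows "summable (\<lambda>n. (norm (c * a n))\<^sup>2)"
  using summable_mult[OF assms, of "(norm c)\<^sup>2"] by (simp add: norm_mult power_mult_distrib)

lemma summable_prod_square:
  fixes a b :: "nat \<Rightarrow> complex"
  assumes "summable (\<lambda>n. (norm (a n))\<^sup>2)" "summable (\<lambda>n. (norm (b n))\<^sup>2)"
  shows "summable (\<lambda>n. a n * cnj (b n))"
proof (rule summable_comparison_test')
  show "summable (\<lambda>n. (norm (a n))\<^sup>2 + (norm (b n))\<^sup>2)" using assms by (rule summable_add)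
  fix n :: nat assume "n \<ge> 0"
  have "2 * norm (a n) * norm (b n) \<le> (norm (a n))\<^sup>2 + (norm (b n))\<^sup>2"
    by (rule sum_squares_bound)
  moreover have "norm (a n) * norm (b n) \<ge> 0" by simp
  ultimately show "norm (a n * cnj (b n)) \<le> (norm (a n))\<^sup>2 + (norm (b n))\<^sup>2"
    unfolding norm_mult complex_mod_cnj by linarith
qed

definition cin :: "l2 \<Rightarrow> l2 \<Rightarrow> complex"
  where "cin x y = (\<Sum>n. coord x n * cnj (coord y n))"

definition cscale :: "complex \<Rightarrow> l2 \<Rightarrow> l2"
  where "cscale c x = Abs_l2 (\<lambda>n. c * coord x n)"

lemma coord_cscale [simp]: "coord (cscale c x) n = c * coord x n"
  unfolding cscale_def by (simp add: coord_Abs square_summable_mult summable_coord)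

instantiation l2 :: real_inner
begin

definition "zero_l2 = Abs_l2 (\<lambda>_. 0)"
definition "plus_l2 x y = Abs_l2 (\<lambda>n. coord x n + coord y n)"
definition "scaleR_l2 r x = cscale (of_real r) x" for r x
definition "uminus_l2 x = cscale (- 1) x" for x
definition "minus_l2 x y = x + cscale (- 1) y" for x y
definition "inner_l2 x y = Re (cin x y)" for x y
definition "norm_l2 x = sqrt (Re (cin x x))" for x
definition "sgn_l2 x = inverse (norm x) *\<^sub>R x" for x :: l2
definition "dist_l2 x y = norm (x - y)" for x y :: l2
definition "uniformity_l2 = (INF e\<in>{0 <..}. principal {(x :: l2, y). dist x y < e})"
definition "open_l2 U = (\<forall>x\<in>U. eventually (\<lambda>(x', y). x' = x \<longrightarrow> y \<in> U) uniformity)"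
  for U :: "l2 set"

lemma coord_zero [simp]: "coord 0 n = 0"
  unfolding zero_l2_def by (simp add: coord_Abs)

lemma coord_add [simp]: "coord (x + y) n = coord x n + coord y n"
  unfolding plus_l2_def by (simp add: coord_Abs square_summable_add summable_coord)

lemma coord_scaleR [simp]: "coord (r *\<^sub>R x) n = of_real r * coord x n"
  unfolding scaleR_l2_def by simp

lemma coord_uminus [simp]: "coord (- x) n = - coord x n"
  unfolding uminus_l2_def by simp

lemma coord_diff [simp]: "coord (x - y) n = coord x n - coord y n"
  unfolding minus_l2_def by simp

lemma summable_cin: "summable (\<lambda>n. coord x n * cnj (coord y n))"
  by (intro summable_prod_square summable_coord)

lemma cin_self: "cin x x = of_real (\<Sum>n. (norm (coord x n))\<^sup>2)"
  unfolding cin_def using suminf_of_real[OF summable_coord[of x], where 'a = complex]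
  by (simp add: complex_norm_square del: of_real_power)

lemma cin_commute: "cin y x = cnj (cin x y)"
proof -
  have "(\<lambda>n. cnj (coord x n * cnj (coord y n))) sums cnj (cin x y)"
    unfolding cin_def sums_cnj by (rule summable_sums[OF summable_cin])
  then show ?thesis unfolding cin_def by (simp add: sums_iff mult.commute)
qed

lemma cin_add_left: "cin (x + y) z = cin x z + cin y z"
  unfolding cin_def using suminf_add[OF summable_cin summable_cin, of x z y z]
  by (simp add: distrib_right)

lemma cin_cscale_left: "cin (cscale c x) z = c * cin x z"
  unfolding cin_def using suminf_mult[OF summable_cin, of c x z] by (simp add: mult.assoc)

instance
proof
  show "dist x y = norm (x - y)" for x y :: l2 by (rule dist_l2_def)
  show "sgn x = inverse (norm x) *\<^sub>R x" for x :: l2 by (rule sgn_l2_def)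
  show "inner x y = inner y x" for x y :: l2
    unfolding inner_l2_def by (subst cin_commute) simp
  show "inner (x + y) z = inner x z + inner y z" for x y z :: l2
    unfolding inner_l2_def by (simp add: cin_add_left)
  show "inner (r *\<^sub>R x) y = r * inner x y" for x y :: l2 and r
    unfolding inner_l2_def by (simp add: scaleR_l2_def cin_cscale_left)
  show "0 \<le> inner x x" for x :: l2
    unfolding inner_l2_def by (simp add: cin_self suminf_nonneg summable_coord)
  show "(inner x x = 0) = (x = 0)" for x :: l2
    unfolding inner_l2_def
    by (auto simp: cin_self suminf_eq_zero_iff[OF summable_coord] intro!: l2_eqI)
  show "norm x = sqrt (inner x x)" for x :: l2
    unfolding inner_l2_def by (rule norm_l2_def)
qed (auto intro!: l2_eqI simp: uniformity_l2_def open_l2_def algebra_simps)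

end

lemma inner_eq_Re_cin: "inner x y = Re (cin x y)"
  by (rule inner_l2_def)

lemma cin_self_norm: "cin x x = of_real ((norm x)\<^sup>2)"
  by (simp add: cin_self power2_norm_eq_inner inner_eq_Re_cin)

lemma norm_l2_sums: "(\<lambda>n. (norm (coord x n))\<^sup>2) sums (norm x)\<^sup>2"
  using cin_self[of x] summable_sums[OF summable_coord[of x]] unfolding cin_self_norm of_real_eq_iff by simp

lemma norm_l2_leI:
  assumes "B \<ge> 0" "\<And>N. (\<Sum>n<N. (norm (coord x n))\<^sup>2) \<le> B\<^sup>2"
  shows "norm x \<le> B"
  by (rule power2_le_imp_le[OF _ assms(1)], rule LIMSEQ_le_const2[OF norm_l2_sums[of x, unfolded sums_def]])
    (use assms in blast)

lemma norm_coord_le: "norm (coord x n) \<le> norm x"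
proof -
  have "(\<Sum>i\<in>{n}. (norm (coord x i))\<^sup>2) \<le> (norm x)\<^sup>2"
    using sum_le_suminf[OF summable_coord, of "{n}" x] norm_l2_sums[of x] by (simp add: sums_iff)
  then show ?thesis by (simp add: power2_le_iff_abs_le)
qed

lemma norm_l2_sum_le: "(\<Sum>n<N. (norm (coord x n))\<^sup>2) \<le> (norm x)\<^sup>2"
  using sum_le_suminf[OF summable_coord, of "{..<N}" x] norm_l2_sums[of x] by (simp add: sums_iff)

lemma l2_of_bounded_sums:
  assumes "B \<ge> 0" "\<And>N. (\<Sum>n<N. (norm (a n))\<^sup>2) \<le> B\<^sup>2"
  shows "summable (\<lambda>n. (norm (a n))\<^sup>2)" "norm (Abs_l2 a) \<le> B"
proof -
  show s: "summable (\<lambda>n. (norm (a n))\<^sup>2)"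
    by (rule summableI_nonneg_bounded[OF _ assms(2)]) simp
  show "norm (Abs_l2 a) \<le> B" by (rule norm_l2_leI) (use assms in \<open>simp_all add: coord_Abs[OF s]\<close>)
qed

lemma cscale_of_real: "cscale (of_real r) x = r *\<^sub>R x"
  by (rule l2_eqI) simp

lemma cscale_simps [simp]:
  "cscale c (x + y) = cscale c x + cscale c y"
  "cscale (c + d) x = cscale c x + cscale d x"
  "cscale c (cscale d x) = cscale (c * d) x"
  "cscale c (r *\<^sub>R x) = r *\<^sub>R cscale c x"
  "cscale (r *\<^sub>R c) x = r *\<^sub>R cscale c x"
  "cscale c (x - y) = cscale c x - cscale c y"
  "cscale 1 x = x" "cscale c 0 = 0"
  by (auto intro!: l2_eqI simp: algebra_simps scaleR_conv_of_real)

lemma norm_cscale [simp]: "norm (cscale c x) = norm c * norm x"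
proof -
  have "(\<lambda>n. (norm c)\<^sup>2 * (norm (coord x n))\<^sup>2) sums ((norm c)\<^sup>2 * (norm x)\<^sup>2)"
    by (intro sums_mult norm_l2_sums)
  then have "(norm (cscale c x))\<^sup>2 = (norm c * norm x)\<^sup>2"
    using norm_l2_sums[of "cscale c x"] by (simp add: norm_mult power_mult_distrib sums_iff)
  then show ?thesis by simp
qed

lemma bounded_linear_cscale_right: "bounded_linear (cscale c)"
  by (rule bounded_linear_intro[where K = "norm c"]) (simp_all add: mult.commute)

lemma bounded_linear_cscale_left: "bounded_linear (\<lambda>c. cscale c x)"
  by (rule bounded_linear_intro[where K = "norm x"]) simp_all

lemma bounded_linear_coord: "bounded_linear (\<lambda>x. coord x n)"
  by (rule bounded_linear_intro[where K = 1]) (simp_all add: norm_coord_le scaleR_conv_of_real)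

lemma cin_add_right: "cin x (y + z) = cin x y + cin x z"
  using cin_commute[of x] by (metis cin_add_left complex_cnj_add)

lemma cin_cscale_right: "cin x (cscale c y) = cnj c * cin x y"
  using cin_commute[of x] by (metis cin_cscale_left complex_cnj_mult)

lemma cin_scaleR: "cin (r *\<^sub>R x) y = r *\<^sub>R cin x y" "cin x (r *\<^sub>R y) = r *\<^sub>R cin x y"
  unfolding cscale_of_real[symmetric]
  by (simp_all add: cin_cscale_left cin_cscale_right scaleR_conv_of_real)

lemma norm_cin_le: "norm (cin x y) \<le> norm x * norm y"
proof (cases "cin x y = 0")
  case False
  \<comment> \<open>a unimodular factor, which rotates \<open>cin x y\<close> onto the positive real axis\<close>
  define c where "c = cnj (cin x y) / norm (cin x y)"
  have "c * cin x y = of_real (norm (cin x y))"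
    using False complex_norm_square[of "cin x y"] by (simp add: c_def field_simps power2_eq_square)
  then have "norm (cin x y) = inner (cscale c x) y"
    by (simp add: inner_eq_Re_cin cin_cscale_left)
  also have "\<dots> \<le> norm (cscale c x) * norm y" by (rule norm_cauchy_schwarz)
  also have "\<dots> = norm x * norm y" using False by (simp add: c_def norm_divide)
  finally show ?thesis .
qed simp

lemma bounded_bilinear_cin: "bounded_bilinear cin"
  by unfold_locales (auto simp: cin_add_left cin_add_right cin_scaleR intro!: exI[of _ 1] norm_cin_le)

lemma cin_diff_left: "cin (x - y) z = cin x z - cin y z"
  by (rule bounded_bilinear.diff_left[OF bounded_bilinear_cin])

lemma cin_diff_right: "cin x (y - z) = cin x y - cin x z"
  by (rule bounded_bilinear.diff_right[OF bounded_bilinear_cin])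

instance l2 :: banach
proof
  fix X :: "nat \<Rightarrow> l2" assume X: "Cauchy X"
  define a where "a n = lim (\<lambda>m. coord (X m) n)" for n
  have a: "(\<lambda>m. coord (X m) n) \<longlonglongrightarrow> a n" for n
    using bounded_linear.Cauchy[OF bounded_linear_coord X, of n]
    by (simp add: a_def Cauchy_convergent_iff convergent_LIMSEQ_iff)
  have *: "(\<Sum>n<N. (norm (a n - coord (X m) n))\<^sup>2) \<le> e\<^sup>2"
    if "e > 0" and M: "\<And>i. i \<ge> M \<Longrightarrow> norm (X i - X m) \<le> e" for e M m N
  proof (rule LIMSEQ_le_const2)
    show "(\<lambda>i. \<Sum>n<N. (norm (coord (X i) n - coord (X m) n))\<^sup>2)
        \<longlonglongrightarrow> (\<Sum>n<N. (norm (a n - coord (X m) n))\<^sup>2)"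
      by (intro tendsto_intros a)
    show "\<exists>K. \<forall>i\<ge>K. (\<Sum>n<N. (norm (coord (X i) n - coord (X m) n))\<^sup>2) \<le> e\<^sup>2"
    proof (intro exI allI impI)
      fix i assume "i \<ge> M"
      have "(\<Sum>n<N. (norm (coord (X i - X m) n))\<^sup>2) \<le> (norm (X i - X m))\<^sup>2"
        by (rule norm_l2_sum_le)
      also have "\<dots> \<le> e\<^sup>2" using M[OF \<open>i \<ge> M\<close>] by (intro power_mono) auto
      finally show "(\<Sum>n<N. (norm (coord (X i) n - coord (X m) n))\<^sup>2) \<le> e\<^sup>2" by simp
    qed
  qed
  obtain M1 where M1: "\<And>i m. i \<ge> M1 \<Longrightarrow> m \<ge> M1 \<Longrightarrow> norm (X i - X m) < 1"
    using X unfolding Cauchy_iff by (metis zero_less_one)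
  have "summable (\<lambda>n. (norm (a n - coord (X M1) n))\<^sup>2)"
    by (rule l2_of_bounded_sums(1)[of 1]) (use *[of 1 M1 M1] M1 in \<open>auto simp: less_imp_le\<close>)
  from square_summable_add[OF this summable_coord[of "X M1"]]
  have s: "summable (\<lambda>n. (norm (a n))\<^sup>2)" by simp
  have "X \<longlonglongrightarrow> Abs_l2 a"
  proof (rule metric_LIMSEQ_I)
    fix r :: real assume "r > 0"
    then obtain M where M: "\<And>i m. i \<ge> M \<Longrightarrow> m \<ge> M \<Longrightarrow> norm (X i - X m) < r / 2"
      using X unfolding Cauchy_iff by (metis half_gt_zero)
    have "dist (X m) (Abs_l2 a) < r" if "m \<ge> M" for m
    proof -
      have "norm (Abs_l2 a - X m) \<le> r / 2"
        by (rule norm_l2_leI) (use *[of "r/2" M m] M that \<open>r > 0\<close> in \<open>auto simp: coord_Abs[OF s] less_imp_le\<close>)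
      then show ?thesis using \<open>r > 0\<close> by (simp add: dist_norm norm_minus_commute)
    qed
    then show "\<exists>no. \<forall>n\<ge>no. dist (X n) (Abs_l2 a) < r" by blast
  qed
  then show "convergent X" by (rule convergentI)
qed

definition basis_vec :: "nat \<Rightarrow> l2"
  where "basis_vec n = Abs_l2 (\<lambda>k. if k = n then 1 else 0)"

lemma coord_basis_vec [simp]: "coord (basis_vec n) k = (if k = n then 1 else 0)"
proof -
  have "(\<lambda>k. (norm (if k = n then 1 else 0 :: complex))\<^sup>2) = (\<lambda>k. if k = n then 1 else 0)" by auto
  then have "summable (\<lambda>k. (norm (if k = n then 1 else 0 :: complex))\<^sup>2)"
    using summable_single[of n "\<lambda>_. 1::real"] by simp
  then show ?thesis unfolding basis_vec_def by (subst coord_Abs) auto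
qed

lemma cin_basis_vec: "cin x (basis_vec n) = coord x n"
proof -
  have "(\<lambda>k. coord x k * cnj (coord (basis_vec n) k)) = (\<lambda>k. if k = n then coord x k else 0)" by auto
  then show ?thesis unfolding cin_def using sums_single[of n "coord x"] by (simp add: sums_iff)
qed

lemma norm_basis_vec [simp]: "norm (basis_vec n) = 1"
proof -
  have "cin (basis_vec n) (basis_vec n) = 1" by (simp add: cin_basis_vec)
  then show ?thesis unfolding cin_self_norm by (metis norm_ge_zero of_real_eq_1_iff power2_eq_1_iff norm_eq_zero abs_norm_cancel abs_1 abs_minus_cancel)
qed

lemma coord_sum [simp]: "coord (sum f A) n = (\<Sum>i\<in>A. coord (f i) n)"
  by (induction A rule: infinite_finite_induct) auto

lemma l2_expansion: "(\<lambda>n. cscale (coord x n) (basis_vec n)) sums x"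
  unfolding sums_def
proof (rule metric_LIMSEQ_I)
  fix r :: real assume r: "r > 0"
  have c: "coord (x - (\<Sum>n<N. cscale (coord x n) (basis_vec n))) k = (if k < N then 0 else coord x k)" for N k
  proof -
    have "(\<Sum>i<N. coord x i * (if k = i then 1 else 0)) = (if k < N then coord x k else 0)"
      by (simp add: sum.delta[of "{..<N}" k] if_distrib cong: if_cong)
    then show ?thesis by simp
  qed
  have "\<forall>\<^sub>F N in sequentially. (\<Sum>n<N. (norm (coord x n))\<^sup>2) > (norm x)\<^sup>2 - (r/2)\<^sup>2"
    using norm_l2_sums[of x] unfolding sums_def by (rule order_tendstoD) (use r in simp)
  then obtain N0 where N0: "\<And>N. N \<ge> N0 \<Longrightarrow> (\<Sum>n<N. (norm (coord x n))\<^sup>2) > (norm x)\<^sup>2 - (r/2)\<^sup>2"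
    unfolding eventually_sequentially by blast
  have "dist (\<Sum>n<N. cscale (coord x n) (basis_vec n)) x < r" if N: "N \<ge> N0" for N
  proof -
    have "norm (x - (\<Sum>n<N. cscale (coord x n) (basis_vec n))) \<le> r / 2"
    proof (rule norm_l2_leI)
      fix K
      have "(\<Sum>n<N. (norm (coord x n))\<^sup>2) = (\<Sum>n<K + N. if n < N then (norm (coord x n))\<^sup>2 else 0)"
        by (rule sum.mono_neutral_cong_left) auto
      moreover have "(\<Sum>n<K. (norm (if n < N then 0 else coord x n))\<^sup>2)
          \<le> (\<Sum>n<K + N. (norm (if n < N then 0 else coord x n))\<^sup>2)"
        by (rule sum_mono2) auto
      ultimately have "(\<Sum>n<K. (norm (if n < N then 0 else coord x n))\<^sup>2) + (\<Sum>n<N. (norm (coord x n))\<^sup>2)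
         \<le> (\<Sum>n<K + N. (norm (if n < N then 0 else coord x n))\<^sup>2) + (\<Sum>n<K + N. if n < N then (norm (coord x n))\<^sup>2 else 0)"
        by linarith
      also have "\<dots> = (\<Sum>n<K + N. (norm (coord x n))\<^sup>2)"
        unfolding sum.distrib[symmetric] by (rule sum.cong) auto
      also have "\<dots> \<le> (norm x)\<^sup>2" by (rule norm_l2_sum_le)
      finally show "(\<Sum>n<K. (norm (coord (x - (\<Sum>n<N. cscale (coord x n) (basis_vec n))) n))\<^sup>2) \<le> (r/2)\<^sup>2"
        unfolding c using N0[OF N] by linarith
    qed (use r in simp)
    then show ?thesis using r by (simp add: dist_norm norm_minus_commute)
  qed
  then show "\<exists>N0. \<forall>N\<ge>N0. dist (\<Sum>n<N. cscale (coord x n) (basis_vec n)) x < r" by blast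
qed

text \<open>For bounded families, coordinatewise convergence is weak convergence: a test vector is
  approximated by its finite sections. Only the limit itself is needed as a test vector.\<close>

lemma tendsto_inner_of_coord:
  fixes X :: "'b \<Rightarrow> l2"
  assumes bd: "\<forall>\<^sub>F t in F. norm (X t) \<le> K"
    and co: "\<And>n. ((\<lambda>t. coord (X t) n) \<longlongrightarrow> coord x n) F"
  shows "((\<lambda>t. inner (X t) x) \<longlongrightarrow> inner x x) F"
proof (rule tendstoI)
  fix e :: real assume e: "e > 0"
  \<comment> \<open>finite sections of the test vector\<close>
  define S where "S N = (\<Sum>n<N. cscale (coord x n) (basis_vec n))" for N
  define K' where "K' = max K 0 + norm x + 1"
  have K': "K' > 0" unfolding K'_def by (smt (verit) norm_ge_zero)
  have "S \<longlonglongrightarrow> x" using l2_expansion[of x] unfolding sums_def S_def by simp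
  then obtain N where N: "norm (S N - x) < e / (2 * K')"
    using e K' unfolding LIMSEQ_iff by (metis order_refl divide_pos_pos mult_pos_pos zero_less_numeral)
  have S: "inner y (S N) = (\<Sum>n<N. Re (cnj (coord x n) * coord y n))" for y
    unfolding S_def inner_sum_right by (simp add: inner_eq_Re_cin cin_cscale_right cin_basis_vec)
  have "((\<lambda>t. inner (X t) (S N)) \<longlongrightarrow> inner x (S N)) F"
    unfolding S by (intro tendsto_intros co)
  then have "\<forall>\<^sub>F t in F. dist (inner (X t) (S N)) (inner x (S N)) < e / 2"
    by (rule tendstoD) (use e in simp)
  with bd show "\<forall>\<^sub>F t in F. dist (inner (X t) x) (inner x x) < e"
  proof eventually_elim
    case (elim t)
    have "\<bar>inner (X t - x) (x - S N)\<bar> \<le> norm (X t - x) * norm (x - S N)"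
      by (rule Cauchy_Schwarz_ineq2)
    also have "\<dots> \<le> K' * (e / (2 * K'))"
    proof (rule mult_mono)
      show "norm (X t - x) \<le> K'" unfolding K'_def using elim(1) norm_triangle_ineq4[of "X t" x] by linarith
    qed (use N K' in \<open>auto simp: norm_minus_commute\<close>)
    also have "\<dots> = e / 2" using K' by simp
    finally have "\<bar>inner (X t - x) (x - S N)\<bar> \<le> e / 2" .
    moreover have "inner (X t) x - inner x x
        = inner (X t - x) (x - S N) + (inner (X t) (S N) - inner x (S N))"
      by (simp add: inner_diff_left inner_diff_right)
    ultimately show ?case using elim(2) unfolding dist_real_def by linarith
  qed
qed

text \<open>Radon-Riesz: coordinatewise convergence together with an asymptotic bound by the norm of
  the limit excludes any loss of mass.\<close>

lemma tendsto_of_coord_norm: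
  fixes X :: "'b \<Rightarrow> l2"
  assumes N: "(N \<longlongrightarrow> (norm x)\<^sup>2) F" "\<forall>\<^sub>F t in F. (norm (X t))\<^sup>2 \<le> N t"
    and co: "\<And>n. ((\<lambda>t. coord (X t) n) \<longlongrightarrow> coord x n) F"
  shows "(X \<longlongrightarrow> x) F"
proof -
  have "\<forall>\<^sub>F t in F. N t < (norm x)\<^sup>2 + 1" using N(1) by (rule order_tendstoD) simp
  with N(2) have bd: "\<forall>\<^sub>F t in F. norm (X t) \<le> sqrt ((norm x)\<^sup>2 + 1)"
    by eventually_elim (simp add: real_le_rsqrt)
  have "((\<lambda>t. N t - 2 * inner (X t) x + (norm x)\<^sup>2) \<longlongrightarrow> (norm x)\<^sup>2 - 2 * inner x x + (norm x)\<^sup>2) F"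
    by (intro tendsto_intros N tendsto_inner_of_coord[OF bd co])
  then have "((\<lambda>t. N t - 2 * inner (X t) x + (norm x)\<^sup>2) \<longlongrightarrow> 0) F"
    by (simp add: power2_norm_eq_inner)
  moreover have "\<forall>\<^sub>F t in F. (norm (X t - x))\<^sup>2 \<le> N t - 2 * inner (X t) x + (norm x)\<^sup>2"
    using N(2) by eventually_elim (simp add: power2_norm_eq_inner inner_diff_left inner_diff_right inner_commute)
  ultimately have "((\<lambda>t. (norm (X t - x))\<^sup>2) \<longlongrightarrow> 0) F"
    by (intro tendsto_sandwich[of "\<lambda>_. 0" "\<lambda>t. (norm (X t - x))\<^sup>2"]) auto
  then have "((\<lambda>t. norm (X t - x)) \<longlongrightarrow> 0) F"
    using tendsto_real_sqrt[of "\<lambda>t. (norm (X t - x))\<^sup>2" 0 F] by simp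
  then show ?thesis by (simp add: tendsto_norm_zero_iff LIM_zero_iff)
qed

section \<open>Square roots of contractions by power series\<close>

text \<open>The coefficients of \<open>q(x) = 1 - sqrt (1 - x)\<close>. The recursion is \<open>q = (x + q\<^sup>2) / 2\<close> read off
  coefficientwise; it shows at once that they are nonnegative.\<close>

fun sqrt_coeff :: "nat \<Rightarrow> real"
  where "sqrt_coeff n =
    ((if n = 1 then 1 else 0) + (\<Sum>i\<in>{1..<n}. sqrt_coeff i * sqrt_coeff (n - i))) / 2"

declare sqrt_coeff.simps [simp del]

lemma sqrt_coeff_0 [simp]: "sqrt_coeff 0 = 0"
  by (subst sqrt_coeff.simps) simp

lemma sqrt_coeff_nonneg: "0 \<le> sqrt_coeff n"
proof (induction n rule: less_induct)
  case (less n)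
  then show ?case by (subst sqrt_coeff.simps) (auto intro!: divide_nonneg_nonneg add_nonneg_nonneg sum_nonneg)
qed

lemma sqrt_coeff_convolution:
  "(\<Sum>i\<le>n. sqrt_coeff i * sqrt_coeff (n - i)) = 2 * sqrt_coeff n - (if n = 1 then 1 else 0)"
proof -
  have "(\<Sum>i\<in>{1..<n}. sqrt_coeff i * sqrt_coeff (n - i)) = (\<Sum>i\<le>n. sqrt_coeff i * sqrt_coeff (n - i))"
  proof (rule sum.mono_neutral_left)
    show "\<forall>i\<in>{..n} - {1..<n}. sqrt_coeff i * sqrt_coeff (n - i) = 0"
    proof
      fix i assume "i \<in> {..n} - {1..<n}"
      then have "i = 0 \<or> i = n" by auto
      then show "sqrt_coeff i * sqrt_coeff (n - i) = 0" by auto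
    qed
  qed auto
  moreover have "2 * sqrt_coeff n =
      (if n = 1 then 1 else 0) + (\<Sum>i\<in>{1..<n}. sqrt_coeff i * sqrt_coeff (n - i))"
    by (subst sqrt_coeff.simps) simp
  ultimately show ?thesis by linarith
qed

text \<open>By \<open>q = (x + q\<^sup>2) / 2\<close> at \<open>x = 1\<close>, the partial sums satisfy \<open>s\<^sub>N\<^sub>+\<^sub>1 \<le> (1 + s\<^sub>N\<^sup>2) / 2\<close>, so that
  they never exceed the fixed point \<open>1\<close>.\<close>

lemma sum_sqrt_coeff_le: "(\<Sum>n<N. sqrt_coeff n) \<le> 1"
proof (induction N)
  case (Suc N)
  let ?q = sqrt_coeff
  have "2 * (\<Sum>n<Suc N. ?q n) = (\<Sum>n<Suc N. (\<Sum>i\<le>n. ?q i * ?q (n - i)) + (if n = 1 then 1 else 0))"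
    unfolding sum_distrib_left by (rule sum.cong) (simp_all add: sqrt_coeff_convolution)
  also have "\<dots> \<le> (\<Sum>n<Suc N. \<Sum>i\<le>n. ?q i * ?q (n - i)) + 1"
    by (simp add: sum.distrib sum.delta')
  also have "(\<Sum>n<Suc N. \<Sum>i\<le>n. ?q i * ?q (n - i)) = (\<Sum>(n, i)\<in>Sigma {..<Suc N} (\<lambda>n. {..n}). ?q i * ?q (n - i))"
    by (rule sum.Sigma) auto
  also have "\<dots> = (\<Sum>(i, j) | i + j < Suc N. ?q i * ?q j)"
    by (rule sum.reindex_bij_witness[of _ "\<lambda>(i, j). (i + j, i)" "\<lambda>(n, i). (i, n - i)"]) auto
  \<comment> \<open>as \<open>q 0 = 0\<close>, both indices are positive and therefore smaller than \<open>N\<close>\<close>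
  also have "\<dots> = (\<Sum>(i, j) | 0 < i \<and> 0 < j \<and> i + j < Suc N. ?q i * ?q j)"
  proof (rule sum.mono_neutral_right)
    show "finite {(i, j). i + j < Suc N}"
      by (rule finite_subset[of _ "{..N} \<times> {..N}"]) auto
  qed (auto intro!: gr0I)
  also have "\<dots> \<le> (\<Sum>(i, j)\<in>{..<N} \<times> {..<N}. ?q i * ?q j)"
    by (rule sum_mono2) (auto simp: sqrt_coeff_nonneg)
  also have "\<dots> = (\<Sum>n<N. ?q n) * (\<Sum>n<N. ?q n)"
    by (simp add: sum_product sum.cartesian_product)
  also have "\<dots> \<le> 1"
    using mult_mono[OF Suc Suc] by (simp add: sum_nonneg sqrt_coeff_nonneg)
  finally show ?case by simp
qed simp

lemma summable_sqrt_coeff: "summable sqrt_coeff"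
  by (rule summableI_nonneg_bounded[OF sqrt_coeff_nonneg sum_sqrt_coeff_le])

lemma suminf_sqrt_coeff_le: "suminf sqrt_coeff \<le> 1"
  by (rule suminf_le_const[OF summable_sqrt_coeff sum_sqrt_coeff_le])

text \<open>The operator \<open>R = I - sqrt (I - B)\<close>; the series converges for every contraction \<open>B\<close> because the
  coefficients are summable.\<close>

definition sqrt_defect :: "('a \<Rightarrow> 'a) \<Rightarrow> 'a \<Rightarrow> 'a::banach"
  where "sqrt_defect B x = (\<Sum>n. sqrt_coeff n *\<^sub>R (B ^^ n) x)"

context
  fixes B :: "'a::banach \<Rightarrow> 'a"
  assumes lin: "bounded_linear B" and contr: "\<And>x. norm (B x) \<le> norm x"
begin

lemma norm_funpow_le: "norm ((B ^^ n) x) \<le> norm x"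
  by (induction n) (simp_all add: order_trans[OF contr])

lemma bounded_linear_funpow: "bounded_linear (B ^^ n)"
  by (induction n) (simp_all add: id_def o_def bounded_linear_compose[OF lin])

lemma norm_sqrt_term_le: "norm (sqrt_coeff n *\<^sub>R (B ^^ n) x) \<le> sqrt_coeff n * norm x"
  by (simp add: mult_left_mono norm_funpow_le sqrt_coeff_nonneg)

lemma summable_norm_sqrt_defect: "summable (\<lambda>n. norm (sqrt_coeff n *\<^sub>R (B ^^ n) x))"
  by (rule summable_comparison_test'[OF summable_mult2[OF summable_sqrt_coeff, of "norm x"]])
    (use norm_sqrt_term_le in simp)

lemma sqrt_defect_sums: "(\<lambda>n. sqrt_coeff n *\<^sub>R (B ^^ n) x) sums sqrt_defect B x"
  unfolding sqrt_defect_def by (rule summable_sums[OF summable_norm_cancel[OF summable_norm_sqrt_defect]])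

lemma norm_sqrt_defect_le: "norm (sqrt_defect B x) \<le> norm x"
proof -
  have "norm (sqrt_defect B x) \<le> (\<Sum>n. norm (sqrt_coeff n *\<^sub>R (B ^^ n) x))"
    unfolding sqrt_defect_def by (rule summable_norm[OF summable_norm_sqrt_defect])
  also have "\<dots> \<le> (\<Sum>n. sqrt_coeff n * norm x)"
    by (intro suminf_le norm_sqrt_term_le summable_norm_sqrt_defect summable_mult2 summable_sqrt_coeff)
  also have "\<dots> = suminf sqrt_coeff * norm x" by (simp add: suminf_mult2 summable_sqrt_coeff)
  also have "\<dots> \<le> 1 * norm x" by (intro mult_right_mono suminf_sqrt_coeff_le) simp
  finally show ?thesis by simp
qed

lemma bounded_linear_sqrt_defect: "bounded_linear (sqrt_defect B)"
proof (rule bounded_linear_intro[where K = 1])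
  fix x y :: 'a and r :: real
  have "(\<lambda>n. sqrt_coeff n *\<^sub>R (B ^^ n) (x + y)) sums (sqrt_defect B x + sqrt_defect B y)"
    using sums_add[OF sqrt_defect_sums[of x] sqrt_defect_sums[of y]]
    by (simp add: linear_add[OF bounded_linear.linear[OF bounded_linear_funpow]] scaleR_add_right)
  then show "sqrt_defect B (x + y) = sqrt_defect B x + sqrt_defect B y"
    by (metis sqrt_defect_sums sums_unique2)
  have "(\<lambda>n. sqrt_coeff n *\<^sub>R (B ^^ n) (r *\<^sub>R x)) sums (r *\<^sub>R sqrt_defect B x)"
    using sums_scaleR_right[OF sqrt_defect_sums[of x], of r]
    by (simp add: linear_scale[OF bounded_linear.linear[OF bounded_linear_funpow]] mult.commute)
  then show "sqrt_defect B (r *\<^sub>R x) = r *\<^sub>R sqrt_defect B x"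
    by (metis sqrt_defect_sums sums_unique2)
qed (simp add: norm_sqrt_defect_le)

text \<open>Ordering the double series of \<open>R\<^sup>2\<close> by total degree leaves the convolution of the coefficients,
  and \<open>q\<^sup>2 = 2 q - x\<close>. Equivalently, \<open>(I - R)\<^sup>2 = I - B\<close>.\<close>

lemma sqrt_defect_square: "sqrt_defect B (sqrt_defect B x) = 2 *\<^sub>R sqrt_defect B x - B x"
proof -
  let ?q = sqrt_coeff
  define F where "F = (\<lambda>(j, k). (?q j * ?q k) *\<^sub>R (B ^^ (j + k)) x)"
  have q: "?q summable_on UNIV"
    by (simp add: summable_on_UNIV_nonneg_real_iff sqrt_coeff_nonneg summable_sqrt_coeff)
  have "(\<lambda>(j, k). ?q j * ?q k * norm x) summable_on UNIV \<times> UNIV"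
  proof (rule summable_on_SigmaI)
    fix j
    show "((\<lambda>k. case (j, k) of (j, k) \<Rightarrow> ?q j * ?q k * norm x) has_sum ?q j * infsum ?q UNIV * norm x) UNIV"
      unfolding prod.case by (intro has_sum_cmult_left has_sum_cmult_right has_sum_infsum q)
  next
    show "(\<lambda>j. ?q j * infsum ?q UNIV * norm x) summable_on UNIV"
      by (intro summable_on_cmult_left q)
  qed (simp add: sqrt_coeff_nonneg)
  then have "F abs_summable_on UNIV \<times> UNIV"
    by (rule Infinite_Sum.abs_summable_on_comparison_test')
      (clarsimp simp: F_def sqrt_coeff_nonneg norm_funpow_le mult_left_mono)
  then have F: "F summable_on UNIV \<times> UNIV" by (rule abs_summable_summable)
  have tm: "((\<lambda>k. ?q k *\<^sub>R (B ^^ k) y) has_sum sqrt_defect B y) UNIV" for y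
    by (rule norm_summable_imp_has_sum[OF summable_norm_sqrt_defect sqrt_defect_sums])
  have row: "((\<lambda>k. F (j, k)) has_sum ?q j *\<^sub>R (B ^^ j) (sqrt_defect B x)) UNIV" for j
  proof -
    have "bounded_linear (\<lambda>y. ?q j *\<^sub>R (B ^^ j) y)"
      by (intro bounded_linear_scaleR_right bounded_linear_compose[OF bounded_linear_scaleR_right bounded_linear_funpow])
    from has_sum_bounded_linear[OF this tm[of x]] show ?thesis
      by (simp add: F_def o_def funpow_add linear_scale[OF bounded_linear.linear[OF bounded_linear_funpow]])
  qed
  have 1: "(F has_sum sqrt_defect B (sqrt_defect B x)) (UNIV \<times> UNIV)"
    by (rule has_sum_SigmaI[OF row tm F])
  have bij: "bij_betw (\<lambda>(n, i). (i, n - i)) (Sigma UNIV (\<lambda>n::nat. {..n})) (UNIV \<times> UNIV)"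
    by (rule bij_betwI[of _ _ _ "\<lambda>(i, j). (i + j, i)"]) auto
  have 2: "((\<lambda>(n, i). F (i, n - i)) has_sum sqrt_defect B (sqrt_defect B x)) (Sigma UNIV (\<lambda>n. {..n}))"
    using has_sum_reindex_bij_betw[OF bij, of F] 1 by (simp add: case_prod_unfold)
  have "((\<lambda>n. (2 * ?q n - (if n = 1 then 1 else 0)) *\<^sub>R (B ^^ n) x) has_sum sqrt_defect B (sqrt_defect B x)) UNIV"
  proof (rule has_sum_SigmaD[OF 2])
    fix n
    have "(\<Sum>i\<le>n. F (i, n - i)) = (2 * ?q n - (if n = 1 then 1 else 0)) *\<^sub>R (B ^^ n) x"
      unfolding sqrt_coeff_convolution[symmetric] scaleR_sum_left by (rule sum.cong) (auto simp: F_def)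
    then show "((\<lambda>i. case (n, i) of (n, i) \<Rightarrow> F (i, n - i)) has_sum (2 * ?q n - (if n = 1 then 1 else 0)) *\<^sub>R (B ^^ n) x) {..n}"
      by (intro has_sum_finiteI) auto
  qed
  then have 3: "(\<lambda>n. (2 * ?q n - (if n = 1 then 1 else 0)) *\<^sub>R (B ^^ n) x) sums sqrt_defect B (sqrt_defect B x)"
    by (rule has_sum_imp_sums)
  have "(\<lambda>n. 2 *\<^sub>R (?q n *\<^sub>R (B ^^ n) x) - (if n = 1 then (B ^^ n) x else 0)) sums (2 *\<^sub>R sqrt_defect B x - (B ^^ 1) x)"
    by (intro sums_diff sums_scaleR_right sqrt_defect_sums sums_single)
  moreover have "(2 *\<^sub>R (?q n *\<^sub>R (B ^^ n) x) - (if n = 1 then (B ^^ n) x else 0))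
      = (2 * ?q n - (if n = 1 then 1 else 0)) *\<^sub>R (B ^^ n) x" for n
    by (simp add: scaleR_diff_left)
  ultimately have "(\<lambda>n. (2 * ?q n - (if n = 1 then 1 else 0)) *\<^sub>R (B ^^ n) x) sums (2 *\<^sub>R sqrt_defect B x - (B ^^ 1) x)"
    by (simp only:)
  from sums_unique2[OF 3 this] show ?thesis by simp
qed

end

section \<open>Operators with summable images of the basis vectors\<close>

text \<open>A complex linear operator which is absolutely summable on the standard basis. This is stronger
  than being trace class, but it is the form in which the estimates come, and it gives compactness,
  the adjoint and the trace by elementary means.\<close>

locale nuclear_map =
  fixes L :: "l2 \<Rightarrow> l2"
  assumes lin: "bounded_linear L"
    and homogeneous: "L (cscale c x) = cscale c (L x)"
    and summable_basis: "summable (\<lambda>n. norm (L (basis_vec n)))"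
begin

lemma image_expansion: "(\<lambda>n. cscale (coord x n) (L (basis_vec n))) sums L x"
  using bounded_linear.sums[OF lin l2_expansion[of x]] by (simp add: homogeneous)

text \<open>The coordinates of a vector of the unit ball form a point in a product of closed discs, which is
  compact by Tychonoff. The map \<open>y \<mapsto> \<Sum> y\<^sub>n L e\<^sub>n\<close> is continuous on the product, being a uniform limit
  of functions of finitely many coordinates.\<close>

lemma compact_superset_image: "\<exists>K. compact K \<and> L ` cball 0 1 \<subseteq> K"
proof -
  define Q :: "(nat \<Rightarrow> complex) set" where "Q = PiE UNIV (\<lambda>_. cball 0 1)"
  define \<Phi> where "\<Phi> y = (\<Sum>n. cscale (y n) (L (basis_vec n)))" for y
  have "compactin (product_topology (\<lambda>_. euclidean) UNIV) Q"
    unfolding Q_def compactin_PiE by simp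
  then have Q: "compact Q" unfolding euclidean_product_topology by simp
  have "continuous_on Q \<Phi>"
  proof (rule uniform_limit_theorem)
    show "uniform_limit Q (\<lambda>N y. \<Sum>n<N. cscale (y n) (L (basis_vec n))) \<Phi> sequentially"
      unfolding \<Phi>_def
    proof (rule Weierstrass_m_test[OF _ summable_basis])
      fix n y assume "y \<in> Q"
      then have "norm (y n) \<le> 1" by (auto simp: Q_def)
      then show "norm (cscale (y n) (L (basis_vec n))) \<le> norm (L (basis_vec n))"
        by (simp add: mult_left_le_one_le)
    qed
    show "\<forall>\<^sub>F N in sequentially. continuous_on Q (\<lambda>y. \<Sum>n<N. cscale (y n) (L (basis_vec n)))"
      by (intro always_eventually allI continuous_on_sum
          bounded_linear.continuous_on[OF bounded_linear_cscale_left])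
        (rule continuous_on_subset[OF continuous_on_product_coordinates], simp)
  qed simp
  then have "compact (\<Phi> ` Q)" using Q by (rule compact_continuous_image)
  moreover have "L x \<in> \<Phi> ` Q" if "x \<in> cball 0 1" for x
  proof (rule image_eqI)
    show "coord x \<in> Q" using that order_trans[OF norm_coord_le[of x], of 1] by (auto simp: Q_def)
    show "L x = \<Phi> (coord x)" unfolding \<Phi>_def using image_expansion by (simp add: sums_iff)
  qed
  ultimately show ?thesis by blast
qed

text \<open>The coordinates of the adjoint are forced by \<open>\<langle>L* y, e\<^sub>n\<rangle> = \<langle>y, L e\<^sub>n\<rangle>\<close>.\<close>

definition adj :: "l2 \<Rightarrow> l2"
  where "adj y = Abs_l2 (\<lambda>n. cin y (L (basis_vec n)))"

text \<open>A bound for the norm of the adjoint; the summand \<open>1\<close> allows division by it even if \<open>L = 0\<close>.\<close>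

definition bd :: real
  where "bd = (\<Sum>n. norm (L (basis_vec n))) + 1"

lemma bd_pos: "bd > 0"
  using suminf_nonneg[OF summable_basis] by (simp add: bd_def)

lemma adj_bound:
  shows coord_adj: "coord (adj y) n = cin y (L (basis_vec n))"
    and norm_adj_le: "norm (adj y) \<le> bd * norm y"
proof -
  have *: "(\<Sum>n<N. (norm (cin y (L (basis_vec n))))\<^sup>2) \<le> (bd * norm y)\<^sup>2" for N
  proof -
    have "L2_set (\<lambda>n. norm (cin y (L (basis_vec n)))) {..<N} \<le> (\<Sum>n<N. norm (cin y (L (basis_vec n))))"
      by (rule L2_set_le_sum) simp
    also have "\<dots> \<le> (\<Sum>n<N. norm y * norm (L (basis_vec n)))" by (intro sum_mono norm_cin_le)
    also have "\<dots> = norm y * (\<Sum>n<N. norm (L (basis_vec n)))" by (simp add: sum_distrib_left)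
    also have "\<dots> \<le> norm y * bd" unfolding bd_def
      by (intro mult_left_mono order_trans[OF sum_le_suminf[OF summable_basis]]) auto
    finally show ?thesis unfolding L2_set_def
      by (metis mult.commute real_sqrt_le_iff real_sqrt_le_mono sqrt_le_D)
  qed
  have "bd * norm y \<ge> 0" using bd_pos by simp
  note l2_of_bounded_sums[OF this *]
  then show "coord (adj y) n = cin y (L (basis_vec n))" "norm (adj y) \<le> bd * norm y"
    unfolding adj_def by (simp_all add: coord_Abs)
qed

lemma cin_image_eq: "cin (L x) y = cin x (adj y)"
proof -
  have "(\<lambda>n. cin (cscale (coord x n) (L (basis_vec n))) y) sums cin (L x) y"
    by (rule bounded_linear.sums[OF bounded_bilinear.bounded_linear_left[OF bounded_bilinear_cin] image_expansion])
  moreover have "cin (cscale (coord x n) (L (basis_vec n))) y = coord x n * cnj (coord (adj y) n)" for n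
    by (simp add: cin_cscale_left coord_adj cin_commute[of y])
  ultimately show ?thesis unfolding cin_def[of x] by (simp add: sums_iff)
qed

lemma bounded_linear_adj: "bounded_linear adj"
proof (rule bounded_linear_intro[where K = bd])
  fix x y :: l2 and r :: real
  show "adj (x + y) = adj x + adj y" by (rule l2_eqI) (simp add: coord_adj cin_add_left)
  show "adj (r *\<^sub>R x) = r *\<^sub>R adj x"
    by (rule l2_eqI) (simp add: coord_adj cin_scaleR scaleR_conv_of_real)
  show "norm (adj x) \<le> norm x * bd" using norm_adj_le[of x] by (simp only: mult.commute)
qed

lemma adj_cscale: "adj (cscale c y) = cscale c (adj y)"
  by (rule l2_eqI) (simp add: coord_adj cin_cscale_left)

text \<open>With \<open>K\<close> a bound for the norm of the adjoint, \<open>B = I - L* L / K\<^sup>2\<close> is a contraction, and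
  \<open>L* L = K\<^sup>2 (I - B)\<close> has the square root \<open>P = K (I - R)\<close>. As a power series in a self-adjoint
  contraction, \<open>R\<close> is self-adjoint with norm at most \<open>1\<close>, so \<open>P\<close> is positive. Being self-adjoint,
  \<open>P\<close> satisfies \<open>\<parallel>P x\<parallel>\<^sup>2 = \<langle>P\<^sup>2 x, x\<rangle> = \<parallel>L x\<parallel>\<^sup>2\<close>.\<close>

lemma ex_absolute_value:
  "\<exists>P. bounded_linear P \<and> (\<forall>c x. P (cscale c x) = cscale c (P x)) \<and> (\<forall>x. P (P x) = adj (L x)) \<and>
     (\<forall>x. cin (P x) x \<in> \<real>\<^sub>\<ge>\<^sub>0) \<and> (\<forall>x. norm (P x) = norm (L x))"
proof -
  define B where "B x = x - inverse (bd\<^sup>2) *\<^sub>R adj (L x)" for x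
  define R where "R = sqrt_defect B"
  define P where "P x = bd *\<^sub>R (x - R x)" for x
  have B_lin: "bounded_linear B" unfolding B_def
    by (intro bounded_linear_sub bounded_linear_ident bounded_linear_compose[OF bounded_linear_scaleR_right]
        bounded_linear_compose[OF bounded_linear_adj] lin)
  have adjL: "inner x (adj (L x)) = (norm (L x))\<^sup>2" for x
    by (simp add: inner_eq_Re_cin cin_image_eq[symmetric] cin_self_norm)
  have B_contr: "norm (B x) \<le> norm x" for x
  proof -
    have "(norm (B x))\<^sup>2 = (norm x)\<^sup>2 - 2 * inverse (bd\<^sup>2) * (norm (L x))\<^sup>2 + (inverse (bd\<^sup>2))\<^sup>2 * (norm (adj (L x)))\<^sup>2"
      unfolding B_def power2_norm_eq_inner inner_diff_left inner_diff_right
      by (simp add: inner_commute[of "adj (L x)" x] adjL power2_norm_eq_inner[symmetric] dot_square_norm power2_eq_square)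
    also have "(inverse (bd\<^sup>2))\<^sup>2 * (norm (adj (L x)))\<^sup>2 \<le> (inverse (bd\<^sup>2))\<^sup>2 * (bd * norm (L x))\<^sup>2"
      by (intro mult_left_mono power_mono norm_adj_le) auto
    also have "\<dots> = inverse (bd\<^sup>2) * (norm (L x))\<^sup>2"
      using bd_pos by (simp add: power2_eq_square field_simps)
    finally have "(norm (B x))\<^sup>2 \<le> (norm x)\<^sup>2 - inverse (bd\<^sup>2) * (norm (L x))\<^sup>2" by simp
    also have "\<dots> \<le> (norm x)\<^sup>2" by simp
    finally show ?thesis by (rule power2_le_imp_le) simp
  qed
  have B_cscale: "B (cscale c x) = cscale c (B x)" for c x
    unfolding B_def by (simp add: homogeneous adj_cscale)
  have B_self: "cin (B x) y = cin x (B y)" for x y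
  proof -
    have "cin (adj (L x)) y = cin x (adj (L y))"
      by (metis cin_commute cin_image_eq)
    then show ?thesis unfolding B_def by (simp add: cin_diff_left cin_diff_right cin_scaleR)
  qed
  have Bn_cscale: "(B ^^ n) (cscale c x) = cscale c ((B ^^ n) x)" for n c x
    by (induction n) (simp_all add: B_cscale)
  have Bn_self: "cin ((B ^^ n) x) y = cin x ((B ^^ n) y)" for n x y
    by (induction n arbitrary: x y) (simp_all add: B_self funpow_swap1)
  note R_sums = sqrt_defect_sums[OF B_lin B_contr, folded R_def]
  have R_cscale: "R (cscale c x) = cscale c (R x)" for c x
    using bounded_linear.sums[OF bounded_linear_cscale_right[of c] R_sums[of x]] R_sums[of "cscale c x"]
    by (simp add: Bn_cscale sums_unique2)
  have R_self: "cin (R x) y = cin x (R y)" for x y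
    using bounded_linear.sums[OF bounded_bilinear.bounded_linear_left[OF bounded_bilinear_cin] R_sums[of x], of y]
      bounded_linear.sums[OF bounded_bilinear.bounded_linear_right[OF bounded_bilinear_cin] R_sums[of y], of x]
    by (simp add: cin_scaleR Bn_self sums_unique2)
  have P_lin: "bounded_linear P" unfolding P_def R_def
    by (intro bounded_linear_compose[OF bounded_linear_scaleR_right] bounded_linear_sub bounded_linear_ident
        bounded_linear_sqrt_defect B_lin B_contr)
  have P_cscale: "P (cscale c x) = cscale c (P x)" for c x
    unfolding P_def by (simp add: R_cscale)
  have PP: "P (P x) = adj (L x)" for x
  proof -
    have R_lin: "linear R" unfolding R_def
      by (intro bounded_linear.linear bounded_linear_sqrt_defect B_lin B_contr)
    have "P (P x) = bd\<^sup>2 *\<^sub>R (x - 2 *\<^sub>R R x + R (R x))"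
      unfolding P_def using R_lin
      by (simp add: linear_scale linear_diff scaleR_diff_right scaleR_add_right power2_eq_square scaleR_2)
    also have "R (R x) = 2 *\<^sub>R R x - B x" unfolding R_def by (rule sqrt_defect_square[OF B_lin B_contr])
    finally show ?thesis using bd_pos by (simp add: B_def)
  qed
  have P_self: "cin (P x) y = cin x (P y)" for x y
    unfolding P_def by (simp add: cin_diff_left cin_diff_right cin_scaleR R_self)
  have P_pos: "cin (P x) x \<in> \<real>\<^sub>\<ge>\<^sub>0" for x
  proof -
    have "cnj (cin (P x) x) = cin (P x) x" by (metis cin_commute P_self)
    then have "Im (cin (P x) x) = 0" by (metis complex_cnj_cancel_iff Reals_cnj_iff complex_is_Real_iff)
    moreover have "Re (cin (R x) x) \<le> (norm x)\<^sup>2"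
    proof -
      have "Re (cin (R x) x) \<le> norm (R x) * norm x" using norm_cin_le complex_Re_le_cmod order_trans by blast
      also have "\<dots> \<le> norm x * norm x" unfolding R_def
        by (intro mult_right_mono norm_sqrt_defect_le B_lin B_contr) auto
      finally show ?thesis by (simp add: power2_eq_square)
    qed
    then have "Re (cin (P x) x) \<ge> 0" unfolding P_def using bd_pos
      by (simp add: cin_scaleR cin_diff_left cin_self_norm)
    ultimately show ?thesis by (simp add: complex_nonneg_Reals_iff)
  qed
  have P_norm: "norm (P x) = norm (L x)" for x
  proof -
    have "cin (P x) (P x) = cin (L x) (L x)" by (metis P_self PP cin_image_eq)
    then have "(norm (P x))\<^sup>2 = (norm (L x))\<^sup>2" unfolding cin_self_norm of_real_eq_iff .
    then show ?thesis by simp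
  qed
  show ?thesis using P_lin P_cscale PP P_pos P_norm by blast
qed

end

section \<open>Taylor coefficients, circle means and subordination\<close>

lemma taylor_coeff_sums:
  assumes "f holomorphic_on unit_disc" "z \<in> unit_disc"
  shows "(\<lambda>n. taylor_coeff f n * z ^ n) sums f z"
  using holomorphic_power_series[OF assms] by (simp add: taylor_coeff_def)

lemma has_fps_expansion_taylor:
  assumes "f holomorphic_on unit_disc"
  shows "f has_fps_expansion Abs_fps (taylor_coeff f)"
proof (rule has_fps_expansionI)
  have "\<forall>\<^sub>F z in nhds (0::complex). z \<in> unit_disc" by (rule eventually_nhds_in_open) auto
  then show "\<forall>\<^sub>F z in nhds 0. (\<lambda>n. fps_nth (Abs_fps (taylor_coeff f)) n * z ^ n) sums f z"
    by eventually_elim (simp add: taylor_coeff_sums[OF assms])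
qed

lemma taylor_coeff_eqI:
  assumes "f has_fps_expansion F"
  shows "taylor_coeff f n = fps_nth F n"
  using fps_nth_fps_expansion[OF assms] by (simp add: taylor_coeff_def)

lemma taylor_coeff_of_sums:
  assumes "\<And>z. z \<in> unit_disc \<Longrightarrow> (\<lambda>n. a n * z ^ n) sums f z"
  shows "taylor_coeff f n = a n"
proof -
  have "\<forall>\<^sub>F z in nhds (0::complex). z \<in> unit_disc" by (rule eventually_nhds_in_open) auto
  then have "\<forall>\<^sub>F z in nhds 0. (\<lambda>n. fps_nth (Abs_fps a) n * z ^ n) sums f z"
    by eventually_elim (simp add: assms)
  from taylor_coeff_eqI[OF has_fps_expansionI[OF this]] show ?thesis by simp
qed

lemma holomorphic_of_sums:
  assumes "\<And>z. z \<in> unit_disc \<Longrightarrow> (\<lambda>n. a n * z ^ n) sums f z"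
  shows "f holomorphic_on unit_disc"
  by (rule power_series_holomorphic[of 0 1 a]) (use assms in simp)

lemma taylor_coeff_cong:
  assumes "\<And>z. z \<in> unit_disc \<Longrightarrow> f z = g z"
  shows "taylor_coeff f n = taylor_coeff g n"
proof -
  have "\<forall>\<^sub>F z in nhds 0. f z = g z"
    using eventually_nhds_in_open[of unit_disc 0] by (auto elim!: eventually_mono simp: assms)
  then show ?thesis unfolding taylor_coeff_def by (metis higher_deriv_cong_ev)
qed

lemma holomorphic_on_disc: "f holomorphic_on unit_disc \<Longrightarrow> on_disc f holomorphic_on unit_disc"
  by (rule holomorphic_transform) (auto simp: on_disc_def)

lemma taylor_coeff_on_disc [simp]: "taylor_coeff (on_disc f) n = taylor_coeff f n"
  by (rule taylor_coeff_cong) (simp add: on_disc_def)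

lemma taylor_coeff_inject:
  assumes "f holomorphic_on unit_disc" "g holomorphic_on unit_disc"
    and "\<And>n. taylor_coeff f n = taylor_coeff g n" and z: "z \<in> unit_disc"
  shows "f z = g z"
  using taylor_coeff_sums[OF assms(1) z] taylor_coeff_sums[OF assms(2) z] assms(3) by (simp add: sums_iff)

lemma taylor_coeff_0 [simp]: "taylor_coeff f 0 = f 0"
  by (simp add: taylor_coeff_def)

lemma taylor_coeff_add:
  assumes "f holomorphic_on unit_disc" "g holomorphic_on unit_disc"
  shows "taylor_coeff (\<lambda>z. f z + g z) n = taylor_coeff f n + taylor_coeff g n"
  by (subst taylor_coeff_eqI[OF has_fps_expansion_add[OF assms[THEN has_fps_expansion_taylor]]]) simp

lemma taylor_coeff_cmult:
  assumes "f holomorphic_on unit_disc"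
  shows "taylor_coeff (\<lambda>z. c * f z) n = c * taylor_coeff f n"
  by (subst taylor_coeff_eqI[OF has_fps_expansion_cmult_left[OF has_fps_expansion_taylor[OF assms]]]) simp

lemma taylor_coeff_times_deriv:
  assumes "f holomorphic_on unit_disc"
  shows "taylor_coeff (\<lambda>z. z * deriv f z) n = of_nat n * taylor_coeff f n"
proof -
  have "(\<lambda>z. z * deriv f z) has_fps_expansion fps_X * fps_deriv (Abs_fps (taylor_coeff f))"
    by (intro fps_expansion_intros has_fps_expansion_taylor assms)
  from taylor_coeff_eqI[OF this] show ?thesis by (simp add: fps_X_mult_nth)
qed

lemma taylor_coeff_bound:
  assumes f: "f holomorphic_on unit_disc" and R: "0 < R" "R < 1"
    and B: "\<And>z. norm z = R \<Longrightarrow> norm (f z) \<le> B"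
  shows "norm (taylor_coeff f n) \<le> B / R ^ n"
proof -
  have "norm ((deriv ^^ n) f 0) \<le> fact n * B / R ^ n"
  proof (rule Cauchy_inequality)
    show "f holomorphic_on ball 0 R" by (rule holomorphic_on_subset[OF f]) (use R in auto)
    show "continuous_on (cball 0 R) f"
      by (rule holomorphic_on_imp_continuous_on[OF holomorphic_on_subset[OF f]]) (use R in auto)
  qed (use R B in auto)
  then show ?thesis by (simp add: taylor_coeff_def norm_divide field_simps)
qed

text \<open>On the circle \<open>cnj (z ^ n) = r\<^sup>2\<^sup>n / z ^ n\<close>, so the integral is Cauchy's formula for the
  \<open>n\<close>-th Taylor coefficient.\<close>

lemma circle_integral_orthogonality:
  assumes p: "p holomorphic_on unit_disc" and r: "0 < r" "r < 1"
  shows "((\<lambda>x. p (circlepath 0 r x) * cnj (circlepath 0 r x ^ n)) has_integral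
    taylor_coeff p n * of_real (r ^ (2 * n))) {0..1}"
proof -
  let ?\<gamma> = "circlepath 0 r"
  have "((\<lambda>u. p u / (u - 0) ^ Suc n) has_contour_integral ((2 * pi * \<i>) / (fact n) * (deriv ^^ n) p 0)) ?\<gamma>"
    by (rule Cauchy_has_contour_integral_higher_derivative_circlepath)
      (use r in \<open>auto intro!: holomorphic_on_imp_continuous_on holomorphic_on_subset[OF p]\<close>)
  then have I: "((\<lambda>x. p (?\<gamma> x) / ?\<gamma> x ^ Suc n * vector_derivative ?\<gamma> (at x)) has_integral
      (2 * pi * \<i>) * taylor_coeff p n) {0..1}"
    by (simp add: has_contour_integral taylor_coeff_def)
  have "of_real (r ^ (2 * n)) / (2 * pi * \<i>) * ((2 * pi * \<i>) * taylor_coeff p n)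
      = taylor_coeff p n * of_real (r ^ (2 * n))" by (simp add: field_simps)
  from has_integral_mult_right[OF I, of "of_real (r ^ (2 * n)) / (2 * pi * \<i>)", unfolded this]
  have "((\<lambda>x. of_real (r ^ (2 * n)) / (2 * pi * \<i>) * (p (?\<gamma> x) / ?\<gamma> x ^ Suc n * vector_derivative ?\<gamma> (at x)))
      has_integral taylor_coeff p n * of_real (r ^ (2 * n))) {0..1}" .
  then show ?thesis
  proof (rule has_integral_eq[rotated])
    fix x :: real
    have g: "?\<gamma> x \<noteq> 0" using r by (simp add: circlepath)
    have "?\<gamma> x * cnj (?\<gamma> x) = of_real (r\<^sup>2)"
      using complex_norm_square[of "?\<gamma> x"] r by (simp add: circlepath norm_mult)
    then have "?\<gamma> x ^ n * cnj (?\<gamma> x ^ n) = of_real (r ^ (2 * n))"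
      by (metis complex_cnj_power of_real_power power_mult power_mult_distrib)
    then have e: "cnj (?\<gamma> x ^ n) = of_real (r ^ (2 * n)) / ?\<gamma> x ^ n" using g by (simp add: field_simps)
    have v: "vector_derivative ?\<gamma> (at x) = 2 * pi * \<i> * ?\<gamma> x"
      unfolding vector_derivative_circlepath by (simp add: circlepath)
    show "of_real (r ^ (2 * n)) / (2 * pi * \<i>) * (p (?\<gamma> x) / ?\<gamma> x ^ Suc n * vector_derivative ?\<gamma> (at x)) =
        p (?\<gamma> x) * cnj (?\<gamma> x ^ n)"
      unfolding e v using g by (simp add: field_simps)
  qed
qed

text \<open>The series of \<open>u\<close> converges uniformly on the circle and can be integrated termwise.\<close>

lemma parseval:
  assumes p: "p holomorphic_on unit_disc" and u: "u holomorphic_on unit_disc" and r: "0 < r" "r < 1"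
  obtains S where
    "(\<lambda>n. taylor_coeff p n * cnj (taylor_coeff u n) * of_real (r ^ (2 * n))) sums S"
    "((\<lambda>x. p (circlepath 0 r x) * cnj (u (circlepath 0 r x))) has_integral S) {0..1}"
proof -
  let ?\<gamma> = "circlepath 0 r"
  define F where "F N x = p (?\<gamma> x) * cnj (\<Sum>n<N. taylor_coeff u n * ?\<gamma> x ^ n)" for N x
  have n\<gamma>: "norm (?\<gamma> x) = r" for x using r by (simp add: circlepath norm_mult)
  have \<gamma>: "?\<gamma> x \<in> unit_disc" for x using n\<gamma> r by simp
  have c\<gamma>: "continuous_on {0..1} ?\<gamma>" by (simp add: circlepath continuous_intros)
  have cp: "continuous_on {0..1} (\<lambda>x. p (?\<gamma> x))"
    by (rule continuous_on_compose2[OF holomorphic_on_imp_continuous_on[OF p] c\<gamma>]) (use \<gamma> in auto)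
  have bp: "bounded ((\<lambda>x. p (?\<gamma> x)) ` {0..1})"
    by (intro compact_imp_bounded compact_continuous_image cp) auto
  have "uniform_limit {0..1} (\<lambda>N x. \<Sum>n<N. taylor_coeff u n * ?\<gamma> x ^ n) (\<lambda>x. suminf (\<lambda>n. taylor_coeff u n * ?\<gamma> x ^ n)) sequentially"
  proof (rule Weierstrass_m_test)
    show "norm (taylor_coeff u n * ?\<gamma> x ^ n) \<le> norm (taylor_coeff u n * of_real r ^ n)" for n x
      using r by (simp add: norm_mult norm_power n\<gamma>)
    have "norm (of_real r :: complex) < norm (of_real ((r + 1) / 2) :: complex)"
      unfolding norm_of_real using r by simp
    moreover have "of_real ((r + 1) / 2) \<in> unit_disc" unfolding mem_ball dist_0_norm norm_of_real using r by simp
    from taylor_coeff_sums[OF u this]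
    have "summable (\<lambda>n. taylor_coeff u n * of_real ((r + 1) / 2) ^ n)" by (rule sums_summable)
    ultimately show "summable (\<lambda>n. norm (taylor_coeff u n * of_real r ^ n))"
      using powser_insidea by blast
  qed
  then have "uniform_limit {0..1} (\<lambda>N x. \<Sum>n<N. taylor_coeff u n * ?\<gamma> x ^ n) (\<lambda>x. u (?\<gamma> x)) sequentially"
    using taylor_coeff_sums[OF u \<gamma>] by (simp add: sums_iff)
  note bounded_linear.uniform_limit[OF bounded_linear_cnj this]
  moreover have "bounded ((\<lambda>x. cnj (u (?\<gamma> x))) ` {0..1})"
    by (intro compact_imp_bounded compact_continuous_image continuous_intros
        continuous_on_compose2[OF holomorphic_on_imp_continuous_on[OF u] c\<gamma>]) (use \<gamma> in auto)
  ultimately have ul: "uniform_limit {0..1} F (\<lambda>x. p (?\<gamma> x) * cnj (u (?\<gamma> x))) sequentially"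
    unfolding F_def by (rule uniform_lim_mult[OF uniform_limit_const _ bp])
  have cF: "continuous_on {0..1} (F N)" for N
    unfolding F_def by (intro continuous_intros cp c\<gamma>)
  obtain I J where IJ: "\<And>N. (F N has_integral I N) {0..1}"
    "((\<lambda>x. p (?\<gamma> x) * cnj (u (?\<gamma> x))) has_integral J) {0..1}" "I \<longlonglongrightarrow> J"
    using uniform_limit_integral[OF ul cF] by auto
  have "(F N has_integral (\<Sum>n<N. taylor_coeff p n * cnj (taylor_coeff u n) * of_real (r ^ (2 * n)))) {0..1}" for N
  proof -
    have "((\<lambda>x. \<Sum>n<N. cnj (taylor_coeff u n) * (p (?\<gamma> x) * cnj (?\<gamma> x ^ n))) has_integral
       (\<Sum>n<N. cnj (taylor_coeff u n) * (taylor_coeff p n * of_real (r ^ (2 * n))))) {0..1}"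
      by (intro has_integral_sum has_integral_mult_right circle_integral_orthogonality p r) auto
    then show ?thesis unfolding F_def by (simp add: sum_distrib_left mult_ac)
  qed
  then have "I N = (\<Sum>n<N. taylor_coeff p n * cnj (taylor_coeff u n) * of_real (r ^ (2 * n)))" for N
    using IJ(1) has_integral_unique by blast
  then have "I = (\<lambda>N. \<Sum>n<N. taylor_coeff p n * cnj (taylor_coeff u n) * of_real (r ^ (2 * n)))" by blast
  with IJ show thesis by (intro that[of J]) (auto simp: sums_def)
qed

text \<open>Estimates for circle means are obtained on circles inside the disc; this carries them over to
  the boundary circle.\<close>

lemma sum_le_of_radius_limit:
  fixes b :: "nat \<Rightarrow> real"
  assumes r0: "r0 < \<rho>" and B: "\<And>r. r0 < r \<Longrightarrow> r < \<rho> \<Longrightarrow> (\<Sum>n<N. b n * r ^ (2 * n)) \<le> B"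
  shows "(\<Sum>n<N. b n * \<rho> ^ (2 * n)) \<le> B"
proof (rule tendsto_upperbound)
  show "((\<lambda>r. \<Sum>n<N. b n * r ^ (2 * n)) \<longlongrightarrow> (\<Sum>n<N. b n * \<rho> ^ (2 * n))) (at_left \<rho>)"
    by (intro tendsto_intros)
  show "\<forall>\<^sub>F r in at_left \<rho>. (\<Sum>n<N. b n * r ^ (2 * n)) \<le> B"
    using eventually_at_left_real[OF r0] by eventually_elim (use B in auto)
qed simp

text \<open>Over each circle the mean of \<open>|g|\<^sup>2\<close> is a coefficient sum, by Parseval, and the mean of \<open>K\<close> is
  \<open>K(0)\<close>.\<close>

lemma coeff_sum_le_of_majorant:
  assumes g: "g holomorphic_on unit_disc" and K: "K holomorphic_on unit_disc"
    and maj: "\<And>z. z \<in> unit_disc \<Longrightarrow> (norm (g z))\<^sup>2 \<le> Re (K z)"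
  shows "(\<Sum>n<N. (norm (taylor_coeff g n))\<^sup>2) \<le> Re (K 0)"
proof -
  have *: "(\<Sum>n<N. (norm (taylor_coeff g n))\<^sup>2 * r ^ (2 * n)) \<le> Re (K 0)" if r: "0 < r" "r < 1" for r
  proof -
    let ?\<gamma> = "circlepath 0 r"
    obtain S where S: "(\<lambda>n. taylor_coeff g n * cnj (taylor_coeff g n) * of_real (r ^ (2 * n))) sums S"
      "((\<lambda>x. g (?\<gamma> x) * cnj (g (?\<gamma> x))) has_integral S) {0..1}"
      using parseval[OF g g r] .
    have K0: "((\<lambda>x. K (?\<gamma> x)) has_integral K 0) {0..1}"
      using circle_integral_orthogonality[OF K r, of 0] by simp
    have "Re S \<le> Re (K 0)"
    proof (rule has_integral_le[OF has_integral_Re[OF S(2)] has_integral_Re[OF K0]])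
      fix x :: real
      have "?\<gamma> x \<in> unit_disc" using r by (simp add: circlepath norm_mult)
      moreover have "g (?\<gamma> x) * cnj (g (?\<gamma> x)) = of_real ((norm (g (?\<gamma> x)))\<^sup>2)"
        by (simp add: complex_norm_square del: of_real_power)
      ultimately show "Re (g (?\<gamma> x) * cnj (g (?\<gamma> x))) \<le> Re (K (?\<gamma> x))"
        by (simp only: Re_complex_of_real maj)
    qed
    moreover have "(\<lambda>n. (norm (taylor_coeff g n))\<^sup>2 * r ^ (2 * n)) sums Re S"
      using sums_Re[OF S(1)] by (simp add: complex_norm_square[symmetric] flip: of_real_power of_real_mult)
    then have "(\<Sum>n<N. (norm (taylor_coeff g n))\<^sup>2 * r ^ (2 * n)) \<le> Re S"
      using sum_le_suminf[of "\<lambda>n. (norm (taylor_coeff g n))\<^sup>2 * r ^ (2 * n)" "{..<N}"] r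
      by (simp add: sums_iff)
    ultimately show ?thesis by linarith
  qed
  show ?thesis using sum_le_of_radius_limit[of 0 1 "\<lambda>n. (norm (taylor_coeff g n))\<^sup>2" N, OF _ *] by simp
qed

definition backward_shift :: "l2 \<Rightarrow> l2"
  where "backward_shift x = Abs_l2 (\<lambda>n. coord x (Suc n))"

lemma coord_backward_shift [simp]: "coord (backward_shift x) n = coord x (Suc n)"
  unfolding backward_shift_def using summable_coord[of x]
  by (subst coord_Abs) (auto simp: summable_Suc_iff[of "\<lambda>n. (norm (coord x n))\<^sup>2"])

lemma norm_backward_shift: "(norm x)\<^sup>2 = (norm (coord x 0))\<^sup>2 + (norm (backward_shift x))\<^sup>2"
proof -
  have "(\<lambda>n. (norm (coord x (Suc n)))\<^sup>2) sums ((norm x)\<^sup>2 - (norm (coord x 0))\<^sup>2)"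
    using norm_l2_sums[of x] by (subst sums_Suc_iff) simp
  then show ?thesis using norm_l2_sums[of "backward_shift x"] by (simp add: sums_unique2 sums_iff)
qed

lemma norm_backward_shift_le: "norm (backward_shift x) \<le> norm x"
  by (rule power2_le_imp_le) (auto simp: norm_backward_shift[of x])

lemma bounded_linear_backward_shift: "bounded_linear backward_shift"
  by (rule bounded_linear_intro[where K = 1]) (auto intro!: l2_eqI simp: norm_backward_shift_le)

lemma coord_backward_shift_funpow: "coord ((backward_shift ^^ k) x) n = coord x (n + k)"
  by (induction k arbitrary: n) auto

text \<open>The squared modulus of a Hardy function has a harmonic majorant whose value at \<open>0\<close> is the squared
  norm. With \<open>S\<close> the backward shift, the vector \<open>s = \<Sum> z\<^sup>k S\<^sup>k x\<close> solves \<open>s = x + z S s\<close> and has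
  \<open>f(z)\<close> as its coordinate \<open>0\<close>. The majorant is
  \<open>2 Re \<langle>s, x\<rangle> - \<parallel>x\<parallel>\<^sup>2 = \<parallel>s\<parallel>\<^sup>2 - \<parallel>s - x\<parallel>\<^sup>2 = \<parallel>s\<parallel>\<^sup>2 - |z|\<^sup>2 \<parallel>S s\<parallel>\<^sup>2\<close>, which is at least
  \<open>\<parallel>s\<parallel>\<^sup>2 - \<parallel>S s\<parallel>\<^sup>2 = |f(z)|\<^sup>2\<close>.\<close>

lemma harmonic_majorant:
  assumes f: "f holomorphic_on unit_disc" and x: "\<And>n. coord x n = taylor_coeff f n"
  obtains H where "H holomorphic_on unit_disc"
    "\<And>z. z \<in> unit_disc \<Longrightarrow> (norm (f z))\<^sup>2 \<le> Re (2 * H z - of_real ((norm x)\<^sup>2))"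
    "\<And>z. z \<in> unit_disc \<Longrightarrow> Re (H z) \<le> (norm x)\<^sup>2 / (1 - norm z)"
proof -
  let ?B = backward_shift
  define s where "s z = (\<Sum>k. cscale (z ^ k) ((?B ^^ k) x))" for z
  define H where "H z = cin (s z) x" for z
  have Bn: "norm ((?B ^^ k) x) \<le> norm x" for k
    by (induction k) (simp_all add: order_trans[OF norm_backward_shift_le])
  have sums: "(\<lambda>k. cscale (z ^ k) ((?B ^^ k) x)) sums s z"
    and ns: "norm (s z) \<le> norm x / (1 - norm z)" if z: "z \<in> unit_disc" for z
  proof -
    have g: "summable (\<lambda>k. norm z ^ k * norm x)"
      using z by (intro summable_mult2 summable_geometric) simp
    have bd: "norm (cscale (z ^ k) ((?B ^^ k) x)) \<le> norm z ^ k * norm x" for k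
      by (simp add: norm_power mult_left_mono Bn)
    have sn: "summable (\<lambda>k. norm (cscale (z ^ k) ((?B ^^ k) x)))"
      by (rule summable_comparison_test'[OF g]) (use bd in simp)
    then show "(\<lambda>k. cscale (z ^ k) ((?B ^^ k) x)) sums s z"
      unfolding s_def by (rule summable_sums[OF summable_norm_cancel])
    have "norm (s z) \<le> (\<Sum>k. norm (cscale (z ^ k) ((?B ^^ k) x)))"
      unfolding s_def by (rule summable_norm[OF sn])
    also have "\<dots> \<le> (\<Sum>k. norm z ^ k * norm x)" by (rule suminf_le[OF bd sn g])
    also have "\<dots> = (\<Sum>k. norm z ^ k) * norm x"
      by (rule suminf_mult2[symmetric, OF summable_geometric]) (use z in simp)
    also have "(\<Sum>k. norm z ^ k) = 1 / (1 - norm z)"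
      by (rule suminf_geometric) (use z in simp)
    finally show "norm (s z) \<le> norm x / (1 - norm z)" by simp
  qed
  have Hs: "(\<lambda>k. cin ((?B ^^ k) x) x * z ^ k) sums H z" if "z \<in> unit_disc" for z
    using bounded_linear.sums[OF bounded_bilinear.bounded_linear_left[OF bounded_bilinear_cin] sums[OF that], of x]
    by (simp add: H_def cin_cscale_left mult.commute)
  have rec: "s z = x + cscale z (?B (s z))" if z: "z \<in> unit_disc" for z
  proof -
    have "(\<lambda>k. cscale (z ^ Suc k) ((?B ^^ Suc k) x)) sums (s z - cscale (z ^ 0) ((?B ^^ 0) x))"
      using sums[OF z] by (subst sums_Suc_iff) simp
    moreover have "(\<lambda>k. cscale z (?B (cscale (z ^ k) ((?B ^^ k) x)))) sums cscale z (?B (s z))"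
      by (intro bounded_linear.sums[OF bounded_linear_cscale_right]
          bounded_linear.sums[OF bounded_linear_backward_shift] sums z)
    moreover have "cscale z (?B (cscale c y)) = cscale (z * c) (?B y)" for c y
      by (rule l2_eqI) simp
    ultimately have "s z - x = cscale z (?B (s z))" by (simp add: sums_iff)
    then show ?thesis by (metis add.commute diff_add_cancel)
  qed
  have s0: "coord (s z) 0 = f z" if z: "z \<in> unit_disc" for z
    using bounded_linear.sums[OF bounded_linear_coord sums[OF z], of 0] taylor_coeff_sums[OF f z]
    by (simp add: coord_backward_shift_funpow x mult.commute sums_iff)
  show thesis
  proof (rule that)
    show "H holomorphic_on unit_disc" using Hs by (rule holomorphic_of_sums)
    fix z :: complex assume z: "z \<in> unit_disc"
    have "Re (2 * H z - of_real ((norm x)\<^sup>2)) = (norm (s z))\<^sup>2 - (norm (s z - x))\<^sup>2"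
      unfolding H_def power2_norm_eq_inner
      by (simp add: inner_diff_left inner_diff_right inner_commute[of x "s z"] inner_eq_Re_cin[of "s z" x])
    moreover have "(norm (s z - x))\<^sup>2 \<le> (norm (?B (s z)))\<^sup>2"
    proof (rule power_mono)
      have "s z - x = cscale z (?B (s z))" using rec[OF z] by (metis add_diff_cancel_left')
      then show "norm (s z - x) \<le> norm (?B (s z))" using z by (simp add: mult_left_le_one_le)
    qed simp
    ultimately show "(norm (f z))\<^sup>2 \<le> Re (2 * H z - of_real ((norm x)\<^sup>2))"
      using norm_backward_shift[of "s z"] s0[OF z] by simp
    have "Re (H z) \<le> norm (s z) * norm x"
      unfolding H_def using norm_cin_le complex_Re_le_cmod order_trans by blast
    also have "\<dots> \<le> norm x / (1 - norm z) * norm x" by (intro mult_right_mono ns z) simp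
    finally show "Re (H z) \<le> (norm x)\<^sup>2 / (1 - norm z)" by (simp add: power2_eq_square)
  qed
qed

text \<open>Composing the harmonic majorant of \<open>|f|\<^sup>2\<close> with \<open>\<phi>\<close> gives one for \<open>|f \<circ> \<phi>|\<^sup>2\<close>, and its value at \<open>0\<close>
  bounds the squared norm.\<close>

lemma littlewood_subordination:
  assumes f: "f holomorphic_on unit_disc" and x: "\<And>n. coord x n = taylor_coeff f n"
    and \<phi>: "\<phi> holomorphic_on unit_disc" "\<phi> ` unit_disc \<subseteq> unit_disc"
  shows "(\<Sum>n<N. (norm (taylor_coeff (f \<circ> \<phi>) n))\<^sup>2)
    \<le> (1 + norm (\<phi> 0)) / (1 - norm (\<phi> 0)) * (norm x)\<^sup>2"
proof -
  obtain H where H: "H holomorphic_on unit_disc"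
    "\<And>z. z \<in> unit_disc \<Longrightarrow> (norm (f z))\<^sup>2 \<le> Re (2 * H z - of_real ((norm x)\<^sup>2))"
    "\<And>z. z \<in> unit_disc \<Longrightarrow> Re (H z) \<le> (norm x)\<^sup>2 / (1 - norm z)"
    using harmonic_majorant[OF f x] by blast
  have a: "\<phi> 0 \<in> unit_disc" using \<phi>(2) by force
  have hc: "h \<circ> \<phi> holomorphic_on unit_disc" if "h holomorphic_on unit_disc" for h
    by (rule holomorphic_on_compose_gen[OF \<phi>(1) that]) (use \<phi>(2) in blast)
  have "(\<Sum>n<N. (norm (taylor_coeff (f \<circ> \<phi>) n))\<^sup>2) \<le> Re (2 * H (\<phi> 0) - of_real ((norm x)\<^sup>2))"
    unfolding o_apply[symmetric, of H]
  proof (rule coeff_sum_le_of_majorant[OF hc[OF f]])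
    show "(\<lambda>z. 2 * (H \<circ> \<phi>) z - of_real ((norm x)\<^sup>2)) holomorphic_on unit_disc"
      by (intro holomorphic_on_diff holomorphic_on_mult holomorphic_on_const hc H(1))
    fix z :: complex assume "z \<in> unit_disc"
    then have "\<phi> z \<in> unit_disc" using \<phi>(2) by blast
    then show "(norm ((f \<circ> \<phi>) z))\<^sup>2 \<le> Re (2 * (H \<circ> \<phi>) z - of_real ((norm x)\<^sup>2))"
      unfolding o_apply by (rule H(2))
  qed
  also have "\<dots> \<le> 2 * ((norm x)\<^sup>2 / (1 - norm (\<phi> 0))) - (norm x)\<^sup>2"
    using H(3)[OF a] by simp
  also have "\<dots> = (1 + norm (\<phi> 0)) / (1 - norm (\<phi> 0)) * (norm x)\<^sup>2"
    using a by (simp add: field_simps)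
  finally show ?thesis .
qed

section \<open>Weighted spaces on the disc as sequence spaces\<close>

text \<open>A lower bound for the weight makes square-summable sequences into Taylor coefficients of functions
  that are holomorphic in the whole disc, so that the map to sequences is onto.\<close>

locale disc_weight =
  fixes w :: "nat \<Rightarrow> real"
  assumes w_ge: "1 \<le> w n"
begin

abbreviation H :: fun_space
  where "H \<equiv> weighted_space w"

lemma w_pos: "w n > 0"
  using w_ge[of n] by linarith

lemma vecs_iff: "f \<in> vecs H \<longleftrightarrow> f holomorphic_on unit_disc \<and> (\<forall>z. z \<notin> unit_disc \<longrightarrow> f z = 0) \<and>
    summable (\<lambda>n. w n * (norm (taylor_coeff f n))\<^sup>2)"
  by (simp add: weighted_space_def)

lemma vecs_holomorphic: "f \<in> vecs H \<Longrightarrow> f holomorphic_on unit_disc"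
  by (simp add: vecs_iff)

text \<open>The isometry between the weighted space and the sequence space, and its inverse.\<close>

definition to_l2 :: "(complex \<Rightarrow> complex) \<Rightarrow> l2"
  where "to_l2 f = Abs_l2 (\<lambda>n. of_real (sqrt (w n)) * taylor_coeff f n)"

definition of_l2 :: "l2 \<Rightarrow> complex \<Rightarrow> complex"
  where "of_l2 x = on_disc (\<lambda>z. \<Sum>n. coord x n / of_real (sqrt (w n)) * z ^ n)"

lemma norm_weighted_coeff: "(norm (of_real (sqrt (w n)) * taylor_coeff f n))\<^sup>2 = w n * (norm (taylor_coeff f n))\<^sup>2"
  using w_pos[of n] by (simp add: norm_mult power_mult_distrib)

lemma coord_to_l2: "f \<in> vecs H \<Longrightarrow> coord (to_l2 f) n = of_real (sqrt (w n)) * taylor_coeff f n"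
  unfolding to_l2_def vecs_iff by (subst coord_Abs) (simp_all only: norm_weighted_coeff)

lemma of_l2_sums:
  assumes z: "z \<in> unit_disc"
  shows "(\<lambda>n. coord x n / of_real (sqrt (w n)) * z ^ n) sums of_l2 x z"
proof -
  have "norm (coord x n / of_real (sqrt (w n)) * z ^ n) \<le> norm x * norm z ^ n" for n
  proof -
    have "norm (coord x n) / sqrt (w n) \<le> norm x / 1"
      using w_ge[of n] by (intro frac_le norm_coord_le) auto
    then show ?thesis using w_pos[of n] mult_right_mono[of _ _ "norm z ^ n"]
      by (fastforce simp: norm_mult norm_divide norm_power)
  qed
  then have "summable (\<lambda>n. coord x n / of_real (sqrt (w n)) * z ^ n)"
    using z by (intro summable_comparison_test'[OF summable_mult[OF summable_geometric], of "norm z" 0 _ "norm x"]) auto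
  then show ?thesis using z by (simp add: of_l2_def on_disc_def summable_sums)
qed

lemma of_l2_holomorphic: "of_l2 x holomorphic_on unit_disc"
  using of_l2_sums by (rule holomorphic_of_sums)

lemma taylor_coeff_of_l2: "taylor_coeff (of_l2 x) n = coord x n / of_real (sqrt (w n))"
  using of_l2_sums by (rule taylor_coeff_of_sums)

lemma of_l2_vecs: "of_l2 x \<in> vecs H"
proof -
  have "w n * (norm (taylor_coeff (of_l2 x) n))\<^sup>2 = (norm (coord x n))\<^sup>2" for n
    using w_pos[of n] by (simp add: taylor_coeff_of_l2 norm_divide power_divide)
  then show ?thesis unfolding vecs_iff
    using summable_coord[of x] by (simp add: of_l2_holomorphic) (simp add: of_l2_def on_disc_def)
qed

lemma to_of_l2 [simp]: "to_l2 (of_l2 x) = x"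
proof (rule l2_eqI)
  fix n
  show "coord (to_l2 (of_l2 x)) n = coord x n"
    using w_pos[of n] by (simp add: coord_to_l2[OF of_l2_vecs] taylor_coeff_of_l2)
qed

lemma vecs_eqI:
  assumes "f \<in> vecs H" "g \<in> vecs H" "\<And>n. taylor_coeff f n = taylor_coeff g n"
  shows "f = g"
proof
  fix z show "f z = g z"
    using taylor_coeff_inject[of f g z] assms by (cases "z \<in> unit_disc") (auto simp: vecs_iff)
qed

lemma of_to_l2: "f \<in> vecs H \<Longrightarrow> of_l2 (to_l2 f) = f"
  by (rule vecs_eqI[OF of_l2_vecs]) (use w_pos in \<open>auto simp: taylor_coeff_of_l2 coord_to_l2 less_imp_neq[THEN not_sym]\<close>)

lemma to_l2_inject: "f \<in> vecs H \<Longrightarrow> g \<in> vecs H \<Longrightarrow> to_l2 f = to_l2 g \<Longrightarrow> f = g"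
  by (metis of_to_l2)

lemma ip_eq: "f \<in> vecs H \<Longrightarrow> g \<in> vecs H \<Longrightarrow> ip H f g = cin (to_l2 f) (to_l2 g)"
proof -
  assume fg: "f \<in> vecs H" "g \<in> vecs H"
  have "of_real (w n) * taylor_coeff f n * cnj (taylor_coeff g n) = coord (to_l2 f) n * cnj (coord (to_l2 g) n)" for n
  proof -
    have "of_real (w n) = (of_real (sqrt (w n)) * of_real (sqrt (w n)) :: complex)"
      using w_pos[of n] by (simp flip: of_real_mult)
    then show ?thesis by (simp add: coord_to_l2 fg)
  qed
  then show ?thesis by (simp add: weighted_space_def cin_def)
qed

lemma hnorm_eq: "f \<in> vecs H \<Longrightarrow> hnorm H f = norm (to_l2 f)"
  by (simp add: hnorm_def ip_eq cin_self_norm)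

lemma norm_to_l2_square: "f \<in> vecs H \<Longrightarrow> (\<lambda>n. w n * (norm (taylor_coeff f n))\<^sup>2) sums (norm (to_l2 f))\<^sup>2"
  using norm_l2_sums[of "to_l2 f"] by (simp only: coord_to_l2 norm_weighted_coeff)

lemma to_l2_add:
  assumes "f \<in> vecs H" "g \<in> vecs H"
  shows "(\<lambda>z. f z + g z) \<in> vecs H" "to_l2 (\<lambda>z. f z + g z) = to_l2 f + to_l2 g"
proof -
  have tc: "taylor_coeff (\<lambda>z. f z + g z) n = taylor_coeff f n + taylor_coeff g n" for n
    by (rule taylor_coeff_add) (use assms vecs_holomorphic in auto)
  have "summable (\<lambda>n. w n * (norm (taylor_coeff (\<lambda>z. f z + g z) n))\<^sup>2)"
    unfolding tc using assms weighted_l2_triangle[OF w_pos] by (auto simp: vecs_iff)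
  then show v: "(\<lambda>z. f z + g z) \<in> vecs H"
    using assms by (auto simp: vecs_iff intro: holomorphic_on_add)
  show "to_l2 (\<lambda>z. f z + g z) = to_l2 f + to_l2 g"
    by (rule l2_eqI) (simp add: coord_to_l2 v assms tc algebra_simps)
qed

lemma to_l2_cmult:
  assumes "f \<in> vecs H"
  shows "(\<lambda>z. c * f z) \<in> vecs H" "to_l2 (\<lambda>z. c * f z) = cscale c (to_l2 f)"
proof -
  have tc: "taylor_coeff (\<lambda>z. c * f z) n = c * taylor_coeff f n" for n
    by (rule taylor_coeff_cmult) (use assms vecs_holomorphic in auto)
  have "summable (\<lambda>n. (norm c)\<^sup>2 * (w n * (norm (taylor_coeff f n))\<^sup>2))"
    using assms by (intro summable_mult) (simp add: vecs_iff)
  then show v: "(\<lambda>z. c * f z) \<in> vecs H"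
    using assms by (auto simp: vecs_iff tc norm_mult power_mult_distrib mult_ac intro: holomorphic_on_mult)
  show "to_l2 (\<lambda>z. c * f z) = cscale c (to_l2 f)"
    by (rule l2_eqI) (simp add: coord_to_l2 v assms tc algebra_simps)
qed

lemma to_l2_diff:
  assumes "f \<in> vecs H" "g \<in> vecs H"
  shows "(\<lambda>z. f z - g z) \<in> vecs H" "to_l2 (\<lambda>z. f z - g z) = to_l2 f - to_l2 g"
proof -
  have "cscale (- 1) x = - x" for x by (rule l2_eqI) simp
  then show "(\<lambda>z. f z - g z) \<in> vecs H" "to_l2 (\<lambda>z. f z - g z) = to_l2 f - to_l2 g"
    using to_l2_add[OF assms(1) to_l2_cmult(1)[OF assms(2), of "-1"]] to_l2_cmult(2)[OF assms(2), of "-1"]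
    by simp_all
qed

lemma of_l2_linear:
  "of_l2 (x + y) = (\<lambda>z. of_l2 x z + of_l2 y z)" "of_l2 (cscale c x) = (\<lambda>z. c * of_l2 x z)"
  by (rule to_l2_inject; simp add: of_l2_vecs to_l2_add to_l2_cmult)+

lemma hdist_eq: "f \<in> vecs H \<Longrightarrow> g \<in> vecs H \<Longrightarrow> hdist H f g = dist (to_l2 f) (to_l2 g)"
  by (simp add: hdist_def hnorm_eq to_l2_diff dist_norm)

sublocale metric: Metric_space "vecs H" "hdist H"
  by (rule Metric_space_weighted_space[OF w_pos])

text \<open>Limits in the norm topology become limits in a normed space of sequences.\<close>

lemma limitin_iff:
  "limitin (htopology H) F l (at_right (0::real)) \<longleftrightarrow> l \<in> vecs H \<and> (\<forall>\<^sub>F t in at_right 0. F t \<in> vecs H) \<and>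
    ((\<lambda>t. to_l2 (F t)) \<longlongrightarrow> to_l2 l) (at_right 0)"
proof -
  have "((\<lambda>t. hdist H (F t) l) \<longlongrightarrow> 0) (at_right 0) \<longleftrightarrow> ((\<lambda>t. to_l2 (F t)) \<longlongrightarrow> to_l2 l) (at_right 0)"
    if l: "l \<in> vecs H" and ev: "\<forall>\<^sub>F t in at_right 0. F t \<in> vecs H"
  proof -
    have "\<forall>\<^sub>F t in at_right 0. hdist H (F t) l = dist (to_l2 (F t)) (to_l2 l)"
      using ev by eventually_elim (simp add: hdist_eq l)
    then show ?thesis unfolding tendsto_dist_iff[of _ "to_l2 l"] by (rule tendsto_cong)
  qed
  then show ?thesis unfolding htopology_def metric.limitin_metric_dist_null by blast
qed

lemma continuous_map_of_l2: "continuous_map euclidean (htopology H) of_l2"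
  unfolding htopology_def metric.continuous_map_to_metric
proof (intro ballI allI impI)
  fix x :: l2 and e :: real assume e: "e > 0"
  show "\<exists>U. openin euclidean U \<and> x \<in> U \<and> (\<forall>y\<in>U. of_l2 y \<in> metric.mball (of_l2 x) e)"
    by (rule exI[of _ "ball x e"]) (use e in \<open>auto simp: of_l2_vecs hdist_eq\<close>)
qed

lemma bounded_operator_of_l2:
  assumes "bounded_linear P" and "\<And>c x. P (cscale c x) = cscale c (P x)"
  shows "bounded_operator H (\<lambda>f. of_l2 (P (to_l2 f)))"
proof -
  obtain K where K: "\<And>x. norm (P x) \<le> norm x * K" using bounded_linear.bounded[OF assms(1)] by blast
  have "hnorm H (of_l2 (P (to_l2 f))) \<le> K * hnorm H f" if "f \<in> vecs H" for f
    using K[of "to_l2 f"] that by (simp add: hnorm_eq of_l2_vecs mult.commute)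
  then show ?thesis unfolding bounded_operator_def
    by (auto simp: of_l2_vecs to_l2_add to_l2_cmult linear_add[OF bounded_linear.linear[OF assms(1)]] assms(2) of_l2_linear)
qed

lemma orthonormal_basis_of_l2: "orthonormal_basis H (range (\<lambda>n. of_l2 (basis_vec n)))"
  unfolding orthonormal_basis_def
proof (intro conjI ballI impI)
  show "range (\<lambda>n. of_l2 (basis_vec n)) \<subseteq> vecs H" using of_l2_vecs by auto
  fix e e' assume "e \<in> range (\<lambda>n. of_l2 (basis_vec n))" "e' \<in> range (\<lambda>n. of_l2 (basis_vec n))"
  then obtain m n where mn: "e = of_l2 (basis_vec m)" "e' = of_l2 (basis_vec n)" by auto
  have "e = e' \<longleftrightarrow> m = n"
    using mn by (metis coord_basis_vec to_of_l2 zero_neq_one)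
  then show "ip H e e' = (if e = e' then 1 else 0)"
    by (auto simp: mn ip_eq of_l2_vecs cin_basis_vec)
next
  fix f assume f: "f \<in> vecs H" and orth: "\<forall>e\<in>range (\<lambda>n. of_l2 (basis_vec n)). ip H f e = 0"
  have c0: "coord (to_l2 f) n = 0" for n
    using orth f by (simp add: ip_eq of_l2_vecs cin_basis_vec)
  have "taylor_coeff f n = 0" for n using c0[of n] w_pos[of n] by (simp add: coord_to_l2[OF f])
  then show "f = (\<lambda>z. 0)"
    by (intro vecs_eqI[OF f]) (auto simp: vecs_iff taylor_coeff_def)
qed

context
  fixes T :: operator
  assumes T: "bounded_operator H T"
    and summable: "summable (\<lambda>n. hnorm H (T (of_l2 (basis_vec n))))"
begin

definition conj_l2 :: "l2 \<Rightarrow> l2"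
  where "conj_l2 x = to_l2 (T (of_l2 x))"

lemma T_vecs: "f \<in> vecs H \<Longrightarrow> T f \<in> vecs H"
  using T by (simp add: bounded_operator_def)

lemma nuclear_conj_l2: "nuclear_map conj_l2"
proof (rule nuclear_map.intro)
  obtain K where K: "\<And>f. f \<in> vecs H \<Longrightarrow> hnorm H (T f) \<le> K * hnorm H f"
    using T unfolding bounded_operator_def by blast
  show hom: "conj_l2 (cscale c x) = cscale c (conj_l2 x)" for c x
    using T by (simp add: conj_l2_def of_l2_linear of_l2_vecs bounded_operator_def to_l2_cmult)
  show "bounded_linear conj_l2"
  proof (rule bounded_linear_intro[where K = K])
    show "conj_l2 (x + y) = conj_l2 x + conj_l2 y" for x y
      using T by (simp add: conj_l2_def of_l2_linear of_l2_vecs bounded_operator_def to_l2_add)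
    show "conj_l2 (r *\<^sub>R x) = r *\<^sub>R conj_l2 x" for r x
      using hom[of "of_real r" x] by (simp add: cscale_of_real)
    show "norm (conj_l2 x) \<le> norm x * K" for x
      using K[OF of_l2_vecs, of x] by (simp add: conj_l2_def hnorm_eq of_l2_vecs T_vecs mult.commute)
  qed
  show "summable (\<lambda>n. norm (conj_l2 (basis_vec n)))"
    using summable by (simp add: conj_l2_def hnorm_eq of_l2_vecs T_vecs)
qed

lemma T_eq: "f \<in> vecs H \<Longrightarrow> T f = of_l2 (conj_l2 (to_l2 f))"
  by (simp add: conj_l2_def of_to_l2 T_vecs)

lemma compact_of_summable: "compact_operator H T"
proof -
  interpret nuclear_map conj_l2 by (rule nuclear_conj_l2)
  obtain K where K: "compact K" "conj_l2 ` cball 0 1 \<subseteq> K" using compact_superset_image by blast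
  have c: "compactin (htopology H) (of_l2 ` K)"
    by (rule image_compactin[OF _ continuous_map_of_l2]) (use K(1) in simp)
  have cl: "closedin (htopology H) (of_l2 ` K)"
    using c unfolding htopology_def by (rule compactin_imp_closedin[OF metric.Hausdorff_space_mtopology])
  have "T ` {f \<in> vecs H. hnorm H f \<le> 1} \<subseteq> of_l2 ` K"
    using K(2) by (force simp: T_eq hnorm_eq)
  from closure_of_minimal[OF this cl]
  have "compactin (htopology H) (htopology H closure_of (T ` {f \<in> vecs H. hnorm H f \<le> 1}))"
    by (rule closed_compactin[OF c]) simp
  then show ?thesis using T by (simp add: compact_operator_def)
qed

text \<open>On the standard basis the trace of the absolute value \<open>P\<close> is dominated termwise, as
  \<open>|\<langle>P e\<^sub>n, e\<^sub>n\<rangle>| \<le> \<parallel>P e\<^sub>n\<parallel> = \<parallel>T e\<^sub>n\<parallel>\<close>.\<close>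

lemma trace_class_of_summable: "trace_class_operator H T"
proof -
  interpret nuclear_map conj_l2 by (rule nuclear_conj_l2)
  obtain P where P: "bounded_linear P" "\<And>c x. P (cscale c x) = cscale c (P x)"
    "\<And>x. P (P x) = adj (conj_l2 x)" "\<And>x. cin (P x) x \<in> \<real>\<^sub>\<ge>\<^sub>0" "\<And>x. norm (P x) = norm (conj_l2 x)"
    using ex_absolute_value by blast
  define P' where "P' f = of_l2 (P (to_l2 f))" for f
  define S where "S f = of_l2 (adj (to_l2 f))" for f
  have "positive_operator H P'"
    unfolding positive_operator_def P'_def[abs_def]
    using bounded_operator_of_l2[OF P(1,2)] P(4) by (simp add: ip_eq of_l2_vecs)
  moreover have "is_adjoint H T S"
    unfolding is_adjoint_def S_def[abs_def]
    using bounded_operator_of_l2[OF bounded_linear_adj adj_cscale]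
    by (simp add: ip_eq of_l2_vecs T_eq cin_image_eq)
  moreover have "\<forall>f\<in>vecs H. P' (P' f) = S (T f)"
    by (simp add: P'_def S_def P(3) T_eq)
  ultimately have abs: "is_abs_operator H T P'" unfolding is_abs_operator_def by blast
  have inj: "inj (\<lambda>n. of_l2 (basis_vec n))"
    by (rule injI) (metis coord_basis_vec to_of_l2 zero_neq_one)
  have "summable (\<lambda>n. norm (cin (P (basis_vec n)) (basis_vec n)))"
  proof (rule summable_comparison_test'[OF summable_basis])
    fix n :: nat assume "n \<ge> 0"
    show "norm (norm (cin (P (basis_vec n)) (basis_vec n))) \<le> norm (conj_l2 (basis_vec n))"
      using norm_cin_le[of "P (basis_vec n)" "basis_vec n"] by (simp add: P(5))
  qed
  then have "(\<lambda>n. cin (P (basis_vec n)) (basis_vec n)) summable_on UNIV"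
    by (rule norm_summable_imp_summable_on)
  then have "(\<lambda>e. ip H (P' e) e) summable_on range (\<lambda>n. of_l2 (basis_vec n))"
    by (subst summable_on_reindex[OF inj]) (simp add: o_def P'_def ip_eq of_l2_vecs)
  then show ?thesis
    unfolding trace_class_operator_def using T abs orthonormal_basis_of_l2 by blast
qed

end

end

section \<open>The flow of an inward-pointing holomorphic field\<close>

lemma holomorphic_bounded_cball:
  assumes "f holomorphic_on unit_disc" "R < 1"
  shows "\<exists>B>0. \<forall>z\<in>cball 0 R. norm (f z) \<le> B"
proof -
  have "continuous_on (cball 0 R) f"
    by (rule holomorphic_on_imp_continuous_on[OF holomorphic_on_subset[OF assms(1)]]) (use assms in auto)
  then have "bounded (f ` cball 0 R)"
    by (intro compact_imp_bounded compact_continuous_image) auto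
  then show ?thesis unfolding bounded_pos by auto
qed

text \<open>The width \<open>\<epsilon>\<close> of the boundary annulus may be decreased at will; with \<open>\<epsilon> \<le> 1 / 2\<close> the circles in the
  annulus stay away from the origin.\<close>

locale inward_field =
  fixes G :: "complex \<Rightarrow> complex" and \<delta> \<epsilon> :: real
  assumes hol_G: "G holomorphic_on unit_disc"
    and \<delta>_pos: "\<delta> > 0" and \<epsilon>_pos: "\<epsilon> > 0" and \<epsilon>_le: "\<epsilon> \<le> 1 / 2"
    and inward: "\<And>z. 1 - \<epsilon> < norm z \<Longrightarrow> norm z < 1 \<Longrightarrow> Re (cnj z * G z) \<le> - \<delta>"
begin

definition euler :: "real \<Rightarrow> complex \<Rightarrow> complex"
  where "euler h z = z + of_real h * G z"

definition flow :: "real \<Rightarrow> complex \<Rightarrow> complex"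
  where "flow t z = lim (\<lambda>N. (euler (t / real N) ^^ N) z)"

lemma continuous_G: "R < 1 \<Longrightarrow> continuous_on (cball 0 R) G"
  by (rule holomorphic_on_imp_continuous_on[OF holomorphic_on_subset[OF hol_G]]) auto

end

text \<open>The constants of the Euler scheme on one closed disc. They depend on the radius, since \<open>G\<close> may be
  unbounded near the unit circle.\<close>

locale euler_region = inward_field +
  fixes R M L h0 :: real
  assumes R: "1 - \<epsilon> < R" "R < 1" and M: "M > 0" and L: "L > 0" and h0: "h0 > 0"
    and G_bound: "z \<in> cball 0 R \<Longrightarrow> norm (G z) \<le> M"
    and G_lipschitz: "a \<in> cball 0 R \<Longrightarrow> b \<in> cball 0 R \<Longrightarrow> norm (G a - G b) \<le> L * norm (a - b)"
    and euler_inv: "0 \<le> h \<Longrightarrow> h \<le> h0 \<Longrightarrow> z \<in> cball 0 R \<Longrightarrow> euler h z \<in> cball 0 R"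
begin

lemma iter_in:
  assumes "0 \<le> h" "h \<le> h0" "z \<in> cball 0 R"
  shows "(euler h ^^ n) z \<in> cball 0 R"
  by (induction n) (use assms euler_inv in auto)

lemma iter_expand: "(euler h ^^ n) z = z + of_real h * (\<Sum>j<n. G ((euler h ^^ j) z))"
  by (induction n) (simp_all add: euler_def algebra_simps)

lemma iter_dist:
  assumes "0 \<le> h" "h \<le> h0" "z \<in> cball 0 R"
  shows "norm ((euler h ^^ n) z - z) \<le> real n * h * M"
proof -
  have "norm (\<Sum>j<n. G ((euler h ^^ j) z)) \<le> real (card {..<n}) * M"
    by (rule sum_norm_bound) (use G_bound iter_in assms in blast)
  then have "h * norm (\<Sum>j<n. G ((euler h ^^ j) z)) \<le> h * (real n * M)"
    using assms by (intro mult_left_mono) auto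
  then show ?thesis using assms by (subst iter_expand) (simp add: norm_mult mult_ac)
qed

text \<open>All intermediate points lie within \<open>h M\<close> of \<open>z\<close>, so the velocities used differ from \<open>G z\<close> by at most
  \<open>L h M\<close>, during a total time \<open>h\<close>.\<close>

lemma refine_step:
  assumes h: "0 \<le> h" "h \<le> h0" and z: "z \<in> cball 0 R" and m: "m \<ge> 1"
  shows "norm ((euler (h / real m) ^^ m) z - euler h z) \<le> L * M * h\<^sup>2"
proof -
  let ?k = "h / real m"
  have k: "0 \<le> ?k" "?k \<le> h" using h m by (auto simp: field_simps mult_le_cancel_left1)
  then have k0: "?k \<le> h0" using h by linarith
  have "norm (\<Sum>j<m. G ((euler ?k ^^ j) z) - G z) \<le> real (card {..<m}) * (L * (h * M))"
  proof (rule sum_norm_bound)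
    fix j assume j: "j \<in> {..<m}"
    have "norm (G ((euler ?k ^^ j) z) - G z) \<le> L * norm ((euler ?k ^^ j) z - z)"
      by (rule G_lipschitz[OF iter_in[OF k(1) k0 z] z])
    also have "norm ((euler ?k ^^ j) z - z) \<le> real j * ?k * M" by (rule iter_dist[OF k(1) k0 z])
    also have "\<dots> \<le> real m * ?k * M" using j k M by (intro mult_right_mono) auto
    also have "real m * ?k = h" using m by simp
    finally show "norm (G ((euler ?k ^^ j) z) - G z) \<le> L * (h * M)" using L by simp
  qed
  then have *: "?k * norm (\<Sum>j<m. G ((euler ?k ^^ j) z) - G z) \<le> ?k * (real m * (L * (h * M)))"
    using k by (intro mult_left_mono) auto
  have "(euler ?k ^^ m) z - euler h z = of_real ?k * (\<Sum>j<m. G ((euler ?k ^^ j) z) - G z)"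
    using m by (subst iter_expand) (simp add: euler_def sum_subtractf algebra_simps)
  then have "norm ((euler ?k ^^ m) z - euler h z) = ?k * norm (\<Sum>j<m. G ((euler ?k ^^ j) z) - G z)"
    using h by (simp add: norm_mult norm_divide)
  also note *
  also have "?k * (real m * (L * (h * M))) = L * M * h\<^sup>2" using m by (simp add: power2_eq_square)
  finally show ?thesis .
qed

lemma euler_lipschitz:
  assumes "0 \<le> h" "a \<in> cball 0 R" "b \<in> cball 0 R"
  shows "norm (euler h a - euler h b) \<le> (1 + h * L) * norm (a - b)"
proof -
  have "euler h a - euler h b = (a - b) + of_real h * (G a - G b)"
    by (simp add: euler_def algebra_simps)
  then have "norm (euler h a - euler h b) \<le> norm (a - b) + h * norm (G a - G b)"
    using norm_triangle_ineq[of "a - b" "of_real h * (G a - G b)"] assms by (simp add: norm_mult)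
  also have "\<dots> \<le> norm (a - b) + h * (L * norm (a - b))"
    by (intro add_left_mono mult_left_mono G_lipschitz assms)
  finally show ?thesis by (simp add: algebra_simps)
qed

text \<open>Local errors \<open>e\<close> accumulate over \<open>n\<close> steps, each amplified by at most \<open>(1 + h L)\<^sup>n \<le> exp (n h L)\<close>.\<close>

lemma iter_stable:
  assumes h: "0 \<le> h" "h \<le> h0" and z: "z \<in> cball 0 R" and e: "e \<ge> 0"
    and B: "\<And>w. w \<in> cball 0 R \<Longrightarrow> B w \<in> cball 0 R"
      "\<And>w. w \<in> cball 0 R \<Longrightarrow> norm (euler h w - B w) \<le> e"
  shows "norm ((euler h ^^ n) z - (B ^^ n) z) \<le> real n * e * exp (real n * h * L)"
proof -
  have hL: "1 \<le> 1 + h * L" using h L by simp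
  have Bn: "(B ^^ k) z \<in> cball 0 R" for k by (induction k) (use z B(1) in auto)
  have "norm ((euler h ^^ n) z - (B ^^ n) z) \<le> real n * e * (1 + h * L) ^ n"
  proof (induction n)
    case (Suc n)
    let ?a = "(euler h ^^ n) z" and ?b = "(B ^^ n) z"
    have "norm (euler h ?a - B ?b) \<le> norm (euler h ?a - euler h ?b) + norm (euler h ?b - B ?b)"
      by (rule order_trans[OF _ norm_triangle_ineq]) simp
    also have "\<dots> \<le> (1 + h * L) * norm (?a - ?b) + e"
      by (intro add_mono euler_lipschitz iter_in B(2) Bn h z)
    also have "\<dots> \<le> (1 + h * L) * (real n * e * (1 + h * L) ^ n) + e * (1 + h * L) ^ Suc n"
      using Suc hL e one_le_power[OF hL, of "Suc n"]
      by (intro add_mono mult_left_mono) (auto simp: mult_le_cancel_left1)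
    also have "\<dots> = real (Suc n) * e * (1 + h * L) ^ Suc n" by (simp add: algebra_simps)
    finally show ?case by simp
  qed simp
  also have "(1 + h * L) ^ n \<le> exp (h * L) ^ n"
    using hL by (intro power_mono) auto
  also have "exp (h * L) ^ n = exp (real n * h * L)" by (simp add: exp_of_nat_mult[symmetric] mult.assoc)
  finally show ?thesis using e by (simp add: mult_left_mono)
qed

text \<open>Over \<open>N\<close> steps of size \<open>t / N\<close> the local errors \<open>L M (t / N)\<^sup>2\<close> add up to this constant divided by
  \<open>N\<close>.\<close>

definition euler_error :: "real \<Rightarrow> real"
  where "euler_error t = L * M * t\<^sup>2 * exp (L * t)"

lemma refine:
  assumes t: "0 \<le> t" and N: "N \<ge> 1" "t / real N \<le> h0" and m: "m \<ge> 1" and z: "z \<in> cball 0 R"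
  shows "norm ((euler (t / real N) ^^ N) z - (euler (t / real (N * m)) ^^ (N * m)) z) \<le> euler_error t / real N"
proof -
  let ?h = "t / real N"
  have h: "0 \<le> ?h" "?h \<le> h0" using t N by auto
  have "?h / real m \<le> ?h / 1" by (rule divide_left_mono) (use h m in auto)
  then have hm: "0 \<le> ?h / real m" "?h / real m \<le> h0" using h t by auto
  have "norm ((euler ?h ^^ N) z - ((euler (?h / real m) ^^ m) ^^ N) z)
      \<le> real N * (L * M * ?h\<^sup>2) * exp (real N * ?h * L)"
    by (rule iter_stable[OF h z])
      (use L M iter_in[OF hm] refine_step[OF h _ m] in \<open>auto simp: norm_minus_commute\<close>)
  also have "\<dots> = euler_error t / real N"
    using N by (simp add: euler_error_def power2_eq_square field_simps)
  also have "(euler (?h / real m) ^^ m) ^^ N = euler (t / real (N * m)) ^^ (N * m)"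
    by (simp add: funpow_mult mult.commute)
  finally show ?thesis .
qed

lemma eventually_small: "\<forall>\<^sub>F N in sequentially. N \<ge> 1 \<and> t / real N \<le> h0"
proof -
  have "(\<lambda>N. t / real N) \<longlonglongrightarrow> 0" by (rule lim_const_over_n)
  then have "\<forall>\<^sub>F N in sequentially. t / real N < h0" by (rule order_tendstoD) (rule h0)
  with eventually_ge_at_top[of "1::nat"] show ?thesis by eventually_elim auto
qed

text \<open>The polygons with \<open>m\<close> and with \<open>n\<close> steps are compared with their common refinement into \<open>m n\<close>
  steps.\<close>

lemma flow_tendsto:
  assumes t: "0 \<le> t" and z: "z \<in> cball 0 R"
  shows "(\<lambda>N. (euler (t / real N) ^^ N) z) \<longlonglongrightarrow> flow t z"
proof -
  let ?a = "\<lambda>N. (euler (t / real N) ^^ N) z"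
  have "Cauchy ?a"
    unfolding Cauchy_iff
  proof (intro allI impI)
    fix e :: real assume e: "e > 0"
    have "(\<lambda>N. euler_error t / real N) \<longlonglongrightarrow> 0" by (rule lim_const_over_n)
    then have "\<forall>\<^sub>F N in sequentially. euler_error t / real N < e / 2"
      by (rule order_tendstoD) (use e in simp)
    with eventually_small[of t] have "\<forall>\<^sub>F N in sequentially. (N \<ge> 1 \<and> t / real N \<le> h0) \<and> euler_error t / real N < e / 2"
      by (rule eventually_conj)
    then obtain K where K: "\<And>N. N \<ge> K \<Longrightarrow> (N \<ge> 1 \<and> t / real N \<le> h0) \<and> euler_error t / real N < e / 2"
      unfolding eventually_sequentially by blast
    have "norm (?a m - ?a n) < e" if "m \<ge> K" "n \<ge> K" for m n
    proof -
      have "norm (?a m - ?a (m * n)) \<le> euler_error t / real m" "norm (?a n - ?a (n * m)) \<le> euler_error t / real n"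
        using K[OF that(1)] K[OF that(2)] refine[OF t _ _ _ z, of m n] refine[OF t _ _ _ z, of n m] by blast+
      then have "norm (?a m - ?a (m * n)) < e / 2" "norm (?a (m * n) - ?a n) < e / 2"
        using K[OF that(1)] K[OF that(2)] by (auto simp: mult.commute norm_minus_commute)
      then show ?thesis by (rule norm_diff_triangle_less[THEN order_less_le_trans]) simp
    qed
    then show "\<exists>K. \<forall>m\<ge>K. \<forall>n\<ge>K. norm (?a m - ?a n) < e" by blast
  qed
  then show ?thesis unfolding flow_def by (simp add: Cauchy_convergent_iff convergent_LIMSEQ_iff)
qed

lemma flow_error:
  assumes t: "0 \<le> t" and N: "N \<ge> 1" "t / real N \<le> h0" and z: "z \<in> cball 0 R"
  shows "norm ((euler (t / real N) ^^ N) z - flow t z) \<le> euler_error t / real N"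
proof (rule LIMSEQ_le_const2)
  have sm: "strict_mono (\<lambda>m. N * m)" using N by (simp add: strict_mono_def)
  show "(\<lambda>m. norm ((euler (t / real N) ^^ N) z - (euler (t / real (N * m)) ^^ (N * m)) z))
      \<longlonglongrightarrow> norm ((euler (t / real N) ^^ N) z - flow t z)"
    using LIMSEQ_subseq_LIMSEQ[OF flow_tendsto[OF t z] sm] by (intro tendsto_intros) (simp add: o_def)
  show "\<exists>K. \<forall>m\<ge>K. norm ((euler (t / real N) ^^ N) z - (euler (t / real (N * m)) ^^ (N * m)) z) \<le> euler_error t / real N"
    using refine[OF t N _ z] by blast
qed

lemma flow_in:
  assumes t: "0 \<le> t" and z: "z \<in> cball 0 R"
  shows "flow t z \<in> cball 0 R"
proof (rule Lim_in_closed_set[OF closed_cball _ _ flow_tendsto[OF t z]])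
  show "\<forall>\<^sub>F N in sequentially. (euler (t / real N) ^^ N) z \<in> cball 0 R"
    using eventually_small[of t] by eventually_elim (use t z iter_in in auto)
qed simp

lemma holomorphic_iter:
  assumes "0 \<le> h" "h \<le> h0"
  shows "(euler h ^^ n) holomorphic_on ball 0 R \<and> continuous_on (cball 0 R) (euler h ^^ n)"
proof (induction n)
  case (Suc n)
  have sub: "(euler h ^^ n) ` cball 0 R \<subseteq> cball 0 R" using iter_in assms by blast
  have "G holomorphic_on (euler h ^^ n) ` ball 0 R"
    by (rule holomorphic_on_subset[OF hol_G]) (use sub R ball_subset_cball in fastforce)
  then have "(\<lambda>z. G ((euler h ^^ n) z)) holomorphic_on ball 0 R"
    using Suc holomorphic_on_compose[of "euler h ^^ n" "ball 0 R" G] by (simp add: o_def)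
  moreover have "continuous_on (cball 0 R) (\<lambda>z. G ((euler h ^^ n) z))"
    by (rule continuous_on_compose2[OF continuous_G[OF R(2)]]) (use Suc sub in auto)
  ultimately show ?case using Suc
    by (auto simp: euler_def[abs_def] o_def intro!: holomorphic_intros continuous_intros)
qed (auto simp: id_def)

lemma flow_regular:
  assumes t: "0 \<le> t"
  shows "flow t holomorphic_on ball 0 R" "continuous_on (cball 0 R) (flow t)"
proof -
  have 1: "\<forall>\<^sub>F N in sequentially. continuous_on (cball 0 R) (euler (t / real N) ^^ N) \<and>
      (euler (t / real N) ^^ N) holomorphic_on ball 0 R"
    using eventually_small[of t] by eventually_elim (use t holomorphic_iter in auto)
  have 2: "uniform_limit (cball 0 R) (\<lambda>N. euler (t / real N) ^^ N) (flow t) sequentially"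
  proof (rule uniform_limitI)
    fix e :: real assume e: "e > 0"
    have "(\<lambda>N. euler_error t / real N) \<longlonglongrightarrow> 0" by (rule lim_const_over_n)
    then have "\<forall>\<^sub>F N in sequentially. euler_error t / real N < e" by (rule order_tendstoD) (rule e)
    with eventually_small[of t]
    show "\<forall>\<^sub>F N in sequentially. \<forall>z\<in>cball 0 R. dist ((euler (t / real N) ^^ N) z) (flow t z) < e"
      by eventually_elim (use flow_error[OF t] in \<open>force simp: dist_norm\<close>)
  qed
  from holomorphic_uniform_limit[OF 1 2]
  show "flow t holomorphic_on ball 0 R" "continuous_on (cball 0 R) (flow t)" by auto
qed

lemma flow_one_step:
  assumes t: "0 \<le> t" "t \<le> h0" and z: "z \<in> cball 0 R"
  shows "norm (flow t z - z - of_real t * G z) \<le> L * M * exp (L * h0) * t\<^sup>2"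
proof -
  have "norm (euler t z - flow t z) \<le> euler_error t"
    using flow_error[OF t(1), of 1 z] t z by simp
  also have "\<dots> \<le> L * M * exp (L * h0) * t\<^sup>2"
    using mult_left_mono[of "exp (L * t)" "exp (L * h0)" "L * M * t\<^sup>2"] L M t
    by (simp add: euler_error_def mult_ac)
  finally show ?thesis by (simp add: euler_def norm_minus_commute algebra_simps)
qed

lemma flow_lipschitz:
  assumes t: "0 \<le> t" and s: "0 \<le> s" and z: "z \<in> cball 0 R"
  shows "norm (flow t z - flow s z) \<le> \<bar>t - s\<bar> * M * exp (t * L)"
proof (rule tendsto_upperbound)
  show "(\<lambda>N. norm ((euler (t / real N) ^^ N) z - (euler (s / real N) ^^ N) z)) \<longlonglongrightarrow> norm (flow t z - flow s z)"
    by (intro tendsto_intros flow_tendsto t s z)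
  show "\<forall>\<^sub>F N in sequentially. norm ((euler (t / real N) ^^ N) z - (euler (s / real N) ^^ N) z)
      \<le> \<bar>t - s\<bar> * M * exp (t * L)"
    using eventually_small[of t] eventually_small[of s]
  proof eventually_elim
    case (elim N)
    have "norm ((euler (t / real N) ^^ N) z - (euler (s / real N) ^^ N) z)
        \<le> real N * (\<bar>t / real N - s / real N\<bar> * M) * exp (real N * (t / real N) * L)"
    proof (rule iter_stable)
      fix w :: complex assume w: "w \<in> cball 0 R"
      have "euler (t / real N) w - euler (s / real N) w = of_real (t / real N - s / real N) * G w"
        by (simp add: euler_def algebra_simps)
      then have "norm (euler (t / real N) w - euler (s / real N) w) = \<bar>t / real N - s / real N\<bar> * norm (G w)"
        by (simp only: norm_mult norm_of_real)
      then show "norm (euler (t / real N) w - euler (s / real N) w) \<le> \<bar>t / real N - s / real N\<bar> * M"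
        using G_bound[OF w] by (simp add: mult_left_mono)
      show "euler (s / real N) w \<in> cball 0 R" using w elim s euler_inv by simp
    qed (use elim t z M in auto)
    also have "\<dots> = \<bar>t - s\<bar> * M * exp (t * L)"
      using elim by (simp add: diff_divide_distrib[symmetric] abs_divide)
    finally show ?case .
  qed
qed simp

text \<open>The semigroup law for commensurable times: the Euler polygon for \<open>m t\<close> with \<open>m N\<close> steps is the
  \<open>m\<close>-fold iterate of the one for \<open>t\<close> with \<open>N\<close> steps.\<close>

lemma flow_multiple:
  assumes t: "0 \<le> t" and z: "z \<in> cball 0 R"
  shows "flow (real m * t) z = (flow t ^^ m) z"
proof (cases "m = 0")
  case True
  then show ?thesis using flow_tendsto[of 0 z] z
    by (simp add: euler_def[abs_def] id_def[symmetric] LIMSEQ_const_iff flip: id_def)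
next
  case False
  define E where "E N = euler (t / real N) ^^ N" for N
  have orbit: "(flow t ^^ k) z \<in> cball 0 R" for k
    by (induction k) (use z flow_in t in auto)
  have lim: "(\<lambda>N. (E N ^^ k) z) \<longlonglongrightarrow> (flow t ^^ k) z" for k
  proof (induction k)
    case (Suc k)
    let ?w = "(flow t ^^ k) z"
    have 1: "(\<lambda>N. E N ?w) \<longlonglongrightarrow> flow t ?w" unfolding E_def by (rule flow_tendsto[OF t orbit])
    have 2: "(\<lambda>N. E N ((E N ^^ k) z) - E N ?w) \<longlonglongrightarrow> 0"
    proof (rule Lim_null_comparison)
      show "(\<lambda>N. exp (t * L) * norm ((E N ^^ k) z - ?w)) \<longlonglongrightarrow> 0"
        using tendsto_mult_right_zero[OF tendsto_norm_zero[OF LIM_zero[OF Suc]]] by simp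
      show "\<forall>\<^sub>F N in sequentially. norm (E N ((E N ^^ k) z) - E N ?w) \<le> exp (t * L) * norm ((E N ^^ k) z - ?w)"
        using eventually_small[of t]
      proof eventually_elim
        case (elim N)
        let ?h = "t / real N"
        have h: "0 \<le> ?h" "?h \<le> h0" using t elim by auto
        have hL: "0 \<le> 1 + ?h * L" using mult_nonneg_nonneg[OF h(1) less_imp_le[OF L]] by simp
        have lip: "norm ((euler ?h ^^ n) a - (euler ?h ^^ n) b) \<le> (1 + ?h * L) ^ n * norm (a - b)"
          if "a \<in> cball 0 R" "b \<in> cball 0 R" for a b n
        proof (induction n)
          case (Suc n)
          have "norm ((euler ?h ^^ Suc n) a - (euler ?h ^^ Suc n) b)
              \<le> (1 + ?h * L) * norm ((euler ?h ^^ n) a - (euler ?h ^^ n) b)"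
            using euler_lipschitz[OF h(1) iter_in[OF h that(1)] iter_in[OF h that(2)]] by simp
          also have "\<dots> \<le> (1 + ?h * L) * ((1 + ?h * L) ^ n * norm (a - b))"
            by (intro mult_left_mono Suc hL)
          finally show ?case by (simp add: mult.assoc)
        qed simp
        have "(E N ^^ k) z \<in> cball 0 R"
          by (induction k) (use z iter_in[OF h] in \<open>auto simp: E_def\<close>)
        then have "norm (E N ((E N ^^ k) z) - E N ?w) \<le> (1 + ?h * L) ^ N * norm ((E N ^^ k) z - ?w)"
          unfolding E_def by (rule lip[OF _ orbit])
        also have "(1 + ?h * L) ^ N \<le> exp (?h * L) ^ N"
          using hL by (intro power_mono) auto
        also have "exp (?h * L) ^ N = exp (t * L)" using elim by (simp add: exp_of_nat_mult[symmetric])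
        finally show ?case by (simp add: mult_right_mono)
      qed
    qed
    show ?case using tendsto_add[OF 2 1] by simp
  qed simp
  have "strict_mono (\<lambda>N. m * N)" using False by (simp add: strict_mono_def)
  from LIMSEQ_subseq_LIMSEQ[OF flow_tendsto[of "real m * t", OF _ z] this] t
  have "(\<lambda>N. (euler (real m * t / real (m * N)) ^^ (m * N)) z) \<longlonglongrightarrow> flow (real m * t) z"
    by (simp add: o_def)
  moreover have "euler (real m * t / real (m * N)) ^^ (m * N) = E N ^^ m" for N
    using False by (simp add: E_def funpow_mult mult.commute)
  ultimately show ?thesis using lim[of m] LIMSEQ_unique by simp
qed

text \<open>The times \<open>s\<close> and \<open>q s / N\<close> are commensurable, and \<open>q s / N\<close> tends to \<open>t\<close> if \<open>q\<close> is the integer part of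
  \<open>t N / s\<close>; the flow is continuous in time.\<close>

lemma flow_add:
  assumes t: "0 \<le> t" and s: "0 \<le> s" and z: "z \<in> cball 0 R"
  shows "flow (t + s) z = flow t (flow s z)"
proof (cases "s = 0")
  case True
  then show ?thesis using flow_multiple[of 0 z 0] z by simp
next
  case False
  \<comment> \<open>the common unit of time; the successor avoids division by zero\<close>
  define u where "u N = s / real (Suc N)" for N
  define q where "q N = nat \<lfloor>t / u N\<rfloor>" for N
  have u: "u N > 0" for N using False s by (simp add: u_def)
  have q: "real (q N) \<le> t / u N" "t / u N < real (q N) + 1" for N
    using t u[of N] by (auto simp: q_def intro: of_nat_floor)
  have \<tau>: "\<bar>real (q N) * u N - t\<bar> \<le> u N" for N
    using q[of N] u[of N] by (auto simp: field_simps abs_if)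
  have u0: "u \<longlonglongrightarrow> 0" unfolding u_def[abs_def]
    using LIMSEQ_Suc[OF lim_const_over_n[of s]] by simp
  have lim: "(\<lambda>N. flow (real (q N) * u N + c) w) \<longlonglongrightarrow> flow (t + c) w"
    if c: "c \<ge> 0" and w: "w \<in> cball 0 R" for c w
  proof (rule LIM_zero_cancel, rule Lim_null_comparison)
    show "(\<lambda>N. u N * (M * exp ((t + c) * L))) \<longlonglongrightarrow> 0"
      using tendsto_mult_left_zero[OF u0] by simp
    show "\<forall>\<^sub>F N in sequentially. norm (flow (real (q N) * u N + c) w - flow (t + c) w) \<le> u N * (M * exp ((t + c) * L))"
    proof (rule always_eventually, rule allI)
      fix N
      have "norm (flow (t + c) w - flow (real (q N) * u N + c) w)
          \<le> \<bar>(t + c) - (real (q N) * u N + c)\<bar> * M * exp ((t + c) * L)"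
        by (rule flow_lipschitz) (use t c u[of N] w in auto)
      also have "\<dots> \<le> u N * M * exp ((t + c) * L)"
        using \<tau>[of N] M by (intro mult_right_mono) auto
      finally show "norm (flow (real (q N) * u N + c) w - flow (t + c) w) \<le> u N * (M * exp ((t + c) * L))"
        by (simp add: norm_minus_commute mult.assoc)
    qed
  qed
  have "flow (real (q N) * u N + s) z = flow (real (q N) * u N) (flow s z)" for N
  proof -
    have sN: "s = real (Suc N) * u N" by (simp add: u_def)
    have u': "0 \<le> u N" using u[of N] by simp
    have "real (q N) * u N + s = real (q N + Suc N) * u N" by (subst sN) (simp add: algebra_simps)
    then have "flow (real (q N) * u N + s) z = (flow (u N) ^^ (q N + Suc N)) z"
      using flow_multiple[OF u' z] by metis
    also have "\<dots> = (flow (u N) ^^ q N) ((flow (u N) ^^ Suc N) z)" by (simp only: funpow_add o_def)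
    also have "(flow (u N) ^^ Suc N) z = flow s z" using flow_multiple[OF u' z, of "Suc N"] sN by metis
    also have "(flow (u N) ^^ q N) (flow s z) = flow (real (q N) * u N) (flow s z)"
      by (rule flow_multiple[OF u' flow_in[OF s z], symmetric])
    finally show ?thesis .
  qed
  then show ?thesis using lim[OF s z] lim[OF order_refl flow_in[OF s z]] by (simp add: LIMSEQ_unique)
qed

end

lemma norm_add_square: "(norm (a + b))\<^sup>2 = (norm a)\<^sup>2 + 2 * Re (cnj a * b) + (norm b)\<^sup>2" for a b :: complex
  unfolding cmod_power2 by (simp add: power2_eq_square algebra_simps)

context inward_field
begin

lemma ex_region:
  assumes R: "1 - \<epsilon> < R" "R < 1"
  shows "\<exists>M L h0. euler_region G \<delta> \<epsilon> R M L h0"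
proof -
  have cb: "cball 0 R \<subseteq> unit_disc" using R by auto
  obtain M where M: "M > 0" "\<And>z. z \<in> cball 0 R \<Longrightarrow> norm (G z) \<le> M"
    using holomorphic_bounded_cball[OF hol_G R(2)] by blast
  obtain L where L: "L > 0" "\<And>z. z \<in> cball 0 R \<Longrightarrow> norm (deriv G z) \<le> L"
    using holomorphic_bounded_cball[OF holomorphic_deriv[OF hol_G open_ball] R(2)] by blast
  have lip: "norm (G a - G b) \<le> L * norm (a - b)" if "a \<in> cball 0 R" "b \<in> cball 0 R" for a b
  proof (rule field_differentiable_bound[OF convex_cball _ L(2) that])
    fix z :: complex assume "z \<in> cball 0 R"
    then have "z \<in> unit_disc" using cb by blast
    then show "(G has_field_derivative deriv G z) (at z within cball 0 R)"
      using holomorphic_derivI[OF hol_G open_ball] has_field_derivative_at_within by blast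
  qed
  \<comment> \<open>In the annulus \<open>|z|\<^sup>2\<close> changes by at most \<open>- 2 h \<delta> + h\<^sup>2 M\<^sup>2\<close>, which is nonpositive by the first bound; from
    the smaller disc a step of length \<open>h M\<close> cannot leave the disc of radius \<open>R\<close> by the second.\<close>
  define h0 where "h0 = min (2 * \<delta> / M\<^sup>2) ((R - (1 - \<epsilon>)) / M)"
  have h0: "h0 > 0" using \<delta>_pos M(1) R by (simp add: h0_def)
  have inv: "euler h z \<in> cball 0 R" if h: "0 \<le> h" "h \<le> h0" and z: "z \<in> cball 0 R" for h z
  proof (cases "1 - \<epsilon> < norm z")
    case True
    have "h \<le> 2 * \<delta> / M\<^sup>2" using h by (simp add: h0_def)
    then have hM: "h * M\<^sup>2 \<le> 2 * \<delta>" using M(1) by (simp add: field_simps)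
    have "Re (cnj z * G z) \<le> - \<delta>" using True z R by (intro inward) auto
    then have "2 * (h * Re (cnj z * G z)) \<le> 2 * (h * (- \<delta>))" using h by (intro mult_left_mono) auto
    moreover have "h * (h * (norm (G z))\<^sup>2) \<le> h * (2 * \<delta>)"
    proof (rule mult_left_mono[OF _ h(1)])
      have "h * (norm (G z))\<^sup>2 \<le> h * M\<^sup>2" using h M(2)[OF z] by (intro mult_left_mono power_mono) auto
      then show "h * (norm (G z))\<^sup>2 \<le> 2 * \<delta>" using hM by linarith
    qed
    moreover have "(norm (euler h z))\<^sup>2 = (norm z)\<^sup>2 + 2 * (h * Re (cnj z * G z)) + h * (h * (norm (G z))\<^sup>2)"
      unfolding euler_def norm_add_square by (simp add: norm_mult power_mult_distrib power2_eq_square algebra_simps)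
    ultimately have "(norm (euler h z))\<^sup>2 \<le> (norm z)\<^sup>2" by linarith
    then have "norm (euler h z) \<le> norm z" by (rule power2_le_imp_le) simp
    then show ?thesis using z by simp
  next
    case False
    have "h \<le> (R - (1 - \<epsilon>)) / M" using h by (simp add: h0_def)
    then have "h * M \<le> R - (1 - \<epsilon>)" using M(1) by (simp add: field_simps)
    moreover have "h * norm (G z) \<le> h * M" using h M(2)[OF z] by (intro mult_left_mono) auto
    moreover have "norm (euler h z) \<le> norm z + h * norm (G z)"
      using norm_triangle_ineq[of z "of_real h * G z"] h by (simp add: euler_def norm_mult)
    ultimately show ?thesis using False by simp
  qed
  have "euler_region G \<delta> \<epsilon> R M L h0"
    by unfold_locales (use R M L h0 lip inv in auto)
  then show ?thesis by blast
qed

lemma region_of_point: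
  assumes "z \<in> unit_disc"
  obtains R where "1 - \<epsilon> < R" "R < 1" "z \<in> ball 0 R"
proof -
  define R where "R = max ((norm z + 1) / 2) (1 - \<epsilon> / 2)"
  have "1 - \<epsilon> < R" "R < 1" "norm z < R" using assms \<epsilon>_pos by (auto simp: R_def less_max_iff_disj)
  then show thesis using that by auto
qed

lemma flow_cball:
  assumes "1 - \<epsilon> < R" "R < 1" "0 \<le> t" "z \<in> cball 0 R"
  shows "flow t z \<in> cball 0 R"
  using ex_region[OF assms(1,2)] euler_region.flow_in assms(3,4) by blast

lemma flow_disc:
  assumes "0 \<le> t" "z \<in> unit_disc"
  shows "flow t z \<in> unit_disc"
proof -
  obtain R where R: "1 - \<epsilon> < R" "R < 1" "z \<in> ball 0 R" using region_of_point[OF assms(2)] .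
  then show ?thesis using flow_cball[OF R(1,2) assms(1), of z] by auto
qed

lemma flow_holomorphic:
  assumes "0 \<le> t"
  shows "flow t holomorphic_on unit_disc"
proof -
  have "flow t field_differentiable at z" if z: "z \<in> unit_disc" for z
  proof -
    obtain R where R: "1 - \<epsilon> < R" "R < 1" "z \<in> ball 0 R" using region_of_point[OF z] .
    then have "flow t holomorphic_on ball 0 R"
      using ex_region[OF R(1,2)] euler_region.flow_regular(1) assms by blast
    then show ?thesis using R(3) holomorphic_on_open[OF open_ball] field_differentiable_def by blast
  qed
  then show ?thesis by (simp add: holomorphic_on_def field_differentiable_at_within)
qed

lemma flow_zero: "z \<in> unit_disc \<Longrightarrow> flow 0 z = z"
  by (simp add: flow_def euler_def[abs_def] flip: id_def)

lemma flow_semigroup: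
  assumes "0 \<le> t" "0 \<le> s" "z \<in> unit_disc"
  shows "flow (t + s) z = flow t (flow s z)"
proof -
  obtain R where R: "1 - \<epsilon> < R" "R < 1" "z \<in> ball 0 R" using region_of_point[OF assms(3)] .
  then show ?thesis using ex_region[OF R(1,2)] euler_region.flow_add[OF _ assms(1,2)] by auto
qed

lemma flow_expansion:
  assumes R: "1 - \<epsilon> < R" "R < 1"
  obtains C h0 where "C > 0" "h0 > 0"
    "\<And>t z. 0 \<le> t \<Longrightarrow> t \<le> h0 \<Longrightarrow> z \<in> cball 0 R \<Longrightarrow> norm (flow t z - z - of_real t * G z) \<le> C * t\<^sup>2"
proof -
  obtain M L h0 where *: "euler_region G \<delta> \<epsilon> R M L h0" using ex_region[OF R] by blast
  show thesis
  proof (rule that)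
    show "L * M * exp (L * h0) > 0" "h0 > 0" using * by (auto simp: euler_region_def euler_region_axioms_def)
  qed (rule euler_region.flow_one_step[OF *])
qed

end

section \<open>Evolution along the flow and decay of the Dirichlet integral\<close>

text \<open>The hypotheses only look forward in time. The Lipschitz bound for \<open>Y\<close> allows the derivative at the
  left end of a small interval to be replaced by that at the right end, which covers backward
  increments.\<close>

lemma has_vector_derivative_of_quadratic_error:
  fixes X Y :: "real \<Rightarrow> complex"
  assumes C: "C > 0" and h0: "h0 > 0" and t: "t \<ge> 0"
    and X: "\<And>t h. 0 \<le> t \<Longrightarrow> 0 \<le> h \<Longrightarrow> h \<le> h0 \<Longrightarrow> norm (X (t + h) - X t - of_real h * Y t) \<le> C * h\<^sup>2"
    and Y: "\<And>t h. 0 \<le> t \<Longrightarrow> 0 \<le> h \<Longrightarrow> h \<le> h0 \<Longrightarrow> norm (Y (t + h) - Y t) \<le> C * h"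
  shows "(X has_vector_derivative Y t) (at t within {0..})"
  unfolding has_vector_derivative_def
proof (rule has_derivativeI_sandwich[OF h0])
  show "bounded_linear (\<lambda>h. h *\<^sub>R Y t)" by (rule bounded_linear_scaleR_left)
  fix s assume s: "s \<in> {0..}" "s \<noteq> t" "dist s t < h0"
  have "norm (X s - X t - of_real (s - t) * Y t) \<le> 2 * C * (s - t)\<^sup>2"
  proof (cases "t \<le> s")
    case True
    then have "norm (X (t + (s - t)) - X t - of_real (s - t) * Y t) \<le> C * (s - t)\<^sup>2"
      using s t by (intro X) (auto simp: dist_real_def)
    also have "\<dots> \<le> 2 * C * (s - t)\<^sup>2" using C by (intro mult_right_mono) auto
    finally show ?thesis by simp
  next
    case False
    define k where "k = t - s"
    have k: "0 \<le> k" "k \<le> h0" "t = s + k" using False s by (auto simp: k_def dist_real_def)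
    have "norm (X (s + k) - X s - of_real k * Y s) \<le> C * k\<^sup>2" using s k by (intro X) auto
    moreover have "norm (of_real k * (Y (s + k) - Y s)) \<le> k * (C * k)"
      unfolding norm_mult using Y[of s k] s k by (intro mult_mono) auto
    moreover have "X s - X t - of_real (s - t) * Y t
        = of_real k * (Y (s + k) - Y s) - (X (s + k) - X s - of_real k * Y s)"
      using k by (simp add: algebra_simps)
    ultimately have "norm (X s - X t - of_real (s - t) * Y t) \<le> k * (C * k) + C * k\<^sup>2"
      by (smt (verit) norm_triangle_ineq4)
    then show ?thesis by (simp add: k_def power2_eq_square algebra_simps)
  qed
  then show "norm (X s - X t - (s - t) *\<^sub>R Y t) / norm (s - t) \<le> 2 * C * \<bar>s - t\<bar>"
    using s(2) power2_abs[of "s - t"]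
    by (simp add: scaleR_conv_of_real divide_le_eq mult.assoc flip: power2_eq_square)
next
  have "((\<lambda>s. 2 * C * \<bar>s - t\<bar>) \<longlongrightarrow> 2 * C * \<bar>t - t\<bar>) (at t within {0..})"
    by (intro tendsto_intros)
  then show "((\<lambda>s. 2 * C * \<bar>s - t\<bar>) \<longlongrightarrow> 0) (at t within {0..})" by simp
qed

lemma summable_power_times_geometric:
  fixes q :: real
  assumes "\<bar>q\<bar> < 1"
  shows "summable (\<lambda>n. real n ^ k * q ^ n)"
  using assms
proof (induction k arbitrary: q)
  case 0
  then show ?case by (simp add: summable_geometric)
next
  case (Suc k)
  have "summable (\<lambda>n. diffs (\<lambda>n. real n ^ k) n * q ^ n)"
    by (rule termdiff_converges[where K = 1]) (use Suc in auto)
  from summable_mult[OF this, of q] have "summable (\<lambda>n. real (Suc n) ^ Suc k * q ^ Suc n)"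
    by (simp add: diffs_def mult_ac)
  then show ?case by (subst summable_Suc_iff[symmetric])
qed

context inward_field
begin

text \<open>The operator \<open>A\<close> on all holomorphic functions, irrespective of its domain in a space.\<close>

definition drift :: "(complex \<Rightarrow> complex) \<Rightarrow> complex \<Rightarrow> complex"
  where "drift f z = G z * deriv f z"

lemma drift_holomorphic: "f holomorphic_on unit_disc \<Longrightarrow> drift f holomorphic_on unit_disc"
  unfolding drift_def[abs_def] by (intro holomorphic_on_mult hol_G holomorphic_deriv) auto

lemma comp_flow_holomorphic:
  assumes "f holomorphic_on unit_disc" "0 \<le> t"
  shows "f \<circ> flow t holomorphic_on unit_disc"
  by (rule holomorphic_on_compose_gen[OF flow_holomorphic[OF assms(2)] assms(1)])
    (use flow_disc[OF assms(2)] in blast)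

text \<open>Uniformity on closed discs is what makes the expansion pass to Taylor coefficients, by Cauchy's
  estimate.\<close>

lemma comp_flow_expansion:
  assumes f: "f holomorphic_on unit_disc" and R: "1 - \<epsilon> < R" "R < 1"
  obtains C h0 where "C > 0" "h0 > 0"
    "\<And>h z. 0 \<le> h \<Longrightarrow> h \<le> h0 \<Longrightarrow> z \<in> cball 0 R \<Longrightarrow>
      norm (f (flow h z) - f z - of_real h * drift f z) \<le> C * h\<^sup>2"
proof -
  obtain C1 h1 where C1: "C1 > 0" "h1 > 0"
    "\<And>t z. 0 \<le> t \<Longrightarrow> t \<le> h1 \<Longrightarrow> z \<in> cball 0 R \<Longrightarrow> norm (flow t z - z - of_real t * G z) \<le> C1 * t\<^sup>2"
    using flow_expansion[OF R] by blast
  obtain M where M: "M > 0" "\<And>z. z \<in> cball 0 R \<Longrightarrow> norm (G z) \<le> M"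
    using holomorphic_bounded_cball[OF hol_G R(2)] by blast
  have f': "(deriv ^^ i) f holomorphic_on unit_disc" for i
    by (rule holomorphic_higher_deriv[OF f open_ball])
  obtain B1 where B1: "B1 > 0" "\<And>z. z \<in> cball 0 R \<Longrightarrow> norm ((deriv ^^ 1) f z) \<le> B1"
    using holomorphic_bounded_cball[OF f' R(2)] by metis
  obtain B2 where B2: "B2 > 0" "\<And>z. z \<in> cball 0 R \<Longrightarrow> norm ((deriv ^^ Suc 1) f z) \<le> B2"
    using holomorphic_bounded_cball[OF f' R(2)] by metis
  show thesis
  proof (rule that)
    show "B2 * (M + C1)\<^sup>2 + B1 * C1 > 0" using B1 B2 M C1 by (simp add: add_pos_pos)
    show "min h1 1 > 0" using C1 by simp
    fix h :: real and z :: complex assume h: "0 \<le> h" "h \<le> min h1 1" and z: "z \<in> cball 0 R"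
    let ?b = "flow h z"
    have b: "?b \<in> cball 0 R" by (rule flow_cball[OF R h(1) z])
    have e: "norm (?b - z - of_real h * G z) \<le> C1 * h\<^sup>2" using h by (intro C1(3) z) auto
    have "norm (?b - z) \<le> norm (?b - z - of_real h * G z) + norm (of_real h * G z)"
      by (rule order_trans[OF _ norm_triangle_ineq]) simp
    also have "\<dots> \<le> C1 * h + h * M"
    proof (rule add_mono)
      have "C1 * h\<^sup>2 \<le> C1 * h" using h C1 by (intro mult_left_mono) (auto simp: power2_eq_square mult_left_le)
      then show "norm (?b - z - of_real h * G z) \<le> C1 * h" using e by linarith
      show "norm (of_real h * G z) \<le> h * M" using h M(2)[OF z] by (simp add: norm_mult mult_left_mono)
    qed
    finally have bz: "norm (?b - z) \<le> (M + C1) * h" by (simp add: algebra_simps)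
    have "norm ((deriv ^^ 0) f ?b - (\<Sum>i\<le>1. (deriv ^^ i) f z * (?b - z) ^ i / fact i)) \<le> B2 * norm (?b - z) ^ Suc 1 / fact 1"
    proof (rule complex_Taylor[where f = "\<lambda>i. (deriv ^^ i) f" and n = 1, OF convex_cball[of 0 R] _ B2(2) z b])
      fix i :: nat and w :: complex assume w: "w \<in> cball 0 R"
      have "w \<in> unit_disc" using w R by auto
      from holomorphic_derivI[OF f' open_ball this]
      show "((deriv ^^ i) f has_field_derivative (deriv ^^ Suc i) f w) (at w within cball 0 R)"
        by (simp add: has_field_derivative_at_within)
    qed
    then have "norm (f ?b - f z - deriv f z * (?b - z)) \<le> B2 * (norm (?b - z))\<^sup>2"
      by (simp add: power2_eq_square diff_diff_eq)
    also have "\<dots> \<le> B2 * ((M + C1) * h)\<^sup>2" using B2 bz by (intro mult_left_mono power_mono) auto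
    finally have 1: "norm (f ?b - f z - deriv f z * (?b - z)) \<le> B2 * (M + C1)\<^sup>2 * h\<^sup>2"
      by (simp add: power_mult_distrib)
    have 2: "norm (deriv f z * (?b - z - of_real h * G z)) \<le> B1 * (C1 * h\<^sup>2)"
      unfolding norm_mult using B1(1) B1(2)[OF z] e by (intro mult_mono) auto
    have "f ?b - f z - of_real h * drift f z = (f ?b - f z - deriv f z * (?b - z)) + deriv f z * (?b - z - of_real h * G z)"
      by (simp add: drift_def algebra_simps)
    then have "norm (f ?b - f z - of_real h * drift f z) \<le> norm (f ?b - f z - deriv f z * (?b - z)) + norm (deriv f z * (?b - z - of_real h * G z))"
      by (metis norm_triangle_ineq)
    then show "norm (f ?b - f z - of_real h * drift f z) \<le> (B2 * (M + C1)\<^sup>2 + B1 * C1) * h\<^sup>2"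
      using 1 2 by (simp add: algebra_simps)
  qed
qed

lemma comp_flow_lipschitz:
  assumes f: "f holomorphic_on unit_disc" and R: "1 - \<epsilon> < R" "R < 1"
  obtains C h0 where "C > 0" "h0 > 0"
    "\<And>h z. 0 \<le> h \<Longrightarrow> h \<le> h0 \<Longrightarrow> z \<in> cball 0 R \<Longrightarrow> norm (f (flow h z) - f z) \<le> C * h"
proof -
  obtain C h0 where C: "C > 0" "h0 > 0"
    "\<And>h z. 0 \<le> h \<Longrightarrow> h \<le> h0 \<Longrightarrow> z \<in> cball 0 R \<Longrightarrow>
      norm (f (flow h z) - f z - of_real h * drift f z) \<le> C * h\<^sup>2"
    using comp_flow_expansion[OF f R] by blast
  obtain M where M: "M > 0" "\<And>z. z \<in> cball 0 R \<Longrightarrow> norm (drift f z) \<le> M"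
    using holomorphic_bounded_cball[OF drift_holomorphic[OF f] R(2)] by blast
  show thesis
  proof (rule that)
    show "C * h0 + M > 0" "h0 > 0" using C M by (simp_all add: add_pos_pos)
    fix h :: real and z :: complex assume h: "0 \<le> h" "h \<le> h0" and z: "z \<in> cball 0 R"
    have "norm (f (flow h z) - f z) \<le> norm (f (flow h z) - f z - of_real h * drift f z) + norm (of_real h * drift f z)"
      by (rule order_trans[OF _ norm_triangle_ineq]) simp
    also have "\<dots> \<le> C * h\<^sup>2 + h * M"
      using h by (intro add_mono C(3) z) (auto simp: norm_mult intro!: mult_left_mono M(2)[OF z])
    also have "C * h\<^sup>2 \<le> C * (h0 * h)"
      using h C by (intro mult_left_mono) (auto simp: power2_eq_square mult_right_mono)
    finally show "norm (f (flow h z) - f z) \<le> (C * h0 + M) * h" by (simp add: algebra_simps)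
  qed
qed

text \<open>The increment of \<open>f \<circ> \<phi>\<^sub>t\<^sub>+\<^sub>h\<close> has two first-order expansions, as \<open>\<phi>\<^sub>t\<^sub>+\<^sub>h = \<phi>\<^sub>h \<circ> \<phi>\<^sub>t = \<phi>\<^sub>t \<circ> \<phi>\<^sub>h\<close>. Hence
  the time derivative \<open>(G f') \<circ> \<phi>\<^sub>t\<close> of \<open>f \<circ> \<phi>\<^sub>t\<close> equals \<open>G (f \<circ> \<phi>\<^sub>t)'\<close>.\<close>

lemma drift_comp_flow:
  assumes f: "f holomorphic_on unit_disc" and t: "0 \<le> t" and z: "z \<in> unit_disc"
  shows "drift (f \<circ> flow t) z = drift f (flow t z)"
proof (rule ccontr)
  let ?F = "f \<circ> flow t" and ?w = "flow t z"
  assume ne: "drift ?F z \<noteq> drift f ?w"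
  obtain R where R: "1 - \<epsilon> < R" "R < 1" "z \<in> ball 0 R" using region_of_point[OF z] .
  have zR: "z \<in> cball 0 R" using R(3) by auto
  have wR: "?w \<in> cball 0 R" by (rule flow_cball[OF R(1,2) t zR])
  obtain C1 h1 where 1: "C1 > 0" "h1 > 0"
    "\<And>h z. 0 \<le> h \<Longrightarrow> h \<le> h1 \<Longrightarrow> z \<in> cball 0 R \<Longrightarrow>
      norm (?F (flow h z) - ?F z - of_real h * drift ?F z) \<le> C1 * h\<^sup>2"
    using comp_flow_expansion[OF comp_flow_holomorphic[OF f t] R(1,2)] by blast
  obtain C2 h2 where 2: "C2 > 0" "h2 > 0"
    "\<And>h z. 0 \<le> h \<Longrightarrow> h \<le> h2 \<Longrightarrow> z \<in> cball 0 R \<Longrightarrow>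
      norm (f (flow h z) - f z - of_real h * drift f z) \<le> C2 * h\<^sup>2"
    using comp_flow_expansion[OF f R(1,2)] by blast
  define d where "d = norm (drift ?F z - drift f ?w)"
  have d: "d > 0" using ne by (simp add: d_def)
  \<comment> \<open>so small that the quadratic errors cannot add up to \<open>h d\<close>\<close>
  define h where "h = Min {h1, h2, d / (2 * (C1 + C2))}"
  have h: "h > 0" "h \<le> h1" "h \<le> h2" "h \<le> d / (2 * (C1 + C2))"
    using 1 2 d by (auto simp: h_def)
  have "flow t (flow h z) = flow h ?w"
    using flow_semigroup[OF t less_imp_le[OF h(1)] z] flow_semigroup[OF less_imp_le[OF h(1)] t z]
    by (simp add: add.commute)
  then have "of_real h * (drift ?F z - drift f ?w)
      = (f (flow h ?w) - f ?w - of_real h * drift f ?w) - (?F (flow h z) - ?F z - of_real h * drift ?F z)"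
    by (simp add: algebra_simps)
  then have "h * d \<le> norm (f (flow h ?w) - f ?w - of_real h * drift f ?w) + norm (?F (flow h z) - ?F z - of_real h * drift ?F z)"
    using norm_triangle_ineq4 h(1) unfolding d_def by (metis abs_of_pos norm_mult norm_of_real)
  also have "\<dots> \<le> C2 * h\<^sup>2 + C1 * h\<^sup>2"
    using h by (intro add_mono 1(3) 2(3) zR wR) auto
  also have "\<dots> = h * ((C1 + C2) * h)" by (simp add: power2_eq_square algebra_simps)
  finally have "d \<le> (C1 + C2) * h" using h(1) by simp
  also have "\<dots> \<le> (C1 + C2) * (d / (2 * (C1 + C2)))" using h 1 2 by (intro mult_left_mono) auto
  also have "\<dots> = d / 2" using 1(1) 2(1) by (simp add: field_simps)
  finally show False using d by simp
qed

lemma ex_radius: obtains R where "1 - \<epsilon> < R" "0 < R" "R < 1"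
  using that[of "1 - \<epsilon> / 2"] \<epsilon>_pos \<epsilon>_le by auto

text \<open>Cauchy's estimate on a circle inside an invariant disc turns the expansion of \<open>f\<close> along the flow,
  at the point \<open>\<phi>\<^sub>t(z)\<close>, into one for each Taylor coefficient, with constants that do not depend on
  \<open>t\<close>.\<close>

lemma taylor_coeff_comp_flow_derivative:
  assumes f: "f holomorphic_on unit_disc" and t: "0 \<le> t"
  shows "((\<lambda>t. taylor_coeff (f \<circ> flow t) n) has_vector_derivative taylor_coeff (drift f \<circ> flow t) n)
    (at t within {0..})"
proof -
  obtain R where R: "1 - \<epsilon> < R" "0 < R" "R < 1" by (rule ex_radius)
  note df = drift_holomorphic[OF f]
  obtain C1 h1 where 1: "C1 > 0" "h1 > 0"
    "\<And>h z. 0 \<le> h \<Longrightarrow> h \<le> h1 \<Longrightarrow> z \<in> cball 0 R \<Longrightarrow>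
      norm (f (flow h z) - f z - of_real h * drift f z) \<le> C1 * h\<^sup>2"
    using comp_flow_expansion[OF f R(1,3)] by blast
  obtain C2 h2 where 2: "C2 > 0" "h2 > 0"
    "\<And>h z. 0 \<le> h \<Longrightarrow> h \<le> h2 \<Longrightarrow> z \<in> cball 0 R \<Longrightarrow> norm (drift f (flow h z) - drift f z) \<le> C2 * h"
    using comp_flow_lipschitz[OF df R(1,3)] by blast
  define C where "C = max C1 C2 / R ^ n"
  have split: "flow (t + h) z = flow h (flow t z)" and inR: "flow t z \<in> cball 0 R"
    if "0 \<le> t" "0 \<le> h" "norm z = R" for t h z
    using flow_semigroup[of h t z] flow_cball[of R t z] that R by (auto simp: add.commute)
  show ?thesis
  proof (rule has_vector_derivative_of_quadratic_error[of C "min h1 h2"])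
    show "C > 0" "min h1 h2 > 0" using 1 2 R by (auto simp: C_def)
    fix t h :: real assume th: "0 \<le> t" "0 \<le> h" "h \<le> min h1 h2"
    have hol: "f \<circ> flow s holomorphic_on unit_disc" "drift f \<circ> flow s holomorphic_on unit_disc" if "0 \<le> s" for s
      using comp_flow_holomorphic f df that by auto
    have 3: "(\<lambda>z. (f \<circ> flow (t + h)) z - (f \<circ> flow t) z) holomorphic_on unit_disc"
      "(\<lambda>z. of_real h * (drift f \<circ> flow t) z) holomorphic_on unit_disc"
      using holomorphic_on_diff[OF hol(1)[of "t + h"] hol(1)[of t]]
        holomorphic_on_mult[OF holomorphic_on_const hol(2)[of t]] th by simp_all
    have "taylor_coeff (f \<circ> flow (t + h)) n - taylor_coeff (f \<circ> flow t) n - of_real h * taylor_coeff (drift f \<circ> flow t) n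
        = taylor_coeff (\<lambda>z. (f \<circ> flow (t + h)) z - (f \<circ> flow t) z - of_real h * (drift f \<circ> flow t) z) n"
      using th by (simp only: taylor_coeff_diff[OF 3] taylor_coeff_cmult taylor_coeff_diff hol add_nonneg_nonneg)
    also have "norm \<dots> \<le> (C1 * h\<^sup>2) / R ^ n"
    proof (rule taylor_coeff_bound[OF holomorphic_on_diff[OF 3] R(2,3)])
      fix z :: complex assume z: "norm z = R"
      show "norm ((f \<circ> flow (t + h)) z - (f \<circ> flow t) z - of_real h * (drift f \<circ> flow t) z) \<le> C1 * h\<^sup>2"
        using 1(3)[OF th(2) _ inR[OF th(1,2) z]] th split[OF th(1,2) z] by simp
    qed
    also have "\<dots> \<le> C * h\<^sup>2" using R unfolding C_def by (simp add: divide_right_mono mult_right_mono)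
    finally show "norm (taylor_coeff (f \<circ> flow (t + h)) n - taylor_coeff (f \<circ> flow t) n - of_real h * taylor_coeff (drift f \<circ> flow t) n) \<le> C * h\<^sup>2" .
    have 4: "drift f \<circ> flow (t + h) holomorphic_on unit_disc" "drift f \<circ> flow t holomorphic_on unit_disc"
      using hol th by auto
    have "norm (taylor_coeff (drift f \<circ> flow (t + h)) n - taylor_coeff (drift f \<circ> flow t) n) \<le> (C2 * h) / R ^ n"
      unfolding taylor_coeff_diff[OF 4, symmetric]
    proof (rule taylor_coeff_bound[OF holomorphic_on_diff[OF 4] R(2,3)])
      fix z :: complex assume z: "norm z = R"
      show "norm ((drift f \<circ> flow (t + h)) z - (drift f \<circ> flow t) z) \<le> C2 * h"
        using 2(3)[OF th(2) _ inR[OF th(1,2) z]] th split[OF th(1,2) z] by simp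
    qed
    also have "\<dots> \<le> C * h" using R th unfolding C_def by (simp add: divide_right_mono mult_right_mono)
    finally show "norm (taylor_coeff (drift f \<circ> flow (t + h)) n - taylor_coeff (drift f \<circ> flow t) n) \<le> C * h" .
  qed (rule t)
qed

lemma taylor_coeff_comp_flow_bound:
  assumes f: "f holomorphic_on unit_disc" and R: "1 - \<epsilon> < R" "0 < R" "R < 1"
  obtains A where "A > 0" "\<And>t n. 0 \<le> t \<Longrightarrow> norm (taylor_coeff (f \<circ> flow t) n) \<le> A / R ^ n"
proof -
  obtain A where A: "A > 0" "\<And>z. z \<in> cball 0 R \<Longrightarrow> norm (f z) \<le> A"
    using holomorphic_bounded_cball[OF f R(3)] by blast
  show thesis
  proof (rule that[OF A(1)])
    fix t :: real and n assume t: "0 \<le> t"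
    show "norm (taylor_coeff (f \<circ> flow t) n) \<le> A / R ^ n"
      by (rule taylor_coeff_bound[OF comp_flow_holomorphic[OF f t] R(2,3)])
        (use flow_cball[OF R(1,3) t] A(2) in auto)
  qed
qed

text \<open>With \<open>u = z F'\<close>, whose coefficients are \<open>n\<close> times those of \<open>F\<close>, the product \<open>G F' cnj u\<close> equals
  \<open>cnj z G |F'|\<^sup>2\<close>, and on the circle its real part is at most \<open>- \<delta> |F'|\<^sup>2 = - \<delta> |u|\<^sup>2 / r\<^sup>2\<close>. By Parseval this is
  an inequality between coefficient sums.\<close>

lemma energy_flux:
  assumes F: "F holomorphic_on unit_disc" and r: "1 - \<epsilon> < r" "0 < r" "r < 1"
  obtains S where "S \<le> 0"
    "(\<lambda>n. (real n * inner (taylor_coeff (drift F) n) (taylor_coeff F n)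
        + \<delta> / r\<^sup>2 * (real n)\<^sup>2 * (norm (taylor_coeff F n))\<^sup>2) * r ^ (2 * n)) sums S"
proof -
  let ?u = "\<lambda>z. z * deriv F z" and ?\<gamma> = "circlepath 0 r"
  let ?p = "\<lambda>z. drift F z + of_real (\<delta> / r\<^sup>2) * ?u z"
  have u: "?u holomorphic_on unit_disc"
    by (intro holomorphic_on_mult holomorphic_on_ident holomorphic_deriv F) auto
  have cu: "(\<lambda>z. of_real (\<delta> / r\<^sup>2) * ?u z) holomorphic_on unit_disc"
    by (intro holomorphic_on_mult holomorphic_on_const u)
  have p: "?p holomorphic_on unit_disc" by (rule holomorphic_on_add[OF drift_holomorphic[OF F] cu])
  obtain S where S: "(\<lambda>n. taylor_coeff ?p n * cnj (taylor_coeff ?u n) * of_real (r ^ (2 * n))) sums S"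
    "((\<lambda>x. ?p (?\<gamma> x) * cnj (?u (?\<gamma> x))) has_integral S) {0..1}"
    using parseval[OF p u r(2,3)] .
  show thesis
  proof (rule that[of "Re S"])
    have "Re S \<le> Re 0"
    proof (rule has_integral_le[OF has_integral_Re[OF S(2)] has_integral_Re[OF has_integral_0]])
      fix x :: real
      define z where "z = ?\<gamma> x"
      have nz: "norm z = r" using r by (simp add: z_def circlepath norm_mult)
      have inw: "Re (cnj z * G z) \<le> - \<delta>" using r nz by (intro inward) auto
      have "?p z * cnj (?u z) = (cnj z * G z) * (deriv F z * cnj (deriv F z))
          + of_real (\<delta> / r\<^sup>2) * ((z * cnj z) * (deriv F z * cnj (deriv F z)))"
        by (simp add: drift_def algebra_simps)
      also have "\<dots> = (cnj z * G z) * of_real ((norm (deriv F z))\<^sup>2)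
          + of_real (\<delta> / r\<^sup>2 * (r\<^sup>2 * (norm (deriv F z))\<^sup>2))"
        by (simp only: complex_norm_square[symmetric] nz of_real_mult[symmetric])
      finally have "Re (?p z * cnj (?u z)) = (Re (cnj z * G z) + \<delta>) * (norm (deriv F z))\<^sup>2"
        using r by (simp add: algebra_simps)
      then show "Re (?p (?\<gamma> x) * cnj (?u (?\<gamma> x))) \<le> Re 0"
        using inw by (simp add: z_def mult_nonpos_nonneg)
    qed
    then show "Re S \<le> 0" by simp
    have "Re (taylor_coeff ?p n * cnj (taylor_coeff ?u n) * of_real (r ^ (2 * n)))
       = (real n * inner (taylor_coeff (drift F) n) (taylor_coeff F n)
        + \<delta> / r\<^sup>2 * (real n)\<^sup>2 * (norm (taylor_coeff F n))\<^sup>2) * r ^ (2 * n)" for n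
    proof -
      have "taylor_coeff ?p n = taylor_coeff (drift F) n + of_real (\<delta> / r\<^sup>2) * (of_nat n * taylor_coeff F n)"
        by (simp only: taylor_coeff_add[OF drift_holomorphic[OF F] cu] taylor_coeff_cmult[OF u] taylor_coeff_times_deriv[OF F])
      then have "Re (taylor_coeff ?p n * cnj (taylor_coeff ?u n)) = real n * inner (taylor_coeff (drift F) n) (taylor_coeff F n)
        + \<delta> / r\<^sup>2 * (real n)\<^sup>2 * (norm (taylor_coeff F n))\<^sup>2"
        unfolding taylor_coeff_times_deriv[OF F] cmod_power2 inner_complex_def
        by (simp add: power2_eq_square algebra_simps add_divide_distrib)
      moreover have "Re (a * of_real b) = Re a * b" for a b by simp
      ultimately show ?thesis by (simp only:)
    qed
    then show "(\<lambda>n. (real n * inner (taylor_coeff (drift F) n) (taylor_coeff F n)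
        + \<delta> / r\<^sup>2 * (real n)\<^sup>2 * (norm (taylor_coeff F n))\<^sup>2) * r ^ (2 * n)) sums Re S"
      using sums_Re[OF S(1)] by (simp only:)
  qed
qed

text \<open>The Dirichlet integral of \<open>f\<^sub>t\<close> over the disc of radius \<open>r(t) = r0 + \<delta> t\<close> is \<open>\<pi>\<close> times
  \<open>\<Sum> n |x\<^sub>n|\<^sup>2 r\<^sup>2\<^sup>n\<close>. Its time derivative is the flux through the moving circle: the field carries out
  at least what the growing radius brings in, as \<open>r \<le> 1\<close>. Only partial sums are differentiated; the
  part of the nonpositive flux series that they miss is bounded by the tail of a convergent series \<open>b\<close>,
  uniformly in \<open>t\<close>.\<close>

lemma energy_decay:
  assumes f: "f holomorphic_on unit_disc" and r0: "1 - \<epsilon> < r0" and T: "T > 0" "r0 + \<delta> * T < 1"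
    and B: "\<And>M. (\<Sum>n<M. real n * (norm (taylor_coeff f n))\<^sup>2 * r0 ^ (2 * n)) \<le> B"
  shows "(\<Sum>n<N. real n * (norm (taylor_coeff (f \<circ> flow T) n))\<^sup>2 * (r0 + \<delta> * T) ^ (2 * n)) \<le> B"
proof -
  define x where "x n t = taylor_coeff (f \<circ> flow t) n" for n t
  define y where "y n t = taylor_coeff (drift f \<circ> flow t) n" for n t
  define r where "r t = r0 + \<delta> * t" for t
  define e where "e n t = (real n * inner (y n t) (x n t) + \<delta> / (r t)\<^sup>2 * (real n)\<^sup>2 * (norm (x n t))\<^sup>2) * r t ^ (2 * n)" for n t
  define E where "E M t = (\<Sum>n<M. real n * (norm (x n t))\<^sup>2 * r t ^ (2 * n))" for M t
  have r0': "0 < r0" using r0 \<epsilon>_le by simp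
  have r: "r0 \<le> r t" "r t \<le> r T" "1 - \<epsilon> < r t" "0 < r t" "r t < 1" if "t \<in> {0..T}" for t
  proof -
    have "\<delta> * t \<le> \<delta> * T" "0 \<le> \<delta> * t" using that \<delta>_pos by auto
    then show "r0 \<le> r t" "r t \<le> r T" "1 - \<epsilon> < r t" "0 < r t" "r t < 1"
      using r0 r0' T by (auto simp: r_def)
  qed
  have rT: "0 < r T" "r T < 1" using r[of T] T by auto
  \<comment> \<open>a larger invariant disc, on which Cauchy's estimate bounds all coefficients\<close>
  define R where "R = (r T + 1) / 2"
  have R: "1 - \<epsilon> < R" "0 < R" "R < 1" "r T < R" using r(3)[of T] rT T by (auto simp: R_def)
  define q where "q = (r T / R)\<^sup>2"
  have q: "0 \<le> q" "q < 1" using R rT power_strict_mono[of "r T / R" 1 2] by (auto simp: q_def)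
  obtain A1 where A1: "A1 > 0" "\<And>t n. 0 \<le> t \<Longrightarrow> norm (x n t) \<le> A1 / R ^ n"
    using taylor_coeff_comp_flow_bound[OF f R(1-3)] unfolding x_def by blast
  obtain A2 where A2: "A2 > 0" "\<And>t n. 0 \<le> t \<Longrightarrow> norm (y n t) \<le> A2 / R ^ n"
    using taylor_coeff_comp_flow_bound[OF drift_holomorphic[OF f] R(1-3)] unfolding y_def by blast
  define b where "b n = (A1 * A2 * real n + \<delta> / r0\<^sup>2 * A1\<^sup>2 * (real n)\<^sup>2) * q ^ n" for n
  have qR: "r t ^ (2 * n) / (R ^ n * R ^ n) \<le> q ^ n" if t: "t \<in> {0..T}" for t n
  proof -
    have "r t ^ (2 * n) \<le> r T ^ (2 * n)" using r[OF t] by (intro power_mono) auto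
    then have "r t ^ (2 * n) / (R ^ n * R ^ n) \<le> r T ^ (2 * n) / (R ^ n * R ^ n)"
      using R by (intro divide_right_mono) auto
    also have "\<dots> = q ^ n"
      by (simp add: q_def power_divide power_mult power_mult_distrib power2_eq_square)
    finally show ?thesis .
  qed
  have e_bound: "\<bar>e n t\<bar> \<le> b n" if t: "t \<in> {0..T}" for n t
  proof -
    have t0: "0 \<le> t" using t by simp
    have Rn: "R ^ n > 0" using R by simp
    have 1: "\<bar>inner (y n t) (x n t)\<bar> \<le> A1 * A2 / (R ^ n * R ^ n)"
    proof -
      have "\<bar>inner (y n t) (x n t)\<bar> \<le> norm (y n t) * norm (x n t)" by (rule Cauchy_Schwarz_ineq2)
      also have "\<dots> \<le> (A2 / R ^ n) * (A1 / R ^ n)"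
        using A1(2)[OF t0] A2(2)[OF t0] A1(1) A2(1) Rn by (intro mult_mono) auto
      finally show ?thesis by (simp add: mult_ac)
    qed
    have 2: "(norm (x n t))\<^sup>2 \<le> A1\<^sup>2 / (R ^ n * R ^ n)"
      using power_mono[OF A1(2)[OF t0] norm_ge_zero, of n 2] by (simp add: power_divide power2_eq_square)
    have 3: "\<delta> / (r t)\<^sup>2 \<le> \<delta> / r0\<^sup>2"
      using r[OF t] r0' \<delta>_pos by (intro divide_left_mono power_mono) auto
    have "\<bar>e n t\<bar> \<le> (real n * (A1 * A2 / (R ^ n * R ^ n)) + \<delta> / r0\<^sup>2 * (real n)\<^sup>2 * (A1\<^sup>2 / (R ^ n * R ^ n))) * r t ^ (2 * n)"
    proof -
      have "\<bar>real n * inner (y n t) (x n t)\<bar> \<le> real n * (A1 * A2 / (R ^ n * R ^ n))"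
        using mult_left_mono[OF 1, of "real n"] by (simp add: abs_mult)
      moreover have "0 \<le> \<delta> / (r t)\<^sup>2 * (real n)\<^sup>2 * (norm (x n t))\<^sup>2" using \<delta>_pos by simp
      moreover have "\<delta> / (r t)\<^sup>2 * (real n)\<^sup>2 * (norm (x n t))\<^sup>2 \<le> \<delta> / r0\<^sup>2 * (real n)\<^sup>2 * (A1\<^sup>2 / (R ^ n * R ^ n))"
        using 2 3 \<delta>_pos by (intro mult_mono mult_nonneg_nonneg) auto
      ultimately have "\<bar>real n * inner (y n t) (x n t) + \<delta> / (r t)\<^sup>2 * (real n)\<^sup>2 * (norm (x n t))\<^sup>2\<bar>
          \<le> real n * (A1 * A2 / (R ^ n * R ^ n)) + \<delta> / r0\<^sup>2 * (real n)\<^sup>2 * (A1\<^sup>2 / (R ^ n * R ^ n))"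
        by linarith
      then show ?thesis unfolding e_def abs_mult using r(4)[OF t] by (simp add: mult_right_mono)
    qed
    also have "\<dots> = (A1 * A2 * real n + \<delta> / r0\<^sup>2 * A1\<^sup>2 * (real n)\<^sup>2) * (r t ^ (2 * n) / (R ^ n * R ^ n))"
      by (simp add: algebra_simps add_divide_distrib)
    also have "\<dots> \<le> b n" unfolding b_def
      using A1(1) A2(1) \<delta>_pos by (intro mult_left_mono qR t) auto
    finally show ?thesis .
  qed
  have b_nonneg: "0 \<le> b n" for n using e_bound[of 0 n] T by simp
  have "summable (\<lambda>n. A1 * A2 * (real n ^ 1 * q ^ n) + \<delta> / r0\<^sup>2 * A1\<^sup>2 * (real n ^ 2 * q ^ n))"
    by (intro summable_add summable_mult summable_power_times_geometric) (use q in auto)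
  then have sb: "summable b" unfolding b_def[abs_def] by (simp add: algebra_simps)
  define tail where "tail M = suminf b - (\<Sum>n<M. b n)" for M
  have e_sum: "(\<Sum>n<M. e n t) \<le> tail M" if t: "t \<in> {0..T}" for M t
  proof -
    have t0: "0 \<le> t" using t by simp
    have F: "f \<circ> flow t holomorphic_on unit_disc" by (rule comp_flow_holomorphic[OF f t0])
    have yx: "taylor_coeff (drift (f \<circ> flow t)) n = y n t" for n
      unfolding y_def by (rule taylor_coeff_cong) (simp add: drift_comp_flow[OF f t0])
    obtain S where S: "S \<le> 0" "(\<lambda>n. e n t) sums S"
      using energy_flux[OF F r(3-5)[OF t]] unfolding yx e_def x_def by blast
    have "(\<lambda>n. e n t + b n) sums (S + suminf b)" by (intro sums_add S summable_sums sb)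
    moreover have "0 \<le> e n t + b n" for n using e_bound[OF t, of n] by linarith
    ultimately have "(\<Sum>n<M. e n t + b n) \<le> S + suminf b"
      using sum_le_suminf[of "\<lambda>n. e n t + b n" "{..<M}"] by (simp add: sums_iff)
    then show ?thesis using S(1) by (simp add: tail_def sum.distrib)
  qed
  have E_step: "E M T \<le> E M 0 + T * (2 * tail M)" for M
  proof -
    define E' where "E' t = (\<Sum>n<M. real n * (2 * inner (y n t) (x n t)) * r t ^ (2 * n)
        + real n * (norm (x n t))\<^sup>2 * (real (2 * n) * r t ^ (2 * n - 1) * \<delta>))" for t
    have der: "(E M has_derivative (\<lambda>h. h * E' t)) (at t within {0..T})" if t: "t \<in> {0..T}" for t
    proof -
      have nrm: "((\<lambda>t. (norm (x n t))\<^sup>2) has_real_derivative 2 * inner (y n t) (x n t)) (at t within {0..T})" for n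
      proof -
        have "(x n has_vector_derivative y n t) (at t within {0..T})"
          unfolding x_def[abs_def] y_def
          by (rule has_vector_derivative_within_subset[OF taylor_coeff_comp_flow_derivative[OF f]]) (use t in auto)
        from bounded_bilinear.has_vector_derivative[OF bounded_bilinear_inner this this]
        show ?thesis
          by (simp add: power2_norm_eq_inner has_real_derivative_iff_has_vector_derivative inner_commute)
      qed
      have rd: "(r has_real_derivative \<delta>) (at t within {0..T})"
        unfolding r_def by (auto intro!: derivative_eq_intros)
      have "(E M has_real_derivative E' t) (at t within {0..T})"
        unfolding E_def[abs_def] E'_def
      proof (rule DERIV_sum)
        fix n
        show "((\<lambda>t. real n * (norm (x n t))\<^sup>2 * r t ^ (2 * n)) has_real_derivative
            real n * (2 * inner (y n t) (x n t)) * r t ^ (2 * n)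
            + real n * (norm (x n t))\<^sup>2 * (real (2 * n) * r t ^ (2 * n - 1) * \<delta>)) (at t within {0..T})"
          by (rule DERIV_cong[OF DERIV_mult[OF DERIV_cmult[OF nrm] DERIV_power[OF rd]]])
            (simp add: algebra_simps)
      qed
      then show ?thesis by (simp add: has_field_derivative_def mult.commute[of _ "E' t"] mult_commute_abs)
    qed
    obtain s where s: "s \<in> {0<..<T}" "E M T - E M 0 = (T - 0) * E' s"
      using mvt_simple[OF T(1), of "E M" "\<lambda>t h. h * E' t"] der by auto
    then have s': "s \<in> {0..T}" by simp
    have "E' s \<le> (\<Sum>n<M. 2 * e n s)"
      unfolding E'_def
    proof (rule sum_mono)
      fix n
      have "r s ^ (2 * n - 1) * real n \<le> r s ^ (2 * n) / (r s)\<^sup>2 * real n"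
      proof (cases n)
        case (Suc m)
        have "r s ^ (2 * n) / (r s)\<^sup>2 = r s ^ (2 * m)" using r(4)[OF s'] Suc by (simp add: power2_eq_square)
        moreover have "r s ^ (2 * n - 1) \<le> r s ^ (2 * m)" using r(4,5)[OF s'] Suc by (simp add: mult_left_le_one_le)
        ultimately show ?thesis by (simp add: mult_right_mono)
      qed simp
      then have "2 * \<delta> * real n * (norm (x n s))\<^sup>2 * (r s ^ (2 * n - 1) * real n)
          \<le> 2 * \<delta> * real n * (norm (x n s))\<^sup>2 * (r s ^ (2 * n) / (r s)\<^sup>2 * real n)"
        using \<delta>_pos by (intro mult_left_mono) auto
      then show "real n * (2 * inner (y n s) (x n s)) * r s ^ (2 * n)
          + real n * (norm (x n s))\<^sup>2 * (real (2 * n) * r s ^ (2 * n - 1) * \<delta>) \<le> 2 * e n s"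
        by (simp add: e_def power2_eq_square algebra_simps)
    qed
    also have "\<dots> \<le> 2 * tail M" using e_sum[OF s', of M] by (simp add: sum_distrib_left[symmetric])
    finally have "T * E' s \<le> T * (2 * tail M)" using T by (intro mult_left_mono) auto
    then show ?thesis using s(2) by simp
  qed
  have "x n 0 = taylor_coeff f n" for n
    unfolding x_def by (rule taylor_coeff_cong) (simp add: flow_zero)
  then have E0: "E M 0 \<le> B" for M using B[of M] by (simp add: E_def r_def)
  have "E N T \<le> B + T * (2 * tail M)" if "M \<ge> N" for M
  proof -
    have "E N T \<le> E M T" unfolding E_def using that rT by (intro sum_mono2) auto
    then show ?thesis using E_step[of M] E0[of M] by linarith
  qed
  moreover have "(\<lambda>M. B + T * (2 * tail M)) \<longlonglongrightarrow> B + T * (2 * 0)"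
    unfolding tail_def using summable_LIMSEQ[OF sb] by (intro tendsto_intros) (auto intro: LIM_zero tendsto_eq_intros)
  ultimately have "E N T \<le> B + T * (2 * 0)"
    by (intro LIMSEQ_le_const[of "\<lambda>M. B + T * (2 * tail M)"]) auto
  then show ?thesis by (simp add: E_def r_def x_def)
qed

text \<open>The radius \<open>r0\<close> at time \<open>0\<close> tends to \<open>1 - \<delta> t\<close>, so that the final radius tends to \<open>1\<close>.\<close>

lemma dirichlet_sum_decay:
  assumes f: "f holomorphic_on unit_disc" and t: "t > 0" "\<delta> * t < \<epsilon>"
    and B: "\<And>M. (\<Sum>n<M. real n * (norm (taylor_coeff f n))\<^sup>2 * (1 - \<delta> * t) ^ (2 * n)) \<le> B"
  shows "(\<Sum>n<N. real n * (norm (taylor_coeff (f \<circ> flow t) n))\<^sup>2) \<le> B"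
proof -
  let ?x = "\<lambda>n. real n * (norm (taylor_coeff (f \<circ> flow t) n))\<^sup>2"
  have "(\<Sum>n<N. ?x n * 1 ^ (2 * n)) \<le> B"
  proof (rule sum_le_of_radius_limit)
    show "1 - \<epsilon> + \<delta> * t < 1" using t by simp
    fix r assume r: "1 - \<epsilon> + \<delta> * t < r" "r < 1"
    have d: "\<delta> * t > 0" using \<delta>_pos t by simp
    have "(\<Sum>n<N. ?x n * ((r - \<delta> * t) + \<delta> * t) ^ (2 * n)) \<le> B"
    proof (rule energy_decay[OF f _ t(1)])
      fix M
      have "(\<Sum>n<M. real n * (norm (taylor_coeff f n))\<^sup>2 * (r - \<delta> * t) ^ (2 * n))
          \<le> (\<Sum>n<M. real n * (norm (taylor_coeff f n))\<^sup>2 * (1 - \<delta> * t) ^ (2 * n))"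
        using r \<epsilon>_le by (intro sum_mono mult_left_mono power_mono) auto
      then show "(\<Sum>n<M. real n * (norm (taylor_coeff f n))\<^sup>2 * (r - \<delta> * t) ^ (2 * n)) \<le> B"
        using B[of M] by linarith
    qed (use r in auto)
    then show "(\<Sum>n<N. ?x n * r ^ (2 * n)) \<le> B" by simp
  qed
  then show ?thesis by simp
qed

end

section \<open>The semigroup of composition operators\<close>

text \<open>Only the coordinates of \<open>X\<close> are known to be differentiable. The mean value theorem is applied to the
  scalar product with a finite section of the vector that is to be estimated.\<close>

lemma l2_mean_value_inequality:
  fixes X Y :: "real \<Rightarrow> l2"
  assumes t: "0 < t"
    and X: "\<And>n s. s \<in> {0..t} \<Longrightarrow>
      ((\<lambda>s. coord (X s) n) has_vector_derivative coord (Y s) n) (at s within {0..t})"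
    and Y: "\<And>s. s \<in> {0..t} \<Longrightarrow> norm (Y s - y) \<le> \<eta>"
  shows "norm (X t - X 0 - t *\<^sub>R y) \<le> t * \<eta>"
proof (rule norm_l2_leI)
  have \<eta>: "0 \<le> \<eta>" using order_trans[OF norm_ge_zero Y[of 0]] t by simp
  then show "0 \<le> t * \<eta>" using t by simp
  define Z where "Z s = X s - X 0 - s *\<^sub>R y" for s
  fix N
  define b where "b = (\<Sum>n<N. cscale (coord (Z t) n) (basis_vec n))"
  have ib: "inner u b = (\<Sum>n<N. inner (coord u n) (coord (Z t) n))" for u
    unfolding b_def inner_sum_right
    by (simp add: inner_eq_Re_cin cin_cscale_right cin_basis_vec inner_complex_def algebra_simps)
  have cb: "coord b k = (if k < N then coord (Z t) k else 0)" for k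
    unfolding b_def by (simp add: if_distrib cong: if_cong)
  have bb: "inner (Z t) b = (\<Sum>n<N. (norm (coord (Z t) n))\<^sup>2)"
    unfolding ib by (simp add: power2_norm_eq_inner)
  moreover have "inner b b = (\<Sum>n<N. (norm (coord (Z t) n))\<^sup>2)"
    unfolding ib by (simp add: cb power2_norm_eq_inner)
  ultimately have Zb: "inner (Z t) b = (norm b)\<^sup>2" by (simp add: power2_norm_eq_inner)
  have "((\<lambda>s. inner (Z s) b) has_derivative (\<lambda>h. h * inner (Y s - y) b)) (at s within {0..t})"
    if s: "s \<in> {0..t}" for s
  proof -
    have "((\<lambda>s. coord (Z s) n) has_vector_derivative coord (Y s - y) n) (at s within {0..t})" for n
      unfolding Z_def by (auto intro!: derivative_eq_intros X s)
    then have "((\<lambda>s. inner (coord (Z s) n) (coord (Z t) n)) has_vector_derivative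
        inner (coord (Y s - y) n) (coord (Z t) n)) (at s within {0..t})" for n
      by (rule bounded_linear.has_vector_derivative[OF bounded_linear_inner_left])
    then have "((\<lambda>s. inner (Z s) b) has_vector_derivative inner (Y s - y) b) (at s within {0..t})"
      unfolding ib by (intro has_vector_derivative_sum)
    then show ?thesis by (simp add: has_vector_derivative_def)
  qed
  then obtain s where s: "s \<in> {0<..<t}" "inner (Z t) b - inner (Z 0) b = (t - 0) * inner (Y s - y) b"
    using mvt_simple[OF t, of "\<lambda>s. inner (Z s) b" "\<lambda>s h. h * inner (Y s - y) b"] by auto
  have "Z 0 = 0" by (simp add: Z_def)
  then have "(norm b)\<^sup>2 = t * inner (Y s - y) b" using s(2) by (simp add: Zb)
  also have "\<dots> \<le> t * (norm (Y s - y) * norm b)" using t by (intro mult_left_mono norm_cauchy_schwarz) auto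
  also have "\<dots> \<le> t * (\<eta> * norm b)" using t s(1) by (intro mult_left_mono mult_right_mono Y) auto
  finally have "norm b * norm b \<le> (t * \<eta>) * norm b" by (simp add: power2_eq_square)
  then have "norm b \<le> t * \<eta>" using t \<eta> by (cases "norm b = 0") auto
  then have "(norm b)\<^sup>2 \<le> (t * \<eta>)\<^sup>2" by (rule power_mono) simp
  then show "(\<Sum>n<N. (norm (coord (X t - X 0 - t *\<^sub>R y) n))\<^sup>2) \<le> (t * \<eta>)\<^sup>2"
    using bb Zb by (simp add: Z_def)
qed

lemma difference_quotient_tendsto:
  fixes X :: "real \<Rightarrow> complex"
  assumes "(X has_vector_derivative D) (at 0 within {0..})"
  shows "((\<lambda>t. (X t - X 0) / of_real t) \<longlongrightarrow> D) (at_right 0)"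
proof -
  have "((\<lambda>t. (1 / norm (t - 0)) *\<^sub>R (X t - (X 0 + (t - 0) *\<^sub>R D))) \<longlongrightarrow> 0) (at 0 within {0..})"
    using assms unfolding has_vector_derivative_def has_derivative_within by blast
  then have "((\<lambda>t. (1 / norm (t - 0)) *\<^sub>R (X t - (X 0 + (t - 0) *\<^sub>R D))) \<longlongrightarrow> 0) (at_right 0)"
    by (rule tendsto_within_subset) auto
  moreover have "\<forall>\<^sub>F t in at_right 0. (1 / norm (t - 0)) *\<^sub>R (X t - (X 0 + (t - 0) *\<^sub>R D)) = (X t - X 0) / of_real t - D"
    using eventually_at_right_less[of 0]
    by eventually_elim (simp add: scaleR_conv_of_real field_simps)
  ultimately have "((\<lambda>t. (X t - X 0) / of_real t - D) \<longlongrightarrow> 0) (at_right 0)"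
    by (rule Lim_transform_eventually)
  then show ?thesis by (rule LIM_zero_cancel)
qed

text \<open>What a space must provide: a bound \<open>size_bound f t\<close> for the squared norm of \<open>f \<circ> \<phi>\<^sub>t\<close>, for short times, that
  is bounded in terms of the norm of \<open>f\<close> (continuity of the operators) and tends to the squared norm
  of \<open>f\<close> itself (strong continuity), and summability on the basis (compactness and trace).\<close>

locale flow_space = inward_field + disc_weight +
  fixes \<tau> :: real and K :: "real \<Rightarrow> real" and size_bound :: "(complex \<Rightarrow> complex) \<Rightarrow> real \<Rightarrow> real"
  assumes \<tau>_pos: "\<tau> > 0"
    and coeff_sum_le: "f \<in> vecs H \<Longrightarrow> 0 < t \<Longrightarrow> t < \<tau> \<Longrightarrow>
      (\<Sum>n<N. w n * (norm (taylor_coeff (f \<circ> flow t) n))\<^sup>2) \<le> size_bound f t"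
    and size_bound_le: "f \<in> vecs H \<Longrightarrow> 0 < t \<Longrightarrow> t < \<tau> \<Longrightarrow> size_bound f t \<le> K t * (hnorm H f)\<^sup>2"
    and size_bound_tendsto: "f \<in> vecs H \<Longrightarrow> (size_bound f \<longlongrightarrow> (hnorm H f)\<^sup>2) (at_right 0)"
    and summable_image_basis: "0 < t \<Longrightarrow> t < \<tau> \<Longrightarrow>
      summable (\<lambda>n. hnorm H (on_disc (of_l2 (basis_vec n) \<circ> flow t)))"
begin

definition comp :: "real \<Rightarrow> operator"
  where "comp t f = on_disc (f \<circ> flow t)"

lemma taylor_coeff_comp [simp]: "taylor_coeff (comp t f) n = taylor_coeff (f \<circ> flow t) n"
  by (simp add: comp_def)

lemma comp_0: "f \<in> vecs H \<Longrightarrow> comp 0 f = f"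
  by (auto simp: comp_def on_disc_def flow_zero vecs_iff fun_eq_iff)

lemma comp_add: "0 \<le> t \<Longrightarrow> 0 \<le> s \<Longrightarrow> comp (t + s) f = comp t (comp s f)"
  using flow_disc[of t] flow_semigroup[of s t]
  by (auto simp: comp_def on_disc_def fun_eq_iff add.commute)

lemma comp_holomorphic: "f \<in> vecs H \<Longrightarrow> 0 \<le> t \<Longrightarrow> comp t f holomorphic_on unit_disc"
  unfolding comp_def by (intro holomorphic_on_disc comp_flow_holomorphic vecs_holomorphic)

lemma comp_short:
  assumes f: "f \<in> vecs H" and t: "0 < t" "t < \<tau>"
  shows "comp t f \<in> vecs H" "(norm (to_l2 (comp t f)))\<^sup>2 \<le> size_bound f t"
proof -
  have "summable (\<lambda>n. w n * (norm (taylor_coeff (comp t f) n))\<^sup>2)"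
    by (rule summableI_nonneg_bounded[of _ "size_bound f t"])
      (use coeff_sum_le[OF f t] w_pos in \<open>auto simp: less_imp_le\<close>)
  then show v: "comp t f \<in> vecs H"
    using comp_holomorphic[OF f, of t] t by (simp add: vecs_iff) (simp add: comp_def on_disc_def)
  show "(norm (to_l2 (comp t f)))\<^sup>2 \<le> size_bound f t"
    using coeff_sum_le[OF f t] norm_to_l2_square[OF v]
    by (intro LIMSEQ_le_const2[OF norm_to_l2_square[OF v, unfolded sums_def]]) auto
qed

text \<open>The semigroup law extends the bounds from short times in steps of \<open>\<tau> / 2\<close>.\<close>

lemma comp_bounded:
  assumes "0 \<le> t"
  shows "\<exists>C. \<forall>f\<in>vecs H. comp t f \<in> vecs H \<and> hnorm H (comp t f) \<le> C * hnorm H f"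
proof -
  have short: "\<exists>C. \<forall>f\<in>vecs H. comp t f \<in> vecs H \<and> hnorm H (comp t f) \<le> C * hnorm H f"
    if t: "0 \<le> t" "t < \<tau>" for t
  proof (cases "t = 0")
    case True
    then show ?thesis by (intro exI[of _ 1]) (simp add: comp_0)
  next
    case False
    with t have t': "0 < t" "t < \<tau>" by auto
    have "hnorm H (comp t f) \<le> sqrt \<bar>K t\<bar> * hnorm H f" if f: "f \<in> vecs H" for f
    proof (rule power2_le_imp_le)
      have "(hnorm H (comp t f))\<^sup>2 \<le> K t * (hnorm H f)\<^sup>2"
        using comp_short[OF f t'] size_bound_le[OF f t'] by (simp add: hnorm_eq)
      also have "\<dots> \<le> \<bar>K t\<bar> * (hnorm H f)\<^sup>2" by (intro mult_right_mono) auto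
      finally show "(hnorm H (comp t f))\<^sup>2 \<le> (sqrt \<bar>K t\<bar> * hnorm H f)\<^sup>2" by (simp add: power_mult_distrib)
    qed (use f in \<open>simp add: hnorm_eq\<close>)
    then show ?thesis using comp_short(1)[OF _ t'] by blast
  qed
  have "\<exists>C. \<forall>f\<in>vecs H. comp t f \<in> vecs H \<and> hnorm H (comp t f) \<le> C * hnorm H f"
    if "0 \<le> t" "t \<le> real n * (\<tau> / 2)" for n t
    using that
  proof (induction n arbitrary: t)
    case 0
    then show ?case using short[of t] \<tau>_pos by simp
  next
    case (Suc n)
    show ?case
    proof (cases "t < \<tau>")
      case True
      then show ?thesis using short Suc.prems by simp
    next
      case False
      define s where "s = t - \<tau> / 2"
      have s: "0 \<le> s" "s \<le> real n * (\<tau> / 2)" "t = \<tau> / 2 + s"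
        using False Suc.prems \<tau>_pos by (auto simp: s_def field_simps)
      obtain C1 where C1: "\<And>f. f \<in> vecs H \<Longrightarrow> comp s f \<in> vecs H \<and> hnorm H (comp s f) \<le> C1 * hnorm H f"
        using Suc.IH[OF s(1,2)] by blast
      obtain C2 where C2: "\<And>f. f \<in> vecs H \<Longrightarrow> comp (\<tau> / 2) f \<in> vecs H \<and> hnorm H (comp (\<tau> / 2) f) \<le> C2 * hnorm H f"
        using short[of "\<tau> / 2"] \<tau>_pos by auto
      have "comp t f \<in> vecs H \<and> hnorm H (comp t f) \<le> (\<bar>C2\<bar> * C1) * hnorm H f" if f: "f \<in> vecs H" for f
      proof -
        have e: "comp t f = comp (\<tau> / 2) (comp s f)"
          unfolding s(3) using \<tau>_pos s(1) by (intro comp_add) auto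
        have v: "comp s f \<in> vecs H" using C1[OF f] by blast
        have "hnorm H (comp t f) \<le> C2 * hnorm H (comp s f)" unfolding e using C2[OF v] by blast
        also have "\<dots> \<le> \<bar>C2\<bar> * hnorm H (comp s f)" by (intro mult_right_mono) (auto simp: hnorm_eq v)
        also have "\<dots> \<le> \<bar>C2\<bar> * (C1 * hnorm H f)" using C1[OF f] by (intro mult_left_mono) auto
        finally show ?thesis using C2[OF v] by (simp add: e mult.assoc)
      qed
      then show ?thesis by blast
    qed
  qed
  moreover obtain n where "t / (\<tau> / 2) \<le> real n" using real_arch_simple by blast
  then have "t \<le> real n * (\<tau> / 2)" using \<tau>_pos by (simp add: field_simps)
  ultimately show ?thesis using assms by blast
qed

lemma comp_vecs: "0 \<le> t \<Longrightarrow> f \<in> vecs H \<Longrightarrow> comp t f \<in> vecs H"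
  using comp_bounded by blast

lemma bounded_operator_comp: "0 \<le> t \<Longrightarrow> bounded_operator H (comp t)"
  unfolding bounded_operator_def
  using comp_bounded[of t] by (auto simp: comp_def on_disc_def fun_eq_iff)

lemma coord_comp: "0 \<le> t \<Longrightarrow> f \<in> vecs H \<Longrightarrow>
    coord (to_l2 (comp t f)) n = of_real (sqrt (w n)) * taylor_coeff (f \<circ> flow t) n"
  by (simp add: coord_to_l2 comp_vecs)

lemma coord_comp_derivative:
  assumes f: "f \<in> vecs H" and t: "0 \<le> t"
  shows "((\<lambda>t. coord (to_l2 (comp t f)) n) has_vector_derivative
    of_real (sqrt (w n)) * taylor_coeff (drift f \<circ> flow t) n) (at t within {0..})"
proof (rule has_vector_derivative_transform[where f = "\<lambda>t. of_real (sqrt (w n)) * taylor_coeff (f \<circ> flow t) n"])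
  show "((\<lambda>t. of_real (sqrt (w n)) * taylor_coeff (f \<circ> flow t) n) has_vector_derivative
    of_real (sqrt (w n)) * taylor_coeff (drift f \<circ> flow t) n) (at t within {0..})"
    by (rule bounded_linear.has_vector_derivative[OF bounded_linear_mult_right
          taylor_coeff_comp_flow_derivative[OF vecs_holomorphic[OF f] t]])
qed (use t f in \<open>auto simp: coord_comp\<close>)

text \<open>The Taylor coefficients are continuous in \<open>t\<close>, and the norms do not exceed that of \<open>f\<close> in the limit.\<close>

lemma comp_tendsto:
  assumes f: "f \<in> vecs H"
  shows "((\<lambda>t. to_l2 (comp t f)) \<longlongrightarrow> to_l2 f) (at_right 0)"
proof (rule tendsto_of_coord_norm)
  show "(size_bound f \<longlongrightarrow> (norm (to_l2 f))\<^sup>2) (at_right 0)"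
    using size_bound_tendsto[OF f] f by (simp add: hnorm_eq)
  show "\<forall>\<^sub>F t in at_right 0. (norm (to_l2 (comp t f)))\<^sup>2 \<le> size_bound f t"
    using eventually_at_right_real[OF \<tau>_pos] by eventually_elim (use comp_short(2)[OF f] in auto)
  fix n
  have "continuous (at 0 within {0..}) (\<lambda>t. coord (to_l2 (comp t f)) n)"
    by (rule has_vector_derivative_continuous[OF coord_comp_derivative[OF f]]) simp
  then have "((\<lambda>t. coord (to_l2 (comp t f)) n) \<longlongrightarrow> coord (to_l2 f) n) (at 0 within {0..})"
    by (simp add: continuous_within comp_0 f)
  then show "((\<lambda>t. coord (to_l2 (comp t f)) n) \<longlongrightarrow> coord (to_l2 f) n) (at_right 0)"
    by (rule tendsto_within_subset) auto
qed

lemma C0_semigroup_comp: "C0_semigroup H comp"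
  unfolding C0_semigroup_def
proof (intro conjI allI impI ballI)
  fix f assume f: "f \<in> vecs H"
  have "\<forall>\<^sub>F t in at_right 0. comp t f \<in> vecs H"
    using eventually_at_right_less[of 0] by eventually_elim (use comp_vecs f in auto)
  then show "limitin (htopology H) (\<lambda>t. comp t f) f (at_right 0)"
    unfolding limitin_iff using f comp_tendsto[OF f] by blast
qed (simp_all add: bounded_operator_comp comp_0 comp_add)

lemma quotient_vecs:
  assumes f: "f \<in> vecs H" and t: "0 \<le> t"
  shows "(\<lambda>z. (comp t f z - f z) / of_real t) \<in> vecs H"
    "to_l2 (\<lambda>z. (comp t f z - f z) / of_real t) = (1 / t) *\<^sub>R (to_l2 (comp t f) - to_l2 f)"
proof -
  note d = to_l2_diff[OF comp_vecs[OF t f] f]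
  show "(\<lambda>z. (comp t f z - f z) / of_real t) \<in> vecs H"
    "to_l2 (\<lambda>z. (comp t f z - f z) / of_real t) = (1 / t) *\<^sub>R (to_l2 (comp t f) - to_l2 f)"
    using to_l2_cmult[OF d(1), of "of_real (1 / t)"] unfolding d(2) cscale_of_real
    by (simp_all add: field_simps)
qed

text \<open>Norm limits of difference quotients are limits of Taylor coefficients, and those are known.\<close>

lemma generator_subset: "generator H comp \<subseteq> diff_operator H G"
proof safe
  fix f g assume "(f, g) \<in> generator H comp"
  then have f: "f \<in> vecs H" and g: "g \<in> vecs H"
    and lim: "((\<lambda>t. to_l2 (\<lambda>z. (comp t f z - f z) / of_real t)) \<longlongrightarrow> to_l2 g) (at_right 0)"
    unfolding generator_def limitin_iff by auto
  have "taylor_coeff g n = taylor_coeff (drift f) n" for n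
  proof -
    have 1: "((\<lambda>t. coord (to_l2 (\<lambda>z. (comp t f z - f z) / of_real t)) n) \<longlongrightarrow> coord (to_l2 g) n) (at_right 0)"
      by (rule bounded_linear.tendsto[OF bounded_linear_coord lim])
    have "((\<lambda>t. (coord (to_l2 (comp t f)) n - coord (to_l2 (comp 0 f)) n) / of_real t)
        \<longlongrightarrow> of_real (sqrt (w n)) * taylor_coeff (drift f \<circ> flow 0) n) (at_right 0)"
      by (rule difference_quotient_tendsto[OF coord_comp_derivative[OF f order_refl]])
    moreover have "\<forall>\<^sub>F t in at_right 0. (coord (to_l2 (comp t f)) n - coord (to_l2 (comp 0 f)) n) / of_real t
        = coord (to_l2 (\<lambda>z. (comp t f z - f z) / of_real t)) n"
      using eventually_at_right_less[of 0] by eventually_elim (simp add: quotient_vecs f comp_0)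
    ultimately have "((\<lambda>t. coord (to_l2 (\<lambda>z. (comp t f z - f z) / of_real t)) n)
        \<longlongrightarrow> of_real (sqrt (w n)) * taylor_coeff (drift f \<circ> flow 0) n) (at_right 0)"
      by (rule Lim_transform_eventually)
    from tendsto_unique[OF _ 1 this]
    have "coord (to_l2 g) n = of_real (sqrt (w n)) * taylor_coeff (drift f \<circ> flow 0) n" by simp
    also have "taylor_coeff (drift f \<circ> flow 0) n = taylor_coeff (drift f) n"
      by (rule taylor_coeff_cong) (simp add: flow_zero)
    finally show ?thesis using w_pos[of n] by (simp add: coord_to_l2 g)
  qed
  then have "g z = on_disc (drift f) z" for z
    using taylor_coeff_inject[OF vecs_holomorphic[OF g] drift_holomorphic[OF vecs_holomorphic[OF f]], of z] g
    by (auto simp: on_disc_def vecs_iff)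
  then show "(f, g) \<in> diff_operator H G"
    using f g unfolding diff_operator_def by (auto simp: drift_def[abs_def] fun_eq_iff on_disc_def)
qed

text \<open>The coefficients of \<open>T(t) f\<close> have those of \<open>T(t) g\<close> as derivatives, and \<open>T(t) g\<close> is close to \<open>g\<close> in norm for
  small \<open>t\<close>; the mean value inequality then bounds \<open>T(t) f - f - t g\<close> by \<open>t\<close> times this distance.\<close>

lemma diff_operator_subset: "diff_operator H G \<subseteq> generator H comp"
proof safe
  fix f g assume "(f, g) \<in> diff_operator H G"
  then have f: "f \<in> vecs H" and g: "g \<in> vecs H" and g_eq: "g = on_disc (drift f)"
    unfolding diff_operator_def drift_def[abs_def] by auto
  let ?q = "\<lambda>t z. (comp t f z - f z) / of_real t"
  have der: "((\<lambda>s. coord (to_l2 (comp s f)) n) has_vector_derivative coord (to_l2 (comp s g)) n) (at s within {0..t})"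
    if s: "s \<in> {0..t}" for n s t
  proof -
    have "taylor_coeff (drift f \<circ> flow s) n = taylor_coeff (g \<circ> flow s) n"
      by (rule taylor_coeff_cong) (use s flow_disc[of s] in \<open>simp add: g_eq on_disc_def\<close>)
    then show ?thesis
      using has_vector_derivative_within_subset[OF coord_comp_derivative[OF f, of s n], of "{0..t}"] s
      by (auto simp: coord_comp g)
  qed
  have "((\<lambda>t. to_l2 (?q t)) \<longlongrightarrow> to_l2 g) (at_right 0)"
  proof (rule tendstoI)
    fix e :: real assume e: "e > 0"
    have "\<forall>\<^sub>F t in at_right 0. dist (to_l2 (comp t g)) (to_l2 g) < e / 2"
      by (rule tendstoD[OF comp_tendsto[OF g]]) (use e in simp)
    then obtain h where h: "h > 0" "\<And>s. 0 < s \<Longrightarrow> s < h \<Longrightarrow> dist (to_l2 (comp s g)) (to_l2 g) < e / 2"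
      unfolding eventually_at_right_field by auto
    have "dist (to_l2 (?q t)) (to_l2 g) < e" if t: "0 < t" "t < h" for t
    proof -
      have "norm (to_l2 (comp t f) - to_l2 (comp 0 f) - t *\<^sub>R to_l2 g) \<le> t * (e / 2)"
      proof (rule l2_mean_value_inequality[OF t(1) der])
        fix s assume s: "s \<in> {0..t}"
        show "norm (to_l2 (comp s g) - to_l2 g) \<le> e / 2"
        proof (cases "s = 0")
          case True
          then show ?thesis using e by (simp add: comp_0 g)
        next
          case False
          then show ?thesis using h(2)[of s] s t by (simp add: dist_norm)
        qed
      qed
      from mult_left_mono[OF this, of "1 / t"] t
      have "norm ((1 / t) *\<^sub>R (to_l2 (comp t f) - to_l2 f - t *\<^sub>R to_l2 g)) \<le> (1 / t) * (t * (e / 2))"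
        unfolding norm_scaleR by (simp add: comp_0 f)
      moreover have "(1 / t) *\<^sub>R (to_l2 (comp t f) - to_l2 f - t *\<^sub>R to_l2 g) = to_l2 (?q t) - to_l2 g"
        using t by (simp add: quotient_vecs f scaleR_diff_right)
      ultimately show ?thesis using t e by (simp add: dist_norm)
    qed
    then show "\<forall>\<^sub>F t in at_right 0. dist (to_l2 (?q t)) (to_l2 g) < e"
      unfolding eventually_at_right_field using h(1) by blast
  qed
  moreover have "\<forall>\<^sub>F t in at_right 0. ?q t \<in> vecs H"
    using eventually_at_right_less[of 0] by eventually_elim (simp add: quotient_vecs f)
  ultimately show "(f, g) \<in> generator H comp"
    unfolding generator_def limitin_iff using f g by simp
qed

text \<open>For long times, \<open>T(t) = T(t - s) T(s)\<close> with \<open>s\<close> short and \<open>T(t - s)\<close> bounded.\<close>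

lemma summable_comp_basis:
  assumes t: "0 < t"
  shows "summable (\<lambda>n. hnorm H (comp t (of_l2 (basis_vec n))))"
proof (cases "t < \<tau>")
  case True
  then show ?thesis using summable_image_basis[OF t] by (simp add: comp_def)
next
  case False
  define s where "s = \<tau> / 2"
  have s: "0 < s" "s < \<tau>" "0 \<le> t - s" using False \<tau>_pos by (auto simp: s_def)
  obtain C where C: "\<And>f. f \<in> vecs H \<Longrightarrow> comp (t - s) f \<in> vecs H \<and> hnorm H (comp (t - s) f) \<le> C * hnorm H f"
    using comp_bounded[OF s(3)] by blast
  have v: "comp s (of_l2 x) \<in> vecs H" for x
    using comp_vecs s(1) of_l2_vecs by simp
  have "summable (\<lambda>n. C * hnorm H (comp s (of_l2 (basis_vec n))))"
    using summable_image_basis[OF s(1,2)] by (intro summable_mult) (simp add: comp_def)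
  then show ?thesis
  proof (rule summable_comparison_test')
    fix n :: nat assume "n \<ge> 0"
    have "comp t (of_l2 (basis_vec n)) = comp (t - s) (comp s (of_l2 (basis_vec n)))"
      using comp_add[of "t - s" s] s by simp
    moreover have "0 \<le> hnorm H (comp t (of_l2 (basis_vec n)))"
      using t by (simp add: hnorm_eq comp_vecs of_l2_vecs)
    ultimately show "norm (hnorm H (comp t (of_l2 (basis_vec n)))) \<le> C * hnorm H (comp s (of_l2 (basis_vec n)))"
      using C[OF v] by simp
  qed
qed

theorem trace_class_semigroup:
  "\<exists>T. C0_semigroup H T \<and> generator H T = diff_operator H G \<and>
     (\<forall>t\<ge>0. composition_operator H (T t)) \<and>
     (\<forall>t>0. compact_operator H (T t)) \<and> (\<forall>t>0. trace_class_operator H (T t))"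
proof (intro exI[of _ comp] conjI allI impI)
  show "C0_semigroup H comp" by (rule C0_semigroup_comp)
  show "generator H comp = diff_operator H G"
    using generator_subset diff_operator_subset by blast
  show "composition_operator H (comp t)" if "0 \<le> t" for t
    unfolding composition_operator_def comp_def
    using flow_holomorphic[OF that] flow_disc[OF that] by blast
  show "compact_operator H (comp t)" "trace_class_operator H (comp t)" if "0 < t" for t
    using compact_of_summable trace_class_of_summable bounded_operator_comp summable_comp_basis that by simp_all
qed

end

context inward_field
begin

lemma flow_origin_tendsto: "((\<lambda>t. flow t 0) \<longlongrightarrow> 0) (at_right 0)"
proof -
  obtain R where R: "1 - \<epsilon> < R" "0 < R" "R < 1" by (rule ex_radius)
  obtain C h where C: "C > 0" "h > 0"
    "\<And>t z. 0 \<le> t \<Longrightarrow> t \<le> h \<Longrightarrow> z \<in> cball 0 R \<Longrightarrow> norm (id (flow t z) - id z) \<le> C * t"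
    using comp_flow_lipschitz[OF holomorphic_on_id R(1,3)] by blast
  show ?thesis
  proof (rule Lim_null_comparison)
    show "\<forall>\<^sub>F t in at_right 0. norm (flow t 0) \<le> C * t"
      using eventually_at_right_real[OF C(2)] by eventually_elim (use C(3)[of _ 0] R in auto)
    have "((\<lambda>t. C * t) \<longlongrightarrow> C * 0) (at_right 0)" by (intro tendsto_intros)
    then show "((\<lambda>t. C * t) \<longlongrightarrow> 0) (at_right 0)" by simp
  qed
qed

text \<open>The Dirichlet integral of \<open>z ^ n\<close> over the disc of radius \<open>1 - \<delta> t\<close> is \<open>\<pi> n (1 - \<delta> t)\<^sup>2\<^sup>n\<close>, and the
  constant coefficient of the image is \<open>\<phi>\<^sub>t(0) ^ n\<close>.\<close>

lemma monomial_decay: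
  assumes t: "0 < t" "t < \<epsilon> / \<delta>"
  shows "(\<Sum>k<N. max 1 (real k) * (norm (taylor_coeff ((\<lambda>z. z ^ n) \<circ> flow t) k))\<^sup>2)
    \<le> (real (Suc n) * max (norm (flow t 0)) (1 - \<delta> * t) ^ n)\<^sup>2"
proof -
  define c where "c = max (norm (flow t 0)) (1 - \<delta> * t)"
  have c: "0 \<le> c" unfolding c_def by (rule order_trans[OF norm_ge_zero max.cobounded1])
  have t': "\<delta> * t < \<epsilon>" using t \<delta>_pos by (simp add: field_simps)
  let ?p = "\<lambda>z::complex. z ^ n"
  let ?x = "\<lambda>k. (norm (taylor_coeff (?p \<circ> flow t) k))\<^sup>2"
  have hp: "?p holomorphic_on unit_disc" by (intro holomorphic_intros)
  have tc: "taylor_coeff ?p k = (if k = n then 1 else 0)" for k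
  proof (rule taylor_coeff_of_sums)
    fix z :: complex
    have "(\<lambda>k. if k = n then z ^ k else 0) sums z ^ n" by (rule sums_single)
    moreover have "(if k = n then 1 else 0) * z ^ k = (if k = n then z ^ k else 0)" for k by simp
    ultimately show "(\<lambda>k. (if k = n then 1 else 0) * z ^ k) sums z ^ n" by simp
  qed
  have "(\<Sum>k<N. real k * ?x k) \<le> real n * (1 - \<delta> * t) ^ (2 * n)"
  proof (rule dirichlet_sum_decay[OF hp t(1) t'])
    fix M
    have "(\<Sum>k<M. real k * (norm (taylor_coeff ?p k))\<^sup>2 * (1 - \<delta> * t) ^ (2 * k))
        = (\<Sum>k<M. if k = n then real n * (1 - \<delta> * t) ^ (2 * n) else 0)"
      by (rule sum.cong) (auto simp: tc)
    also have "\<dots> \<le> real n * (1 - \<delta> * t) ^ (2 * n)" by simp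
    finally show "(\<Sum>k<M. real k * (norm (taylor_coeff ?p k))\<^sup>2 * (1 - \<delta> * t) ^ (2 * k))
        \<le> real n * (1 - \<delta> * t) ^ (2 * n)" .
  qed
  also have "\<dots> \<le> real n * c ^ (2 * n)"
    using t' \<epsilon>_le by (intro mult_left_mono power_mono) (auto simp: c_def)
  finally have 1: "(\<Sum>k<N. real k * ?x k) \<le> real n * c ^ (2 * n)" .
  have "?x 0 = norm (flow t 0) ^ (2 * n)" by (simp add: norm_power power_mult power2_eq_square power_mult_distrib)
  also have "\<dots> \<le> c ^ (2 * n)" by (intro power_mono) (auto simp: c_def)
  finally have 2: "?x 0 \<le> c ^ (2 * n)" .
  have "(\<Sum>k<N. max 1 (real k) * ?x k) \<le> (\<Sum>k<N. (if k = 0 then ?x 0 else 0) + real k * ?x k)"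
    by (intro sum_mono) (auto simp: max_def)
  also have "\<dots> \<le> ?x 0 + (\<Sum>k<N. real k * ?x k)"
    unfolding sum.distrib by (intro add_right_mono) simp
  also have "\<dots> \<le> real (Suc n) * c ^ (2 * n)" using 1 2 by (simp add: algebra_simps)
  also have "\<dots> \<le> (real (Suc n))\<^sup>2 * c ^ (2 * n)"
    using c by (intro mult_right_mono) (auto simp: power2_eq_square)
  also have "\<dots> = (real (Suc n) * c ^ n)\<^sup>2" by (simp add: power_mult_distrib power_even_eq)
  finally show ?thesis by (simp add: c_def)
qed

end

context disc_weight
begin

lemma norm_taylor_coeff_le: "f \<in> vecs H \<Longrightarrow> norm (taylor_coeff f n) \<le> hnorm H f"
proof -
  assume f: "f \<in> vecs H"
  have "1 * norm (taylor_coeff f n) \<le> sqrt (w n) * norm (taylor_coeff f n)"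
    using w_ge[of n] by (intro mult_right_mono) auto
  also have "\<dots> = norm (coord (to_l2 f) n)" using w_pos[of n] by (simp add: coord_to_l2 f norm_mult)
  also have "\<dots> \<le> hnorm H f" by (simp add: hnorm_eq f norm_coord_le)
  finally show ?thesis by simp
qed

lemma norm_eval_le:
  assumes f: "f \<in> vecs H" and a: "a \<in> unit_disc"
  shows "norm (f a) \<le> hnorm H f / (1 - norm a)"
proof -
  have g: "(\<lambda>n. hnorm H f * norm a ^ n) sums (hnorm H f * (1 / (1 - norm a)))"
    using a by (intro sums_mult geometric_sums) simp
  have bd: "norm (taylor_coeff f n * a ^ n) \<le> hnorm H f * norm a ^ n" for n
    by (simp add: norm_mult norm_power mult_right_mono norm_taylor_coeff_le f)
  have "norm (\<Sum>n. taylor_coeff f n * a ^ n) \<le> (\<Sum>n. hnorm H f * norm a ^ n)"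
    by (rule norm_suminf_le[OF bd sums_summable[OF g]])
  then show ?thesis using g taylor_coeff_sums[OF vecs_holomorphic[OF f] a] by (simp add: sums_iff)
qed

end

text \<open>Weights between those of the Hardy and the Dirichlet space: in all of them the decay of the
  monomials in the Dirichlet norm is enough.\<close>

locale small_weight = inward_field + disc_weight +
  assumes w_le: "w n \<le> max 1 (real n)"
begin

lemma summable_monomial_images:
  assumes t: "0 < t" "t < \<epsilon> / \<delta>"
  shows "summable (\<lambda>n. hnorm H (on_disc (of_l2 (basis_vec n) \<circ> flow t)))"
proof -
  define c where "c = max (norm (flow t 0)) (1 - \<delta> * t)"
  have "0 \<le> c" "c < 1"
    using flow_disc[of t 0] t \<delta>_pos unfolding c_def by (auto intro: order_trans[OF norm_ge_zero max.cobounded1])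
  then have "summable (\<lambda>n. real n ^ 1 * c ^ n + real n ^ 0 * c ^ n)"
    by (intro summable_add summable_power_times_geometric) auto
  then have sc: "summable (\<lambda>n. real (Suc n) * c ^ n)" by (simp add: algebra_simps)
  have "hnorm H (on_disc (of_l2 (basis_vec n) \<circ> flow t)) \<le> real (Suc n) * c ^ n \<and>
     0 \<le> hnorm H (on_disc (of_l2 (basis_vec n) \<circ> flow t))" for n
  proof -
    let ?g = "on_disc (of_l2 (basis_vec n) \<circ> flow t)"
    have e: "of_l2 (basis_vec n) z = z ^ n / of_real (sqrt (w n))" if z: "z \<in> unit_disc" for z
    proof -
      have "(\<lambda>k. if k = n then z ^ k / of_real (sqrt (w k)) else 0) sums (z ^ n / of_real (sqrt (w n)))"
        by (rule sums_single)
      moreover have "coord (basis_vec n) k / of_real (sqrt (w k)) * z ^ k = (if k = n then z ^ k / of_real (sqrt (w k)) else 0)" for k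
        by simp
      ultimately show ?thesis using of_l2_sums[OF z, of "basis_vec n"] sums_unique2 by simp
    qed
    have hol: "(\<lambda>z. z ^ n) \<circ> flow t holomorphic_on unit_disc"
      using t by (intro comp_flow_holomorphic holomorphic_intros) auto
    have "taylor_coeff ?g k = (1 / of_real (sqrt (w n))) * taylor_coeff ((\<lambda>z. z ^ n) \<circ> flow t) k" for k
    proof -
      have "taylor_coeff ?g k = taylor_coeff (\<lambda>z. (1 / of_real (sqrt (w n))) * ((\<lambda>z. z ^ n) \<circ> flow t) z) k"
        by (rule taylor_coeff_cong) (use flow_disc[of t] t in \<open>simp add: on_disc_def e\<close>)
      then show ?thesis by (simp only: taylor_coeff_cmult[OF hol])
    qed
    then have "norm (taylor_coeff ?g k) \<le> norm (taylor_coeff ((\<lambda>z. z ^ n) \<circ> flow t) k)" for k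
      using w_ge[of n] w_pos[of n] mult_right_mono[of 1 "sqrt (w n)" "norm (taylor_coeff ((\<lambda>z. z ^ n) \<circ> flow t) k)"]
      by (simp add: norm_mult norm_divide divide_le_eq mult.commute)
    then have "w k * (norm (taylor_coeff ?g k))\<^sup>2 \<le> max 1 (real k) * (norm (taylor_coeff ((\<lambda>z. z ^ n) \<circ> flow t) k))\<^sup>2" for k
      using w_le[of k] w_pos[of k] by (intro mult_mono power_mono) auto
    then have S: "(\<Sum>k<N. w k * (norm (taylor_coeff ?g k))\<^sup>2) \<le> (real (Suc n) * c ^ n)\<^sup>2" for N
      unfolding c_def by (intro order_trans[OF sum_mono monomial_decay[OF t]])
    have "summable (\<lambda>k. w k * (norm (taylor_coeff ?g k))\<^sup>2)"
      by (rule summableI_nonneg_bounded[OF _ S]) (use w_pos in \<open>simp add: less_imp_le\<close>)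
    moreover have "?g holomorphic_on unit_disc"
      using t by (intro holomorphic_on_disc comp_flow_holomorphic of_l2_holomorphic) auto
    ultimately have v: "?g \<in> vecs H" by (simp add: vecs_iff) (simp add: on_disc_def)
    have "(norm (to_l2 ?g))\<^sup>2 \<le> (real (Suc n) * c ^ n)\<^sup>2"
      using S by (intro LIMSEQ_le_const2[OF norm_to_l2_square[OF v, unfolded sums_def]]) auto
    then have "norm (to_l2 ?g) \<le> real (Suc n) * c ^ n"
      by (rule power2_le_imp_le) (use \<open>0 \<le> c\<close> in simp)
    then show ?thesis by (simp add: hnorm_eq v)
  qed
  then show ?thesis by (intro summable_comparison_test'[OF sc]) simp
qed

end

context inward_field
begin

text \<open>The subordination bound tends to the squared norm because \<open>\<phi>\<^sub>t(0) \<rightarrow> 0\<close>.\<close>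

lemma hardy_trace_class_semigroup:
  "\<exists>T. C0_semigroup hardy_space T \<and> generator hardy_space T = diff_operator hardy_space G \<and>
     (\<forall>t\<ge>0. composition_operator hardy_space (T t)) \<and>
     (\<forall>t>0. compact_operator hardy_space (T t)) \<and> (\<forall>t>0. trace_class_operator hardy_space (T t))"
proof -
  define K where "K t = (1 + norm (flow t 0)) / (1 - norm (flow t 0))" for t
  interpret small_weight G \<delta> \<epsilon> "\<lambda>_. 1" by unfold_locales simp_all
  interpret flow_space G \<delta> \<epsilon> "\<lambda>_. 1" "\<epsilon> / \<delta>" K "\<lambda>f t. K t * (hnorm H f)\<^sup>2"
  proof
    show "0 < \<epsilon> / \<delta>" using \<epsilon>_pos \<delta>_pos by simp
    show "summable (\<lambda>n. hnorm H (on_disc (of_l2 (basis_vec n) \<circ> flow t)))" if "0 < t" "t < \<epsilon> / \<delta>" for t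
      using that by (rule summable_monomial_images)
    fix f assume f: "f \<in> vecs H"
    show "(\<Sum>n<N. 1 * (norm (taylor_coeff (f \<circ> flow t) n))\<^sup>2) \<le> K t * (hnorm H f)\<^sup>2" if "0 < t" for t N
    proof -
      have "flow t ` unit_disc \<subseteq> unit_disc" using flow_disc that by (meson image_subsetI less_imp_le)
      then show ?thesis
        using littlewood_subordination[OF vecs_holomorphic[OF f] _ flow_holomorphic, of "to_l2 f" t N] that f
        by (simp add: K_def coord_to_l2 hnorm_eq)
    qed
    have "((\<lambda>t. K t * (hnorm H f)\<^sup>2) \<longlongrightarrow> (1 + norm (0::complex)) / (1 - norm (0::complex)) * (hnorm H f)\<^sup>2) (at_right 0)"
      unfolding K_def by (intro tendsto_intros flow_origin_tendsto) simp
    then show "((\<lambda>t. K t * (hnorm H f)\<^sup>2) \<longlongrightarrow> (hnorm H f)\<^sup>2) (at_right 0)" by simp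
  qed simp
  show ?thesis using trace_class_semigroup unfolding hardy_space_def .
qed

lemma dirichlet_space_eq: "dirichlet_space = weighted_space (\<lambda>n. max 1 (real n))"
proof -
  have "(\<lambda>n. if n = 0 then 1 else real n) = (\<lambda>n. max 1 (real n))" by (auto simp: max_def)
  then show ?thesis by (simp add: dirichlet_space_def)
qed

text \<open>The seminorm does not increase, so only the constant coefficient \<open>f (\<phi>\<^sub>t(0))\<close> has to be controlled; it
  is bounded by point evaluation and tends to \<open>f 0\<close>.\<close>

lemma dirichlet_trace_class_semigroup:
  "\<exists>T. C0_semigroup dirichlet_space T \<and> generator dirichlet_space T = diff_operator dirichlet_space G \<and>
     (\<forall>t\<ge>0. composition_operator dirichlet_space (T t)) \<and>
     (\<forall>t>0. compact_operator dirichlet_space (T t)) \<and> (\<forall>t>0. trace_class_operator dirichlet_space (T t))"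
proof -
  define K where "K t = 1 + (1 / (1 - norm (flow t 0)))\<^sup>2" for t
  let ?w = "\<lambda>n. max 1 (real n)"
  interpret small_weight G \<delta> \<epsilon> ?w by unfold_locales simp_all
  define S where "S f t = (norm (f (flow t 0)))\<^sup>2 - (norm (f 0))\<^sup>2 + (hnorm H f)\<^sup>2" for f t
  have split: "?w n * a = (if n = 0 then a else 0) + real n * a" for n and a :: real
    by (auto simp: max_def)
  interpret flow_space G \<delta> \<epsilon> ?w "\<epsilon> / \<delta>" K S
  proof
    show "0 < \<epsilon> / \<delta>" using \<epsilon>_pos \<delta>_pos by simp
    show "summable (\<lambda>n. hnorm H (on_disc (of_l2 (basis_vec n) \<circ> flow t)))" if "0 < t" "t < \<epsilon> / \<delta>" for t
      using that by (rule summable_monomial_images)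
    fix f assume f: "f \<in> vecs H"
    note hf = vecs_holomorphic[OF f]
    show "(\<Sum>n<N. ?w n * (norm (taylor_coeff (f \<circ> flow t) n))\<^sup>2) \<le> S f t" if t: "0 < t" "t < \<epsilon> / \<delta>" for t N
    proof -
      let ?c = "\<lambda>n. (norm (taylor_coeff f n))\<^sup>2" and ?x = "\<lambda>n. (norm (taylor_coeff (f \<circ> flow t) n))\<^sup>2"
      have \<delta>t: "0 < \<delta> * t" "\<delta> * t < \<epsilon>" using t \<delta>_pos by (auto simp: field_simps)
      have seminorm: "(\<Sum>n<M. real n * ?c n) \<le> (hnorm H f)\<^sup>2 - (norm (f 0))\<^sup>2" for M
      proof -
        have "(\<Sum>n<Suc M. ?w n * ?c n) \<le> (hnorm H f)\<^sup>2"
          using sum_le_suminf[of "\<lambda>n. ?w n * ?c n" "{..<Suc M}"] norm_to_l2_square[OF f] f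
          by (simp add: sums_iff hnorm_eq)
        moreover have "(\<Sum>n<Suc M. ?w n * ?c n) = (norm (f 0))\<^sup>2 + (\<Sum>n<Suc M. real n * ?c n)"
          unfolding split sum.distrib by simp
        moreover have "(\<Sum>n<M. real n * ?c n) \<le> (\<Sum>n<Suc M. real n * ?c n)" by simp
        ultimately show ?thesis by linarith
      qed
      have "(\<Sum>n<N. real n * ?x n) \<le> (hnorm H f)\<^sup>2 - (norm (f 0))\<^sup>2"
      proof (rule dirichlet_sum_decay[OF hf t(1) \<delta>t(2)])
        fix M
        have "(\<Sum>n<M. real n * ?c n * (1 - \<delta> * t) ^ (2 * n)) \<le> (\<Sum>n<M. real n * ?c n)"
          using \<delta>t \<epsilon>_le by (intro sum_mono mult_right_le_one_le power_le_one) auto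
        then show "(\<Sum>n<M. real n * ?c n * (1 - \<delta> * t) ^ (2 * n)) \<le> (hnorm H f)\<^sup>2 - (norm (f 0))\<^sup>2"
          using seminorm[of M] by linarith
      qed
      moreover have "(\<Sum>n<N. if n = 0 then ?x n else 0) \<le> (norm (f (flow t 0)))\<^sup>2" by simp
      ultimately show ?thesis unfolding split sum.distrib S_def by linarith
    qed
    show "S f t \<le> K t * (hnorm H f)\<^sup>2" if t: "0 < t" for t
    proof -
      have "(norm (f (flow t 0)))\<^sup>2 \<le> (hnorm H f / (1 - norm (flow t 0)))\<^sup>2"
        using t by (intro power_mono norm_eval_le f flow_disc) auto
      moreover have "0 \<le> (norm (f 0))\<^sup>2" by simp
      moreover have "K t * (hnorm H f)\<^sup>2 = (hnorm H f)\<^sup>2 + (hnorm H f / (1 - norm (flow t 0)))\<^sup>2"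
        by (simp add: K_def power_divide algebra_simps)
      ultimately show ?thesis unfolding S_def by linarith
    qed
    have "isCont f 0"
      using holomorphic_on_imp_continuous_on[OF hf] by (simp add: continuous_on_eq_continuous_at)
    then have "((\<lambda>t. f (flow t 0)) \<longlongrightarrow> f 0) (at_right 0)"
      using flow_origin_tendsto by (rule isCont_tendsto_compose)
    then have "(S f \<longlongrightarrow> (norm (f 0))\<^sup>2 - (norm (f 0))\<^sup>2 + (hnorm H f)\<^sup>2) (at_right 0)"
      unfolding S_def[abs_def] by (intro tendsto_intros)
    then show "(S f \<longlongrightarrow> (hnorm H f)\<^sup>2) (at_right 0)" by simp
  qed
  show ?thesis using trace_class_semigroup unfolding dirichlet_space_eq .
qed

end

theorem theorem3p6:
  fixes G :: "complex \<Rightarrow> complex" and \<delta> :: real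
  assumes "G holomorphic_on unit_disc"
    and "\<delta> > 0"
    and "\<exists>\<epsilon>>0. \<forall>z. 1 - \<epsilon> < norm z \<and> norm z < 1 \<longrightarrow> Re (cnj z * G z) \<le> - \<delta>"
  shows "\<forall>H \<in> {hardy_space, dirichlet_space}. \<exists>T.
           C0_semigroup H T \<and>
           generator H T = diff_operator H G \<and>
           (\<forall>t\<ge>0. composition_operator H (T t)) \<and>
           (\<forall>t>0. compact_operator H (T t)) \<and>
           (\<forall>t>0. trace_class_operator H (T t))"
proof -
  obtain \<epsilon> where \<epsilon>: "\<epsilon> > 0" "\<And>z. 1 - \<epsilon> < norm z \<Longrightarrow> norm z < 1 \<Longrightarrow> Re (cnj z * G z) \<le> - \<delta>"
    using assms(3) by blast
  interpret inward_field G \<delta> "min \<epsilon> (1 / 2)"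
    by unfold_locales (use assms \<epsilon> in auto)
  show ?thesis using hardy_trace_class_semigroup dirichlet_trace_class_semigroup by simp
qed

end
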